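(* Fix $\beta>0$. Let $g:\mathbb{R}\to\mathbb{R}$ be measurable, $2\pi$-periodic, bounded, and $C^{2,q}$ in neighborhoods of $\frac{\pi}{2}$ and $-\frac{\pi}{2}$, with $0<q\le1$. For each $n$, let $(\theta_1,\ldots,\theta_n)$ be distributed according to the mirror-type point process with parameters $n$ and $\beta$. Let $B,N_1,N_2$ be independent random variables with $$B\sim\mathrm{Bernoulli}(\tfrac12),\qquad N_1\sim\mathcal{N}_{\mathbb{R}}\Big(\tfrac{2g''(\frac{\pi}{2})}{\beta},\tfrac{2g'(\frac{\pi}{2})^2}{\beta}\Big),\qquad N_2\sim\mathcal{N}_{\mathbb{R}}\Big(\tfrac{2g''(-\frac{\pi}{2})}{\beta},\tfrac{2g'(-\frac{\pi}{2})^2}{\beta}\Big),$$ and let $$\nu_1=\frac{g(\frac{\pi}{2})+g(-\frac{\pi}{2})}{2},\qquad \nu_2=\frac{g''(\frac{\pi}{2})+g''(-\frac{\pi}{2})}{\beta}.$$ Below, $\xrightarrow{\mathrm{law}}$ denotes convergence in distribution as $n\to\infty$. (a) Define $\mu_n=\frac1n\sum_{j=1}^n\delta_{\theta_j}$ and $\mu:=B\delta_{\frac{\pi}{2}}+(1-B)\delta_{-\frac{\pi}{2}}$. Then $$\int_{(-\pi,\pi]}g(x)\,d\mu_n(x)\xrightarrow{\mathrm{law}}\int_{(-\pi,\pi]}g(x)\,d\mu(x).$$ Equivalently, $$n^{-1}\Big(\sum_{j=1}^n g(\theta_j)-\nu_1n\Big)\xrightarrow{\mathrm{law}}\frac{g(\frac{\pi}{2})-g(-\frac{\pi}{2})}{2}(2B-1).$$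 (b) If $g(\frac{\pi}{2})=g(-\frac{\pi}{2})$ and $g'(\frac{\pi}{2})\ne0\ne g'(-\frac{\pi}{2})$, then $$\sum_{j=1}^n g(\theta_j)-\nu_1n\xrightarrow{\mathrm{law}}BN_1+(1-B)N_2.$$ In particular, if $g(\frac{\pi}{2})=g(-\frac{\pi}{2})$, $g'(\frac{\pi}{2})=g'(-\frac{\pi}{2})\neq0$ and $g''(\frac{\pi}{2})=g''(-\frac{\pi}{2})$, then $N_1$ and $N_2$ are equal in distribution and $$\sum_{j=1}^n g(\theta_j)-\nu_1n\xrightarrow{\mathrm{law}}N_1.$$ (c) If $g(\frac{\pi}{2})=g(-\frac{\pi}{2})$, $g'(\frac{\pi}{2})\ne0$ and $g'(-\frac{\pi}{2})=0$, then $$\sum_{j=1}^n g(\theta_j)-\nu_1n\xrightarrow{\mathrm{law}}BN_1+(1-B)\frac{2g''(-\frac{\pi}{2})}{\beta}.$$ Similarly, if $g(\frac{\pi}{2})=g(-\frac{\pi}{2})$, $g'(-\frac{\pi}{2})\ne0$ and $g'(\frac{\pi}{2})=0$, then $$\sum_{j=1}^n g(\theta_j)-\nu_1n\xrightarrow{\mathrm{law}}B\frac{2g''(\frac{\pi}{2})}{\beta}+(1-B)N_2.$$ (d) If $g(\frac{\pi}{2})=g(-\frac{\pi}{2})$ and $g'(\frac{\pi}{2})=0=g'(-\frac{\pi}{2})$, then $$\sum_{j=1}^n g(\theta_j)-(\nu_1n+\nu_2)\xrightarrow{\mathrm{law}}\frac{g''(\frac{\pi}{2})-g''(-\frac{\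pi}{2})}{\beta}(2B-1).$$
   Context: For $n\in\mathbb{N}_{>0}$ and $\beta>0$, the mirror-type point process is the probability measure on $(-\pi,\pi]^n$ given by $$\frac{1}{Z_n}\prod_{1\le j<k\le n}|e^{i\theta_j}-e^{-i\theta_k}|^{\beta}\prod_{j=1}^n d\theta_j,\qquad \theta_1,\ldots,\theta_n\in(-\pi,\pi],$$ where $Z_n$ is the normalization constant. A function is $C^{2,q}$ in a neighborhood of a point if it is twice continuously differentiable there with $q$-Hölder continuous second derivative. $\mathrm{Bernoulli}(\frac12)$ means $\mathbb{P}(B=0)=\mathbb{P}(B=1)=\frac12$. $\mathcal{N}_{\mathbb{R}}(m,\sigma^2)$ denotes the real Gaussian law with mean $m$ and variance $\sigma^2$ (the point mass at $m$ if $\sigma^2=0$). $\delta_x$ denotes the Dirac measure at $x$. *)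

theory Defs
  imports "HOL-Probability.Probability"
begin

definition mirror_weight :: "nat \<Rightarrow> real \<Rightarrow> (nat \<Rightarrow> real) \<Rightarrow> real" where
  "mirror_weight n \<beta> \<theta> =
     (\<Prod>k\<in>{1..n}. \<Prod>j\<in>{1..<k}. cmod (cis (\<theta> j) - cis (- \<theta> k)) powr \<beta>)"

definition mirror_base :: "nat \<Rightarrow> (nat \<Rightarrow> real) measure" where
  "mirror_base n = PiM {1..n} (\<lambda>_. restrict_space lborel {-pi<..pi})"

definition mirror_Z :: "nat \<Rightarrow> real \<Rightarrow> real" where
  "mirror_Z n \<beta> = (LINT \<theta>|mirror_base n. mirror_weight n \<beta> \<theta>)"

definition mirror_process :: "nat \<Rightarrow> real \<Rightarrow> (nat \<Rightarrow> real) measure" where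
  "mirror_process n \<beta> =
     density (mirror_base n) (\<lambda>\<theta>. ennreal (mirror_weight n \<beta> \<theta> / mirror_Z n \<beta>))"

definition C2_holder_near :: "real \<Rightarrow> (real \<Rightarrow> real) \<Rightarrow> real \<Rightarrow> bool" where
  "C2_holder_near q g a \<longleftrightarrow>
     (\<exists>U. open U \<and> a \<in> U \<and>
        (\<forall>x\<in>U. g differentiable (at x)) \<and>
        (\<forall>x\<in>U. deriv g differentiable (at x)) \<and>
        continuous_on U (deriv (deriv g)) \<and>
        (\<exists>C. \<forall>x\<in>U. \<forall>y\<in>U.
           \<bar>deriv (deriv g) x - deriv (deriv g) y\<bar> \<le> C * \<bar>x - y\<bar> powr q))"

(* The second parameter is the variance, whereas normal_density takes the standard deviation. *)
definition gaussian_law :: "real \<Rightarrow> real \<Rightarrow> real measure" where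
  "gaussian_law m v =
     (if v = 0 then return borel m else density lborel (normal_density m (sqrt v)))"

(* The measure w1 * delta_x1 + ... + wr * delta_xr given by its list of pairs (w, x);
   the weights are meant to be nonnegative (ennreal truncates negative ones to 0). *)
definition dirac_sum :: "(real \<times> real) list \<Rightarrow> real measure" where
  "dirac_sum ps = measure_of UNIV (sets borel)
     (\<lambda>A. \<Sum>(w, x)\<leftarrow>ps. ennreal w * emeasure (return borel x) A)"

definition conv_in_law ::
  "(nat \<Rightarrow> 'b measure) \<Rightarrow> (nat \<Rightarrow> 'b \<Rightarrow> real) \<Rightarrow> 'a measure \<Rightarrow> ('a \<Rightarrow> real) \<Rightarrow> bool" where
  "conv_in_law P X M Y \<longleftrightarrow>
     weak_conv_m (\<lambda>n. distr (P n) borel (X n)) (distr M borel Y)"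

lemma sets_dirac_sum [simp]: "sets (dirac_sum ps) = sets borel"
  unfolding dirac_sum_def
  by (metis sets.sets_measure_of_eq space_borel)

lemma space_dirac_sum [simp]: "space (dirac_sum ps) = UNIV"
  using sets_eq_imp_space_eq[OF sets_dirac_sum] by simp

lemma emeasure_dirac_sum:
  assumes "A \<in> sets borel"
  shows "emeasure (dirac_sum ps) A = (\<Sum>(w, x)\<leftarrow>ps. ennreal w * emeasure (return borel x) A)"
proof -
  let ?f = "\<lambda>A. \<Sum>(w, x)\<leftarrow>ps. ennreal w * emeasure (return borel x) A"
  have ca: "countably_additive (sets borel) ?f"
  proof (rule countably_additiveI)
    fix F :: "nat \<Rightarrow> real set"
    assume F: "range F \<subseteq> sets borel" "disjoint_family F"
    show "(\<Sum>i. ?f (F i)) = ?f (\<Union>i. F i)"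
    proof (induction ps)
      case (Cons p ps)
      obtain w x where p: "p = (w, x)" by (cases p)
      have "(\<Sum>i. emeasure (return borel x) (F i)) = emeasure (return borel x) (\<Union>i. F i)"
        using F by (intro suminf_emeasure) auto
      then show ?case
        using Cons by (simp add: p suminf_add[symmetric] ennreal_suminf_cmult summableI)
    qed simp
  qed
  have pos: "positive (sets borel) ?f"
    unfolding positive_def by (induction ps) auto
  show ?thesis
    unfolding dirac_sum_def
    by (rule emeasure_measure_of_sigma[OF _ pos ca assms])
       (metis sets.sigma_algebra_axioms space_borel)
qed

lemma nn_integral_dirac_sum:
  assumes "f \<in> borel_measurable borel"
  shows "(\<integral>\<^sup>+ y. f y \<partial>dirac_sum ps) = (\<Sum>(w, x)\<leftarrow>ps. ennreal w * f x)"
  using assms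
proof (induction rule: borel_measurable_induct)
  case (cong f g)
  then show ?case by (metis ext space_borel UNIV_I)
next
  case (set A)
  then show ?case by (simp add: emeasure_dirac_sum)
next
  case (mult u c)
  have "(\<Sum>(w, x)\<leftarrow>ps. ennreal w * (c * u x)) = c * (\<Sum>(w, x)\<leftarrow>ps. ennreal w * u x)"
    by (induction ps) (auto simp: algebra_simps)
  moreover have "u \<in> borel_measurable (dirac_sum ps)" using mult by (simp cong: measurable_cong_sets)
  ultimately show ?case using mult by (simp add: nn_integral_cmult)
next
  case (add u v)
  have "(\<Sum>(w, x)\<leftarrow>ps. ennreal w * (v x + u x))
     = (\<Sum>(w, x)\<leftarrow>ps. ennreal w * v x) + (\<Sum>(w, x)\<leftarrow>ps. ennreal w * u x)"
    by (induction ps) (auto simp: algebra_simps)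
  moreover have "u \<in> borel_measurable (dirac_sum ps)" "v \<in> borel_measurable (dirac_sum ps)"
    using add by (simp_all cong: measurable_cong_sets)
  ultimately show ?case using add by (simp add: nn_integral_add)
next
  case (seq U)
  have m: "\<And>i. U i \<in> borel_measurable (dirac_sum ps)" using seq by (simp cong: measurable_cong_sets)
  have "(\<integral>\<^sup>+ y. (SUP i. U i y) \<partial>dirac_sum ps) = (SUP i. integral\<^sup>N (dirac_sum ps) (U i))"
    using seq m by (intro nn_integral_monotone_convergence_SUP) auto
  also have "\<dots> = (SUP i. \<Sum>(w, x)\<leftarrow>ps. ennreal w * U i x)" using seq by simp
  also have "\<dots> = (\<Sum>(w, x)\<leftarrow>ps. ennreal w * (SUP i. U i x))"
  proof (induction ps)
    case (Cons p ps)
    obtain w x where p: "p = (w, x)" by (cases p)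
    have i1: "incseq (\<lambda>i. ennreal w * U i x)"
      using seq(3) by (auto simp: incseq_def le_fun_def intro!: mult_left_mono)
    have i2: "incseq (\<lambda>i. \<Sum>(w, x)\<leftarrow>ps. ennreal w * U i x)"
      using seq(3) by (auto simp: incseq_def le_fun_def intro!: sum_list_mono mult_left_mono)
    show ?case using Cons by (simp add: p ennreal_SUP_add[OF i1 i2] SUP_mult_left_ennreal)
  qed simp
  finally show ?case by (simp add: image_comp SUP_apply)
qed

lemma prob_space_mirror_process:
  assumes "\<beta> > 0"
  shows "prob_space (mirror_process n \<beta>)"
proof -
  let ?L = "restrict_space lborel {-pi<..pi}"
  let ?A = "PiE {1..n} (\<lambda>_. {0<..<1::real})"
  have finL: "finite_measure ?L"
    by (rule finite_measureI) (simp add: emeasure_restrict_space space_restrict_space)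
  interpret product_sigma_finite "\<lambda>_::nat. ?L"
    unfolding product_sigma_finite_def
    using finL by (simp add: finite_measure_def)
  have sub: "{0<..<1::real} \<subseteq> {-pi<..pi}"
    using pi_gt3 by auto
  have "A \<in> sets ?L \<longleftrightarrow> A \<in> sets borel \<and> A \<subseteq> {-pi<..pi}" for A
    by (subst sets_restrict_space_iff) auto
  then have mA: "{0<..<1::real} \<in> sets ?L" using sub by simp
  have eA: "emeasure (mirror_base n) ?A = 1"
    unfolding mirror_base_def using mA sub
    by (subst emeasure_PiM) (auto simp: emeasure_restrict_space)
  have sA: "?A \<in> sets (mirror_base n)"
    unfolding mirror_base_def using mA by (intro sets_PiM_I_finite) auto
  have sp: "space (mirror_base n) = PiE {1..n} (\<lambda>_. {-pi<..pi})"
    by (simp add: mirror_base_def space_PiM space_restrict_space)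
  have fin: "finite_measure (mirror_base n)"
  proof (rule finite_measureI)
    have "emeasure (mirror_base n) (PiE {1..n} (\<lambda>_. space ?L)) = (\<Prod>i\<in>{1..n}. emeasure ?L (space ?L))"
      unfolding mirror_base_def by (rule emeasure_PiM) (use sets.top in blast)+
    also have "\<dots> = ennreal (2 * pi) ^ n"
      by (simp add: emeasure_restrict_space space_restrict_space)
    also have "\<dots> \<noteq> \<infinity>" by (simp add: ennreal_power)
    finally show "emeasure (mirror_base n) (space (mirror_base n)) \<noteq> \<infinity>"
      by (simp add: sp space_restrict_space)
  qed
  interpret B: finite_measure "mirror_base n" by (rule fin)
  have meas: "mirror_weight n \<beta> \<in> borel_measurable (mirror_base n)"
  proof -
    have idm: "(\<lambda>x. x) \<in> ?L \<rightarrow>\<^sub>M borel"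
      by (rule measurable_restrict_space1) simp
    have c: "(\<lambda>\<theta>. \<theta> j) \<in> borel_measurable (mirror_base n)" if "j \<in> {1..n}" for j
      using measurable_compose[OF measurable_component_singleton[OF that, of "\<lambda>_. ?L"] idm]
      by (simp add: mirror_base_def)
    have cm: "cis \<in> borel_measurable borel"
      by (intro borel_measurable_continuous_onI continuous_intros)
    have "(\<lambda>\<theta>. cmod (cis (\<theta> j) - cis (- \<theta> k)) powr \<beta>) \<in> borel_measurable (mirror_base n)"
      if "j \<in> {1..n}" "k \<in> {1..n}" for j k
    proof -
      note [measurable] = c[OF that(1)] c[OF that(2)] cm
      show ?thesis by measurable
    qed
    then show ?thesis
      unfolding mirror_weight_def[abs_def] by (intro borel_measurable_prod) auto
  qed
  have nn: "mirror_weight n \<beta> \<theta> \<ge> 0" for \<theta>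
    unfolding mirror_weight_def by (intro prod_nonneg) auto
  have bd: "mirror_weight n \<beta> \<theta> \<le> (\<Prod>k\<in>{1..n}. \<Prod>j\<in>{1..<k}. 2 powr \<beta>)" for \<theta>
  proof -
    have "cmod (cis a - cis b) \<le> 2" for a b
      using norm_triangle_ineq4[of "cis a" "cis b"] by simp
    then show ?thesis
      unfolding mirror_weight_def using assms
      by (intro prod_mono conjI prod_nonneg powr_mono2) auto
  qed
  have int: "integrable (mirror_base n) (mirror_weight n \<beta>)"
    using meas nn bd
    by (intro B.integrable_const_bound[where B="\<Prod>k\<in>{1..n}. \<Prod>j\<in>{1..<k}. 2 powr \<beta>"]) auto
  have pos: "mirror_weight n \<beta> \<theta> > 0" if T: "\<theta> \<in> ?A" for \<theta>
  proof -
    have "cis (\<theta> j) \<noteq> cis (- \<theta> k)" if "j \<in> {1..n}" "k \<in> {1..n}" for j k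
    proof
      assume "cis (\<theta> j) = cis (- \<theta> k)"
      then have "sin (\<theta> j) = - sin (\<theta> k)" by (simp add: complex_eq_iff)
      moreover have "sin (\<theta> j) > 0" "sin (\<theta> k) > 0"
        using PiE_mem[OF T that(1)] PiE_mem[OF T that(2)] pi_gt3
        by (auto intro!: sin_gt_zero)
      ultimately show False by simp
    qed
    then show ?thesis
      unfolding mirror_weight_def by (intro prod_pos) auto
  qed
  have Z: "mirror_Z n \<beta> > 0"
  proof (rule ccontr)
    assume "\<not> ?thesis"
    then have "mirror_Z n \<beta> = 0"
      using Bochner_Integration.integral_nonneg[of "mirror_base n" "mirror_weight n \<beta>", OF nn]
      by (simp add: mirror_Z_def)
    then have "AE \<theta> in mirror_base n. mirror_weight n \<beta> \<theta> = 0"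
      using integral_nonneg_eq_0_iff_AE[OF int] nn by (simp add: mirror_Z_def)
    then have "AE \<theta> in mirror_base n. \<theta> \<notin> ?A"
      by eventually_elim (use pos in force)
    then have "emeasure (mirror_base n) ?A = 0"
      using sA by (subst (asm) AE_iff_measurable[OF sA]) (use sets.sets_into_space[OF sA] in auto)
    with eA show False by simp
  qed
  show ?thesis
  proof (rule prob_spaceI)
    have "emeasure (mirror_process n \<beta>) (space (mirror_process n \<beta>))
        = (\<integral>\<^sup>+ \<theta>. ennreal (mirror_weight n \<beta> \<theta> / mirror_Z n \<beta>) \<partial>mirror_base n)"
      unfolding mirror_process_def using meas
      by (subst emeasure_density) (auto intro!: nn_integral_cong)
    also have "\<dots> = ennreal (LINT \<theta>|mirror_base n. mirror_weight n \<beta> \<theta> / mirror_Z n \<beta>)"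
      using int nn Z by (intro nn_integral_eq_integral) auto
    also have "\<dots> = 1" using Z by (simp add: mirror_Z_def)
    finally show "emeasure (mirror_process n \<beta>) (space (mirror_process n \<beta>)) = 1" .
  qed
qed

end

theory Submission
  imports Defs "HOL-Real_Asymp.Real_Asymp"
begin

text \<open>
  Up to constants the density is $\prod_{j<k} |\sin((\theta_j+\theta_k)/2)|^\beta$. Around either centre
  $a = \pm\pi/2$, with $\theta_j = a + x_j$, it reads $\prod_{j<k} |\cos((x_j+x_k)/2)|^\beta$. Since
  $\sum_{j<k} (x_j+x_k)^2 = (n-2) p_2 + p_1^2$ with $p_k = \sum_j x_j^k$, and $\cos u \le e^{-u^2/2}$ on
  $[-\pi/2, \pi/2]$, the density relative to independent $N(0, 4/(\beta(n-2)))$ variables is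
  $e^{-\beta p_1^2/8}$ times a correction in $[0,1]$ of quartic order, which converges in probability to a constant.
  So a law of large numbers for $p_2$ and $p_4$ and an exact Gaussian integral for $p_1$ give the joint behaviour
  of $(p_1, p_2)$, and by Taylor's formula that of $\sum_j g(\theta_j)$, on the event that all points lie
  in the half circle around $a$. The two half circles have asymptotically equal mass by symmetry. On a mixed
  configuration, a union bound over the set of points in the minority half circle suffices, since every
  pair of points from opposite half circles costs a factor bounded away from $1$. The laws are then identified by
  Levy's continuity theorem.
\<close>

section \<open>Elementary identities and inequalities\<close>

text \<open>With \<sigma>^2 = 4/(\<beta>(n-2)) the coefficient 1/(2\<sigma>^2) equals
  \<beta>(n-2)/8, so the p_2 terms cancel exactly. The limit constants come from n\<sigma>^2 ->
  4/\<beta>: p_2 tends to 4/\<beta>, which turns g''/2 into the mean 2g''/\<beta>; p_1 starts with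
  variance tending to 4/\<beta>, and the tilt e^{-\<beta> p_1^2/8} halves it, which gives
  2g'^2/\<beta>; the quartic exponent tends to 1/(2\<beta>). Both half circles thus carry the same
  factor e^{-1/(2\<beta>)}/sqrt 2. It cancels between numerator and denominator, so Z_n is never
  evaluated.

  The obstacle is that the tilt by p_1 is of order one, so p_1 is no perturbation and its Gaussian
  integral is kept exact. Everything else is controlled by one explicit integrable majorant, whose
  expectation is computed from moments up to order eight. To cover the scaling 1/n and the unscaled
  sums at once, the frequency is a convergent sequence rather than a fixed number.\<close>

lemma sum_pairs_symmetric:
  fixes f :: "nat \<Rightarrow> nat \<Rightarrow> real"
  assumes "\<And>j k. f j k = f k j"
  shows "2 * (\<Sum>k\<in>{1..n}. \<Sum>j\<in>{1..<k}. f j k) = (\<Sum>j\<in>{1..n}. \<Sum>k\<in>{1..n}. f j k) - (\<Sum>j\<in>{1..n}. f j j)"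
proof (induction n)
  case (Suc n)
  have "{1..<Suc n} = {1..n}" by auto
  moreover have "(\<Sum>k\<in>{1..n}. f (Suc n) k) = (\<Sum>k\<in>{1..n}. f k (Suc n))"
    by (intro sum.cong assms refl)
  ultimately show ?case
    using Suc by (simp add: sum.distrib algebra_simps)
qed simp

lemma sum_pairs_square:
  fixes x :: "nat \<Rightarrow> real"
  shows "(\<Sum>k\<in>{1..n}. \<Sum>j\<in>{1..<k}. (x j + x k)^2) = (real n - 2) * (\<Sum>j\<in>{1..n}. x j ^ 2) + (\<Sum>j\<in>{1..n}. x j)^2"
proof -
  have "(\<Sum>j\<in>{1..n}. \<Sum>k\<in>{1..n}. (x j + x k)^2)
      = (\<Sum>j\<in>{1..n}. \<Sum>k\<in>{1..n}. x j ^ 2 + x k ^ 2 + 2 * (x j * x k))"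
    by (simp add: power2_eq_square algebra_simps)
  also have "\<dots> = 2 * n * (\<Sum>j\<in>{1..n}. x j ^ 2) + 2 * (\<Sum>j\<in>{1..n}. x j)^2"
    by (simp add: sum.distrib sum_distrib_left[symmetric] sum_distrib_right[symmetric] power2_eq_square)
  finally have *: "(\<Sum>j\<in>{1..n}. \<Sum>k\<in>{1..n}. (x j + x k)^2) = \<dots>" .
  have diag: "(\<Sum>j\<in>{1..n}. (x j + x j)^2) = 4 * (\<Sum>j\<in>{1..n}. x j ^ 2)"
    by (simp add: sum_distrib_left power2_eq_square algebra_simps)
  have "2 * (\<Sum>k\<in>{1..n}. \<Sum>j\<in>{1..<k}. (x j + x k)^2)
      = (\<Sum>j\<in>{1..n}. \<Sum>k\<in>{1..n}. (x j + x k)^2) - (\<Sum>j\<in>{1..n}. (x j + x j)^2)"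
    by (rule sum_pairs_symmetric) (simp add: add.commute)
  then show ?thesis unfolding * diag by (simp only: left_diff_distrib)
qed

lemma sum_pairs_fourth_power:
  fixes x :: "nat \<Rightarrow> real"
  shows "(\<Sum>k\<in>{1..n}. \<Sum>j\<in>{1..<k}. (x j + x k)^4) = (real n - 8) * (\<Sum>j\<in>{1..n}. x j ^ 4)
    + 4 * ((\<Sum>j\<in>{1..n}. x j) * (\<Sum>j\<in>{1..n}. x j ^ 3)) + 3 * (\<Sum>j\<in>{1..n}. x j ^ 2)^2"
proof -
  have "(\<Sum>j\<in>{1..n}. \<Sum>k\<in>{1..n}. (x j + x k)^4)
      = (\<Sum>j\<in>{1..n}. \<Sum>k\<in>{1..n}. x j ^ 4 + x k ^ 4 + 4 * (x j * x k ^ 3) + 4 * (x j ^ 3 * x k)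
          + 6 * (x j ^ 2 * x k ^ 2))"
    by (intro sum.cong) (auto simp: power2_eq_square power3_eq_cube power4_eq_xxxx algebra_simps)
  also have "\<dots> = 2 * n * (\<Sum>j\<in>{1..n}. x j ^ 4) + 8 * ((\<Sum>j\<in>{1..n}. x j) * (\<Sum>j\<in>{1..n}. x j ^ 3))
      + 6 * (\<Sum>j\<in>{1..n}. x j ^ 2)^2"
    by (simp add: sum.distrib sum_distrib_left[symmetric] sum_distrib_right[symmetric] power2_eq_square)
  finally have *: "(\<Sum>j\<in>{1..n}. \<Sum>k\<in>{1..n}. (x j + x k)^4) = \<dots>" .
  have diag: "(\<Sum>j\<in>{1..n}. (x j + x j)^4) = 16 * (\<Sum>j\<in>{1..n}. x j ^ 4)"
    by (simp add: sum_distrib_left power4_eq_xxxx algebra_simps)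
  have "2 * (\<Sum>k\<in>{1..n}. \<Sum>j\<in>{1..<k}. (x j + x k)^4)
      = (\<Sum>j\<in>{1..n}. \<Sum>k\<in>{1..n}. (x j + x k)^4) - (\<Sum>j\<in>{1..n}. (x j + x j)^4)"
    by (rule sum_pairs_symmetric) (simp add: add.commute)
  then show ?thesis unfolding * diag by (simp only: left_diff_distrib)
qed

lemma sum_pairs_le_double_sum:
  fixes f :: "nat \<Rightarrow> nat \<Rightarrow> real"
  assumes "\<And>j k. f j k = f k j" "\<And>j k. 0 \<le> f j k"
  shows "2 * (\<Sum>k\<in>{1..n}. \<Sum>j\<in>{1..<k}. f j k) \<le> (\<Sum>j\<in>{1..n}. \<Sum>k\<in>{1..n}. f j k)"
proof -
  have "0 \<le> (\<Sum>j\<in>{1..n}. f j j)" by (intro sum_nonneg assms(2))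
  then show ?thesis using sum_pairs_symmetric[of f n, OF assms(1)] by linarith
qed

text \<open>The derivative of \<open>ln (cos u) + u\<^sup>2 / 2\<close> is \<open>u - tan u\<close>,
  which is nonpositive on [0, pi/2). At the endpoints the logarithm breaks down, but there the
  cosine vanishes.\<close>

lemma cos_le_exp_quadratic:
  assumes "\<bar>u\<bar> \<le> pi/2"
  shows "cos u \<le> exp (- u\<^sup>2 / 2)"
proof -
  have *: "cos u \<le> exp (- u\<^sup>2 / 2)" if "0 \<le> u" "u < pi/2" for u
  proof -
    have "ln (cos u) + u\<^sup>2 / 2 \<le> ln (cos 0) + 0\<^sup>2 / 2"
    proof (rule DERIV_nonpos_imp_nonincreasing[of 0 u "\<lambda>u. ln (cos u) + u\<^sup>2 / 2"])
      fix t assume t: "0 \<le> t" "t \<le> u"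
      with that have c: "cos t > 0" by (intro cos_gt_zero_pi) auto
      have "((\<lambda>u. ln (cos u) + u\<^sup>2 / 2) has_real_derivative t - tan t) (at t)"
        using c by (auto intro!: derivative_eq_intros simp: tan_def field_simps)
      moreover have "t \<le> tan t"
      proof (cases "t = 0")
        case False
        have "sin 0 - 0 * cos 0 \<le> sin t - t * cos t"
        proof (rule DERIV_nonneg_imp_nondecreasing[of 0 t "\<lambda>t. sin t - t * cos t"])
          fix v assume v: "0 \<le> v" "v \<le> t"
          have "((\<lambda>t. sin t - t * cos t) has_real_derivative v * sin v) (at v)"
            by (auto intro!: derivative_eq_intros)
          moreover have "0 \<le> v * sin v" using v t that by (intro mult_nonneg_nonneg sin_ge_zero) auto
          ultimately show "\<exists>y. ((\<lambda>t. sin t - t * cos t) has_real_derivative y) (at v) \<and> 0 \<le> y" by blast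
        qed (use t in simp)
        then show ?thesis using c by (simp add: tan_def field_simps)
      qed simp
      ultimately show "\<exists>y. ((\<lambda>u. ln (cos u) + u\<^sup>2 / 2) has_real_derivative y) (at t) \<and> y \<le> 0"
        by (intro exI[of _ "t - tan t"]) auto
    qed (use that in auto)
    moreover have "cos u > 0" using that by (intro cos_gt_zero_pi) auto
    ultimately have "exp (ln (cos u)) \<le> exp (- u\<^sup>2 / 2)"
      by (subst exp_le_cancel_iff) simp
    with \<open>cos u > 0\<close> show ?thesis by simp
  qed
  show ?thesis
  proof (cases "\<bar>u\<bar> = pi/2")
    case True
    then have "cos u = 0" by (metis cos_abs_real cos_pi_half)
    then show ?thesis by simp
  next
    case False
    with assms *[of "\<bar>u\<bar>"] show ?thesis by simp
  qed
qed

text \<open>The expansion is u^2/2 + u^4/12 + u^6/45 + ..., and 1/45 < 1 leaves room for a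
  sixth-order remainder with constant 1 near 0. The upper limit on \<open>r\<close> keeps the cosine
  positive.\<close>

lemma ln_cos_quartic:
  "\<exists>r>0. r < pi/2 \<and> (\<forall>u::real. \<bar>u\<bar> \<le> r \<longrightarrow> \<bar>- ln (cos u) - u\<^sup>2 / 2 - u^4 / 12\<bar> \<le> u^6)"
proof -
  have "eventually (\<lambda>u::real. \<bar>- ln (cos u) - u\<^sup>2 / 2 - u^4 / 12\<bar> \<le> u^6) (at 0)"
    by real_asymp
  then obtain d where d: "d > 0" "\<And>u::real. u \<noteq> 0 \<Longrightarrow> \<bar>u\<bar> < d \<Longrightarrow> \<bar>- ln (cos u) - u\<^sup>2 / 2 - u^4 / 12\<bar> \<le> u^6"
    by (auto simp: eventually_at dist_real_def)
  have "\<bar>- ln (cos u) - u\<^sup>2 / 2 - u^4 / 12\<bar> \<le> u^6" if "\<bar>u\<bar> \<le> min (d/2) 1" for u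
    using d(2)[of u] d(1) that by (cases "u = 0") auto
  moreover have "min (d/2) 1 < pi/2" using pi_gt3 by linarith
  ultimately show ?thesis using d(1) by (intro exI[of _ "min (d/2) 1"]) auto
qed

text \<open>For points \<open>a + x\<close> and \<open>- a + y\<close> in opposite half circles the
  half sum of the angles is \<open>(x + y) / 2\<close>. The sine comes near 1 in modulus only if
  both deviations are near pi/2; the factor \<open>exp (x\<^sup>2 / 16)\<close> allows for this in
  terms of \<open>x\<close> alone, with an exponent small enough to be absorbed by the Gaussian
  decay of the majority.\<close>

lemma sin_shifted_decay:
  "\<exists>\<kappa>>0. \<kappa> < 1 \<and> (\<forall>x y::real. \<bar>x\<bar> \<le> pi/2 \<longrightarrow> \<bar>y\<bar> \<le> pi/2 \<longrightarrow> \<bar>sin ((x + y) / 2)\<bar> \<le> \<kappa> * exp (x\<^sup>2 / 16))"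
proof -
  define c where "c = sin (1/2 + pi/4)"
  have "1/2 + pi/4 < pi/2" using pi_gt3 by linarith
  then have c: "c < 1" "c > 0"
    unfolding c_def using sin_monotone_2pi[of "1/2 + pi/4" "pi/2"] pi_gt3 by (auto intro!: sin_gt_zero)
  \<comment> \<open>The second entry makes \<open>\<kappa> * exp (x\<^sup>2 / 16)\<close> at least 1
    as soon as \<open>\<bar>x\<bar> \<ge> 1\<close>.\<close>
  define \<kappa> where "\<kappa> = max c (exp (-1/16))"
  have *: "\<bar>sin u\<bar> \<le> sin v" if "\<bar>u\<bar> \<le> v" "v \<le> pi/2" for u v :: real
    using sin_monotone_2pi_le[of u v] sin_monotone_2pi_le[of "-u" v] that by (auto simp: abs_if split: if_splits)
  have "\<bar>sin ((x + y) / 2)\<bar> \<le> \<kappa> * exp (x\<^sup>2 / 16)" if xy: "\<bar>x\<bar> \<le> pi/2" "\<bar>y\<bar> \<le> pi/2" for x y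
  proof (cases "\<bar>x\<bar> \<le> 1")
    case True
    have "\<bar>sin ((x + y) / 2)\<bar> \<le> c" unfolding c_def
    proof (rule *)
      show "\<bar>(x + y) / 2\<bar> \<le> 1/2 + pi/4" using True xy abs_triangle_ineq[of x y] by simp
    qed (use pi_gt3 in simp)
    also have "\<dots> \<le> \<kappa> * 1" by (simp add: \<kappa>_def)
    also have "\<dots> \<le> \<kappa> * exp (x\<^sup>2 / 16)" using c by (intro mult_left_mono) (auto simp: \<kappa>_def)
    finally show ?thesis .
  next
    case False
    then have "x\<^sup>2 \<ge> 1" by (metis abs_square_le_1 linear power2_abs abs_le_square_iff abs_1 power_one)
    have "\<bar>sin ((x + y) / 2)\<bar> \<le> exp (-1/16) * exp (1/16)" by (simp flip: exp_add)
    also have "\<dots> \<le> \<kappa> * exp (x\<^sup>2 / 16)" using \<open>x\<^sup>2 \<ge> 1\<close> c by (intro mult_mono) (auto simp: \<kappa>_def le_max_iff_disj)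
    finally show ?thesis .
  qed
  moreover have "0 < \<kappa>" "\<kappa> < 1" using c by (auto simp: \<kappa>_def)
  ultimately show ?thesis by blast
qed

lemma cmod_cis_diff_mirror: "cmod (cis a - cis (- b)) = 2 * \<bar>sin ((a + b) / 2)\<bar>"
proof -
  have "(cmod (cis a - cis (- b)))\<^sup>2 = (2 * \<bar>sin ((a + b) / 2)\<bar>)\<^sup>2"
  proof -
    have e: "cos (a + b) = 1 - 2 * (sin ((a + b) / 2))\<^sup>2"
      using cos_double_sin[of "(a + b) / 2"] by (simp only: mult_2 field_sum_of_halves)
    have "(cmod (cis a - cis (- b)))\<^sup>2 = (cos a - cos b)\<^sup>2 + (sin a + sin b)\<^sup>2"
      by (simp add: cmod_power2)
    also have "\<dots> = ((sin a)\<^sup>2 + (cos a)\<^sup>2) + ((sin b)\<^sup>2 + (cos b)\<^sup>2) - 2 * cos (a + b)"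
      unfolding cos_add power2_eq_square by (simp only: algebra_simps)
    also have "\<dots> = (2 * \<bar>sin ((a + b) / 2)\<bar>)\<^sup>2"
      by (simp only: e sin_cos_squared_add) (simp add: power_mult_distrib)
    finally show ?thesis .
  qed
  then show ?thesis by (rule power2_eq_imp_eq) auto
qed

section \<open>Independent centred Gaussian variables\<close>

lemma (in prob_space) expectation_indep_sum_square:
  fixes Y :: "'i \<Rightarrow> 'a \<Rightarrow> real"
  assumes "finite I" and indep: "indep_vars (\<lambda>_. borel) Y I"
    and sq: "\<And>i. i \<in> I \<Longrightarrow> integrable M (\<lambda>\<omega>. (Y i \<omega>)\<^sup>2)"
    and zero: "\<And>i. i \<in> I \<Longrightarrow> expectation (Y i) = 0"
  shows "integrable M (\<lambda>\<omega>. (\<Sum>i\<in>I. Y i \<omega>)\<^sup>2)"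
    and "expectation (\<lambda>\<omega>. (\<Sum>i\<in>I. Y i \<omega>)\<^sup>2) = (\<Sum>i\<in>I. expectation (\<lambda>\<omega>. (Y i \<omega>)\<^sup>2))"
proof -
  have rv: "Y i \<in> borel_measurable M" if "i \<in> I" for i
    using indep that by (auto simp: indep_vars_def)
  have int: "integrable M (Y i)" if "i \<in> I" for i
    using square_integrable_imp_integrable[OF rv sq] that by auto
  have prod: "integrable M (\<lambda>\<omega>. Y i \<omega> * Y j \<omega>) \<and>
      expectation (\<lambda>\<omega>. Y i \<omega> * Y j \<omega>) = (if i = j then expectation (\<lambda>\<omega>. (Y i \<omega>)\<^sup>2) else 0)"
    if "i \<in> I" "j \<in> I" for i j
  proof (cases "i = j")
    case True
    then show ?thesis using sq[OF that(1)] by (simp add: power2_eq_square)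
  next
    case False
    have "indep_vars (\<lambda>_. borel) Y {i, j}"
      using indep_vars_subset[OF indep, of "{i, j}"] that by auto
    from indep_vars_lebesgue_integral[OF _ this] indep_vars_integrable[OF _ this] False that int zero
    show ?thesis by auto
  qed
  have eq: "(\<Sum>i\<in>I. Y i \<omega>)\<^sup>2 = (\<Sum>i\<in>I. \<Sum>j\<in>I. Y i \<omega> * Y j \<omega>)" for \<omega>
    by (simp add: power2_eq_square sum_product)
  show "integrable M (\<lambda>\<omega>. (\<Sum>i\<in>I. Y i \<omega>)\<^sup>2)"
    unfolding eq using prod by (intro Bochner_Integration.integrable_sum) auto
  have "expectation (\<lambda>\<omega>. (\<Sum>i\<in>I. Y i \<omega>)\<^sup>2) = (\<Sum>i\<in>I. \<Sum>j\<in>I. expectation (\<lambda>\<omega>. Y i \<omega> * Y j \<omega>))"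
    unfolding eq using prod by (simp add: Bochner_Integration.integral_sum)
  also have "\<dots> = (\<Sum>i\<in>I. \<Sum>j\<in>I. if i = j then expectation (\<lambda>\<omega>. (Y i \<omega>)\<^sup>2) else 0)"
    using prod by (intro sum.cong) auto
  also have "\<dots> = (\<Sum>i\<in>I. expectation (\<lambda>\<omega>. (Y i \<omega>)\<^sup>2))"
    using \<open>finite I\<close> by simp
  finally show "expectation (\<lambda>\<omega>. (\<Sum>i\<in>I. Y i \<omega>)\<^sup>2) = (\<Sum>i\<in>I. expectation (\<lambda>\<omega>. (Y i \<omega>)\<^sup>2))" .
qed

section \<open>Characteristic functions and moments of Gaussian variables\<close>

lemma integral_normal_density_iexp:
  assumes "\<tau> > 0"
  shows "(CLINT y|lborel. normal_density m \<tau> y *\<^sub>R iexp (v * y)) = iexp (v * m) * exp (- (v\<^sup>2 * \<tau>\<^sup>2 / 2))"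
proof -
  have *: "normal_density m \<tau> (m + \<tau> * y) * \<tau> = std_normal_density y" for y
    using assms by (simp add: normal_density_def real_sqrt_mult power_mult_distrib)
  have "(CLINT y|lborel. normal_density m \<tau> y *\<^sub>R iexp (v * y))
      = \<tau> *\<^sub>R (CLINT y|lborel. normal_density m \<tau> (m + \<tau> * y) *\<^sub>R iexp (v * (m + \<tau> * y)))"
    using assms by (subst lborel_integral_real_affine[where t=m and c=\<tau>]) auto
  also have "\<dots> = (CLINT y|lborel. iexp (v * m) * (std_normal_density y *\<^sub>R iexp ((v * \<tau>) * y)))"
    unfolding *[symmetric]
    by (subst integral_scaleR_right[symmetric], intro Bochner_Integration.integral_cong)
       (auto simp: scaleR_conv_of_real algebra_simps exp_add)
  also have "\<dots> = iexp (v * m) * (CLINT y|lborel. std_normal_density y *\<^sub>R iexp ((v * \<tau>) * y))"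
    by (rule integral_mult_right_zero)
  also have "(CLINT y|lborel. std_normal_density y *\<^sub>R iexp ((v * \<tau>) * y)) = char std_normal_distribution (v * \<tau>)"
    unfolding char_def by (subst integral_density) auto
  finally show ?thesis by (simp add: char_std_normal_distribution power_mult_distrib)
qed

lemma char_gaussian_law:
  assumes "V \<ge> 0"
  shows "char (gaussian_law m V) v = iexp (v * m) * exp (- (v\<^sup>2 * V / 2))"
proof (cases "V = 0")
  case True
  then show ?thesis by (simp add: gaussian_law_def char_def integral_return)
next
  case False
  then show ?thesis
    using integral_normal_density_iexp[of "sqrt V" m v] assms
    unfolding gaussian_law_def char_def by (simp add: integral_density)
qed

text \<open>The probability space stays abstract: the coordinates centred at pi/2 and at -pi/2,
  under two different product measures, are both instances, one for each \<open>n\<close>.\<close>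

locale iid_normal = prob_space G for G :: "'a measure" +
  fixes x :: "nat \<Rightarrow> 'a \<Rightarrow> real" and \<sigma> :: real and n :: nat
  assumes \<sigma>_pos: "0 < \<sigma>"
    and indep: "indep_vars (\<lambda>_. borel) x {1..n}"
    and normal: "\<And>i. i \<in> {1..n} \<Longrightarrow> distributed G lborel (x i) (normal_density 0 \<sigma>)"
begin

lemma rv[measurable]: "i \<in> {1..n} \<Longrightarrow> x i \<in> borel_measurable G"
  using indep by (auto simp: indep_vars_def)

lemma integrable_power: "i \<in> {1..n} \<Longrightarrow> integrable G (\<lambda>\<omega>. x i \<omega> ^ k)"
  using distributed_integrable[OF normal, of i "\<lambda>y. y ^ k"] integrable_normal_moment[OF \<sigma>_pos, of 0 k] by simp

lemma expectation_power_even: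
  "i \<in> {1..n} \<Longrightarrow> expectation (\<lambda>\<omega>. x i \<omega> ^ (2 * k)) = fact (2 * k) / ((2 / \<sigma>\<^sup>2)^k * fact k)"
  using distributed_integral[OF normal, of i "\<lambda>y. y ^ (2 * k)"] integral_normal_moment_even[OF \<sigma>_pos, of 0 k] by simp

lemma expectation_power_odd:
  "i \<in> {1..n} \<Longrightarrow> expectation (\<lambda>\<omega>. x i \<omega> ^ (2 * k + 1)) = 0"
  using distributed_integral[OF normal, of i "\<lambda>y. y ^ (2 * k + 1)"] integral_normal_moment_odd[OF \<sigma>_pos, of 0 k] by simp

lemma low_moments:
  assumes "i \<in> {1..n}"
  shows "expectation (x i) = 0" "expectation (\<lambda>\<omega>. x i \<omega> ^ 2) = \<sigma>^2" "expectation (\<lambda>\<omega>. x i \<omega> ^ 3) = 0"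
    "expectation (\<lambda>\<omega>. x i \<omega> ^ 4) = 3 * \<sigma>^4" "expectation (\<lambda>\<omega>. x i \<omega> ^ 6) = 15 * \<sigma>^6"
    "expectation (\<lambda>\<omega>. x i \<omega> ^ 8) = 105 * \<sigma>^8"
  using expectation_power_odd[OF assms, of 0] expectation_power_odd[OF assms, of 1]
    expectation_power_even[OF assms, of 1] expectation_power_even[OF assms, of 2]
    expectation_power_even[OF assms, of 3] expectation_power_even[OF assms, of 4] \<sigma>_pos
  by (simp_all add: eval_nat_numeral fact_numeral divide_simps)

definition psum :: "nat \<Rightarrow> 'a \<Rightarrow> real" where "psum k \<omega> = (\<Sum>i\<in>{1..n}. x i \<omega> ^ k)"

lemma psum_measurable[measurable]: "psum k \<in> borel_measurable G"
  unfolding psum_def[abs_def] by measurable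

lemma integrable_psum[simp]: "integrable G (psum k)"
  unfolding psum_def[abs_def] by (intro Bochner_Integration.integrable_sum integrable_power)

lemma expectation_psum:
  "expectation (psum 2) = n * \<sigma>^2" "expectation (psum 4) = 3 * n * \<sigma>^4" "expectation (psum 6) = 15 * n * \<sigma>^6"
  unfolding psum_def by (simp_all add: Bochner_Integration.integral_sum integrable_power low_moments)

lemma psum_square_deviation:
  fixes c d :: real
  assumes "\<And>i. i \<in> {1..n} \<Longrightarrow> expectation (\<lambda>\<omega>. x i \<omega> ^ k) = c"
    and "\<And>i. i \<in> {1..n} \<Longrightarrow> expectation (\<lambda>\<omega>. x i \<omega> ^ (2 * k)) = d"
  shows "integrable G (\<lambda>\<omega>. (psum k \<omega> - n * c)\<^sup>2)" "expectation (\<lambda>\<omega>. (psum k \<omega> - n * c)\<^sup>2) = n * (d - c\<^sup>2)"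
proof -
  define Y where "Y i \<omega> = x i \<omega> ^ k - c" for i \<omega>
  have "(\<lambda>\<omega>. (Y i \<omega>)\<^sup>2) = (\<lambda>\<omega>. x i \<omega> ^ (2 * k) - 2 * c * x i \<omega> ^ k + c\<^sup>2)" for i
    by (rule ext) (simp add: Y_def power2_diff power_even_eq)
  then have sq: "integrable G (\<lambda>\<omega>. (Y i \<omega>)\<^sup>2)" "expectation (\<lambda>\<omega>. (Y i \<omega>)\<^sup>2) = d - c\<^sup>2" if "i \<in> {1..n}" for i
    using that integrable_power[OF that] by (simp_all only: assms Bochner_Integration.integral_add Bochner_Integration.integral_diff
        Bochner_Integration.integrable_add Bochner_Integration.integrable_diff integrable_const integrable_mult_right integral_mult_right_zero)
      (simp_all add: prob_space power2_eq_square)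
  have zero: "expectation (Y i) = 0" if "i \<in> {1..n}" for i
    unfolding Y_def using that assms integrable_power[OF that] by (simp add: prob_space)
  have ind: "indep_vars (\<lambda>_. borel) Y {1..n}"
    unfolding Y_def[abs_def] by (rule indep_vars_compose2[OF indep]) auto
  have eq: "psum k \<omega> - n * c = (\<Sum>i\<in>{1..n}. Y i \<omega>)" for \<omega>
    by (simp add: psum_def Y_def sum_subtractf)
  show "integrable G (\<lambda>\<omega>. (psum k \<omega> - n * c)\<^sup>2)"
    unfolding eq by (rule expectation_indep_sum_square[OF _ ind sq(1) zero]) auto
  show "expectation (\<lambda>\<omega>. (psum k \<omega> - n * c)\<^sup>2) = n * (d - c\<^sup>2)"
    unfolding eq by (subst expectation_indep_sum_square[OF _ ind sq(1) zero]) (auto simp: sq(2))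
qed

text \<open>The factors are gaps between Gaussian moments: 3 - 1 = 2 for squares and 105 - 9 = 96
  for fourth powers. For first and third powers the mean vanishes, which leaves the moments 1 and
  15.\<close>

lemma psum_squares:
  "integrable G (\<lambda>\<omega>. (psum 1 \<omega>)\<^sup>2)" "expectation (\<lambda>\<omega>. (psum 1 \<omega>)\<^sup>2) = n * \<sigma>^2"
  "integrable G (\<lambda>\<omega>. (psum 3 \<omega>)\<^sup>2)" "expectation (\<lambda>\<omega>. (psum 3 \<omega>)\<^sup>2) = 15 * n * \<sigma>^6"
  "integrable G (\<lambda>\<omega>. (psum 2 \<omega> - n * \<sigma>^2)\<^sup>2)" "expectation (\<lambda>\<omega>. (psum 2 \<omega> - n * \<sigma>^2)\<^sup>2) = 2 * n * \<sigma>^4"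
  "integrable G (\<lambda>\<omega>. (psum 4 \<omega> - 3 * n * \<sigma>^4)\<^sup>2)" "expectation (\<lambda>\<omega>. (psum 4 \<omega> - 3 * n * \<sigma>^4)\<^sup>2) = 96 * n * \<sigma>^8"
  using psum_square_deviation[of 1 0 "\<sigma>^2"] psum_square_deviation[of 3 0 "15 * \<sigma>^6"]
    psum_square_deviation[of 2 "\<sigma>^2" "3 * \<sigma>^4"] psum_square_deviation[of 4 "3 * \<sigma>^4" "105 * \<sigma>^8"] low_moments
  by (simp_all add: power_mult_distrib mult.left_commute mult.assoc flip: power_mult)

text \<open>The sum p_1 is exactly N(0, n\<sigma>^2), and the factor e^{-c y^2} turns its density
  into the one of variance n\<sigma>^2/(1 + 2cn\<sigma>^2), at the price of the square root of that
  denominator.\<close>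

lemma expectation_gaussian_tilt:
  fixes c v :: real
  assumes "n > 0" "c \<ge> 0"
  shows "(CLINT \<omega>|G. iexp (v * psum 1 \<omega>) * exp (- (c * (psum 1 \<omega>)\<^sup>2)))
    = exp (- (v\<^sup>2 * (n * \<sigma>\<^sup>2 / (1 + 2 * c * n * \<sigma>\<^sup>2)) / 2)) / sqrt (1 + 2 * c * n * \<sigma>\<^sup>2)"
proof -
  define \<tau> where "\<tau> = sqrt (n * \<sigma>\<^sup>2)"
  define D where "D = 1 + 2 * c * n * \<sigma>\<^sup>2"
  define \<rho> where "\<rho> = \<tau> / sqrt D"
  have \<tau>: "\<tau> > 0" "\<tau>\<^sup>2 = n * \<sigma>\<^sup>2" using assms \<sigma>_pos by (auto simp: \<tau>_def)
  have D: "D > 0" using assms by (simp add: D_def add_pos_nonneg)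
  have \<rho>: "\<rho> > 0" "\<rho>\<^sup>2 = n * \<sigma>\<^sup>2 / D" using \<tau> D by (auto simp: \<rho>_def power_divide)
  have "distributed G lborel (\<lambda>\<omega>. \<Sum>i\<in>{1..n}. x i \<omega>) (normal_density (\<Sum>i\<in>{1..n}. 0) (sqrt (\<Sum>i\<in>{1..n}. \<sigma>\<^sup>2)))"
    using assms by (intro sum_indep_normal indep \<sigma>_pos normal) auto
  then have dist: "distributed G lborel (psum 1) (normal_density 0 \<tau>)"
    by (simp add: psum_def[abs_def] \<tau>_def)
  \<comment> \<open>The precisions add: 1/(2\<tau>^2) + c = 1/(2\<rho>^2).\<close>
  have dens: "normal_density 0 \<tau> y * exp (- (c * y\<^sup>2)) = normal_density 0 \<rho> y / sqrt D" for y
  proof -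
    have "- (y\<^sup>2 / (2 * \<tau>\<^sup>2)) - c * y\<^sup>2 = - (y\<^sup>2 / (2 * \<rho>\<^sup>2))"
      unfolding \<rho>(2) \<tau>(2) using assms \<sigma>_pos D by (simp add: field_simps) (simp add: D_def algebra_simps)
    moreover have "sqrt (2 * pi * \<rho>\<^sup>2) * sqrt D = sqrt (2 * pi * \<tau>\<^sup>2)"
      unfolding \<rho>(2) \<tau>(2) real_sqrt_mult[symmetric] using D by simp
    ultimately show ?thesis
      using D by (simp add: normal_density_def field_simps flip: exp_add)
  qed
  have "(CLINT \<omega>|G. iexp (v * psum 1 \<omega>) * exp (- (c * (psum 1 \<omega>)\<^sup>2)))
      = (CLINT y|distr G lborel (psum 1). iexp (v * y) * exp (- (c * y\<^sup>2)))"
    by (subst integral_distr) auto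
  also have "distr G lborel (psum 1) = density lborel (normal_density 0 \<tau>)"
    using dist by (simp add: distributed_def)
  also have "(CLINT y|density lborel (normal_density 0 \<tau>). iexp (v * y) * exp (- (c * y\<^sup>2)))
      = (CLINT y|lborel. normal_density 0 \<tau> y *\<^sub>R (iexp (v * y) * exp (- (c * y\<^sup>2))))"
    by (subst integral_density) auto
  also have "\<dots> = (CLINT y|lborel. (normal_density 0 \<rho> y *\<^sub>R iexp (v * y)) * (1 / sqrt D))"
    using dens by (intro Bochner_Integration.integral_cong)
      (auto simp: scaleR_conv_of_real mult_ac simp flip: of_real_mult of_real_divide)
  also have "\<dots> = exp (- (v\<^sup>2 * \<rho>\<^sup>2 / 2)) * (1 / sqrt D)"
    using integral_normal_density_iexp[OF \<rho>(1), of 0 v] by simp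
  finally show ?thesis unfolding \<rho>(2) by (simp add: D_def)
qed

end

section \<open>The tilted Gaussian weight\<close>

definition cos_weight :: "real \<Rightarrow> nat \<Rightarrow> (nat \<Rightarrow> real) \<Rightarrow> real" where
  "cos_weight \<beta> n x = (\<Prod>k\<in>{1..n}. \<Prod>j\<in>{1..<k}. \<bar>cos ((x j + x k) / 2)\<bar> powr \<beta>)"

lemma cos_weight_nonneg: "0 \<le> cos_weight \<beta> n x"
  unfolding cos_weight_def by (intro prod_nonneg) auto

text \<open>The half sum of two deviations stays in [-pi/2, pi/2], so
  \<open>cos_le_exp_quadratic\<close> applies to every pair without any smallness assumption; this
  yields the global bound 1 on the tilted weight.\<close>

lemma cos_weight_le_gaussian:
  assumes "\<beta> > 0" "\<And>j. j \<in> {1..n} \<Longrightarrow> \<bar>x j\<bar> \<le> pi/2"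
  shows "cos_weight \<beta> n x
    \<le> exp (- (\<beta> / 8 * ((real n - 2) * (\<Sum>j\<in>{1..n}. x j ^ 2) + (\<Sum>j\<in>{1..n}. x j)\<^sup>2)))"
proof -
  have "cos_weight \<beta> n x \<le> (\<Prod>k\<in>{1..n}. \<Prod>j\<in>{1..<k}. exp (- (\<beta> / 8 * (x j + x k)\<^sup>2)))"
    unfolding cos_weight_def
  proof (intro prod_mono conjI prod_nonneg ballI)
    fix k j assume kj: "k \<in> {1..n}" "j \<in> {1..<k}"
    define u where "u = (x j + x k) / 2"
    have "\<bar>x j\<bar> \<le> pi/2" "\<bar>x k\<bar> \<le> pi/2" using kj assms(2)[of j] assms(2)[of k] by auto
    then have u: "\<bar>u\<bar> \<le> pi/2" unfolding u_def using abs_triangle_ineq[of "x j" "x k"] by simp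
    then have "0 \<le> cos u" by (intro cos_ge_zero) auto
    then have "\<bar>cos u\<bar> powr \<beta> \<le> exp (- u\<^sup>2 / 2) powr \<beta>"
      using cos_le_exp_quadratic[OF u] assms(1) by (intro powr_mono2) auto
    also have "\<dots> = exp (- (\<beta> / 8 * (x j + x k)\<^sup>2))"
      by (simp add: powr_def u_def power_divide)
    finally show "\<bar>cos ((x j + x k) / 2)\<bar> powr \<beta> \<le> exp (- (\<beta> / 8 * (x j + x k)\<^sup>2))"
      unfolding u_def .
  qed auto
  also have "\<dots> = exp (- (\<beta> / 8 * (\<Sum>k\<in>{1..n}. \<Sum>j\<in>{1..<k}. (x j + x k)\<^sup>2)))"
    by (simp add: exp_sum[symmetric] sum_distrib_left sum_negf)
  finally show ?thesis by (simp only: sum_pairs_square)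
qed

text \<open>\<open>Q\<close> is \<beta> times the pair sum of -ln cos u - u^2/2 at u = (x_j +
  x_k)/2. Nonnegativity is \<open>cos_le_exp_quadratic\<close> again; 192 = 12 * 16 comes from
  u^4/12; the remainder u^6 is at most x_j^6 + x_k^6, and the sum of these over all pairs is at most
  n p_6.\<close>

lemma cos_weight_expansion:
  assumes "\<beta> > 0" and r: "r < pi/2" "\<And>u::real. \<bar>u\<bar> \<le> r \<Longrightarrow> \<bar>- ln (cos u) - u\<^sup>2 / 2 - u^4 / 12\<bar> \<le> u^6"
    and x: "\<And>j. j \<in> {1..n} \<Longrightarrow> \<bar>x j\<bar> \<le> r"
  obtains Q where
    "cos_weight \<beta> n x = exp (- (\<beta> / 8 * ((real n - 2) * (\<Sum>j\<in>{1..n}. x j ^ 2) + (\<Sum>j\<in>{1..n}. x j)\<^sup>2)) - Q)"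
    "Q \<ge> 0"
    "\<bar>Q - \<beta> / 192 * ((real n - 8) * (\<Sum>j\<in>{1..n}. x j ^ 4)
        + 4 * ((\<Sum>j\<in>{1..n}. x j) * (\<Sum>j\<in>{1..n}. x j ^ 3)) + 3 * (\<Sum>j\<in>{1..n}. x j ^ 2)^2)\<bar>
      \<le> \<beta> * n * (\<Sum>j\<in>{1..n}. x j ^ 6)"
proof -
  define S2 where "S2 = (\<Sum>k\<in>{1..n}. \<Sum>j\<in>{1..<k}. (x j + x k)\<^sup>2)"
  define S4 where "S4 = (\<Sum>k\<in>{1..n}. \<Sum>j\<in>{1..<k}. (x j + x k)^4)"
  define F where "F j k = - ln (cos ((x j + x k) / 2)) - (x j + x k)\<^sup>2 / 8" for j k
  define Q where "Q = \<beta> * (\<Sum>k\<in>{1..n}. \<Sum>j\<in>{1..<k}. F j k)"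
  have u: "\<bar>(x j + x k) / 2\<bar> \<le> r" if "k \<in> {1..n}" "j \<in> {1..<k}" for j k
  proof -
    have "\<bar>x j\<bar> \<le> r" "\<bar>x k\<bar> \<le> r" using that by (auto intro!: x)
    then show ?thesis using abs_triangle_ineq[of "x j" "x k"] by simp
  qed
  have cpos: "0 < cos ((x j + x k) / 2)" if "k \<in> {1..n}" "j \<in> {1..<k}" for j k
    using u[OF that] r(1) by (intro cos_gt_zero_pi) auto
  have Fge: "F j k \<ge> 0" if "k \<in> {1..n}" "j \<in> {1..<k}" for j k
  proof -
    have "ln (cos ((x j + x k) / 2)) \<le> ln (exp (- ((x j + x k) / 2)\<^sup>2 / 2))"
      using cos_le_exp_quadratic[of "(x j + x k) / 2"] u[OF that] r(1) cpos[OF that]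
      by (subst ln_le_cancel_iff) auto
    then show ?thesis by (simp add: F_def power_divide)
  qed
  have Fb: "\<bar>F j k - (x j + x k)^4 / 192\<bar> \<le> x j ^ 6 + x k ^ 6" if "k \<in> {1..n}" "j \<in> {1..<k}" for j k
  proof -
    have "\<bar>F j k - (x j + x k)^4 / 192\<bar> \<le> ((x j + x k) / 2)^6"
      using r(2)[OF u[OF that]] by (simp add: F_def power_divide)
    also have "\<dots> = \<bar>(x j + x k) / 2\<bar>^6" by (rule power_even_abs[symmetric]) simp
    also have "\<dots> \<le> (max \<bar>x j\<bar> \<bar>x k\<bar>)^6"
      using abs_triangle_ineq[of "x j" "x k"] by (intro power_mono) auto
    also have "\<dots> \<le> \<bar>x j\<bar>^6 + \<bar>x k\<bar>^6" by (simp add: max_def)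
    finally show ?thesis by (simp add: power_even_abs)
  qed
  have "cos_weight \<beta> n x = (\<Prod>k\<in>{1..n}. \<Prod>j\<in>{1..<k}. exp (- (\<beta> / 8 * (x j + x k)\<^sup>2) - \<beta> * F j k))"
    unfolding cos_weight_def
  proof (intro prod.cong refl)
    fix k j assume kj: "k \<in> {1..n}" "j \<in> {1..<k}"
    show "\<bar>cos ((x j + x k) / 2)\<bar> powr \<beta> = exp (- (\<beta> / 8 * (x j + x k)\<^sup>2) - \<beta> * F j k)"
      using cpos[OF kj] by (simp add: powr_def F_def algebra_simps)
  qed
  also have "\<dots> = exp (- (\<beta> / 8 * S2) - Q)"
    by (simp add: exp_sum[symmetric] Q_def S2_def sum_distrib_left sum_negf sum_subtractf)
  finally have 1: "cos_weight \<beta> n x = exp (- (\<beta> / 8 * S2) - Q)" .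
  have "\<bar>(\<Sum>k\<in>{1..n}. \<Sum>j\<in>{1..<k}. F j k - (x j + x k)^4 / 192)\<bar>
      \<le> (\<Sum>k\<in>{1..n}. \<Sum>j\<in>{1..<k}. x j ^ 6 + x k ^ 6)"
    by (intro order.trans[OF sum_abs] sum_mono) (use Fb in auto)
  also have "\<dots> \<le> n * (\<Sum>j\<in>{1..n}. x j ^ 6)"
  proof -
    have "2 * (\<Sum>k\<in>{1..n}. \<Sum>j\<in>{1..<k}. x j ^ 6 + x k ^ 6) \<le> (\<Sum>j\<in>{1..n}. \<Sum>k\<in>{1..n}. x j ^ 6 + x k ^ 6)"
      by (rule sum_pairs_le_double_sum) auto
    then show ?thesis by (simp add: sum.distrib sum_distrib_left[symmetric])
  qed
  also have "(\<Sum>k\<in>{1..n}. \<Sum>j\<in>{1..<k}. F j k - (x j + x k)^4 / 192) = (\<Sum>k\<in>{1..n}. \<Sum>j\<in>{1..<k}. F j k) - S4 / 192"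
    by (simp add: S4_def sum_subtractf sum_divide_distrib)
  finally have "\<beta> * \<bar>(\<Sum>k\<in>{1..n}. \<Sum>j\<in>{1..<k}. F j k) - S4 / 192\<bar> \<le> \<beta> * (n * (\<Sum>j\<in>{1..n}. x j ^ 6))"
    using assms(1) by (intro mult_left_mono) auto
  then have 2: "\<bar>Q - \<beta> / 192 * S4\<bar> \<le> \<beta> * n * (\<Sum>j\<in>{1..n}. x j ^ 6)"
    using assms(1) by (simp add: Q_def abs_mult_pos' right_diff_distrib mult.assoc)
  have 3: "Q \<ge> 0"
    unfolding Q_def using assms(1) Fge by (intro mult_nonneg_nonneg sum_nonneg) auto
  from 1 3 2 show ?thesis
    unfolding S2_def S4_def sum_pairs_square sum_pairs_fourth_power by (rule that)
qed

text \<open>The maps e^{ia} and, for b >= 0, e^{-b} are Lipschitz with constant 1 and bounded by 1.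
  Comparing integrands thus reduces to comparing phases and exponents separately.\<close>

lemma norm_iexp_exp_diff_le:
  fixes a a' b b' :: real
  assumes "b \<ge> 0" "b' \<ge> 0"
  shows "cmod (iexp a * exp (- b) - iexp a' * exp (- b')) \<le> \<bar>a - a'\<bar> + \<bar>b - b'\<bar>"
proof -
  have 1: "cmod (iexp a - iexp a') \<le> \<bar>a - a'\<bar>"
  proof -
    have "iexp a - iexp a' = iexp a' * (iexp (a - a') - 1)"
      by (simp add: right_diff_distrib algebra_simps flip: exp_add)
    then have "cmod (iexp a - iexp a') = cmod (iexp (a - a') - 1)"
      by (simp only: norm_mult norm_exp_i_times mult_1)
    then show ?thesis using iexp_approx1[of "a - a'" 0] by simp
  qed
  have 2: "\<bar>exp (- b) - exp (- b')\<bar> \<le> \<bar>b - b'\<bar>"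
  proof -
    have *: "exp (- c) - exp (- d) \<le> d - c" if "0 \<le> c" "c \<le> d" for c d :: real
    proof -
      have "exp (- c) - exp (- d) = exp (- c) * (1 - exp (c - d))"
        by (simp add: right_diff_distrib flip: exp_add)
      also have "\<dots> \<le> 1 * (1 - exp (c - d))" using that by (intro mult_right_mono) auto
      also have "\<dots> \<le> d - c" using exp_ge_add_one_self[of "c - d"] by (simp only: mult_1)
      finally show ?thesis .
    qed
    show ?thesis using *[of b b'] *[of b' b] assms by (cases "b \<le> b'") auto
  qed
  have "iexp a * exp (- b) - iexp a' * exp (- b')
      = (iexp a - iexp a') * exp (- b) + iexp a' * of_real (exp (- b) - exp (- b'))"
    by (simp add: algebra_simps)
  then have "cmod (iexp a * exp (- b) - iexp a' * exp (- b'))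
      \<le> cmod (iexp a - iexp a') * exp (- b) + \<bar>exp (- b) - exp (- b')\<bar>"
    by (metis (no_types, lifting) norm_triangle_ineq norm_mult norm_of_real abs_exp_cancel norm_exp_i_times mult_1)
  also have "cmod (iexp a - iexp a') * exp (- b) \<le> \<bar>a - a'\<bar> * 1"
    using 1 assms by (intro mult_mono) auto
  finally show ?thesis using 2 by simp
qed

text \<open>Replaces a fractional moment by even ones while keeping the scaling: \<sigma> is the
  typical size of \<open>y\<close>, and beyond it \<open>\<bar>y\<bar> / \<sigma>\<close> exceeds 1,
  so its power \<open>q\<close> is at most its square. Summed over n points with \<sigma>^2 of order
  1/n this leaves an error of order \<open>\<sigma> powr q\<close>.\<close>

lemma powr_two_plus_le:
  fixes y \<sigma> q :: real
  assumes "0 < \<sigma>" "0 < q" "q \<le> 2"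
  shows "\<bar>y\<bar> powr (2 + q) \<le> \<sigma> powr q * (y^2 + y^4 / \<sigma>\<^sup>2)"
proof -
  have "\<bar>y\<bar> powr q \<le> \<sigma> powr q * (1 + y\<^sup>2 / \<sigma>\<^sup>2)"
  proof (cases "\<bar>y\<bar> \<le> \<sigma>")
    case True
    then have "\<bar>y\<bar> powr q \<le> \<sigma> powr q * 1" using assms by (simp add: powr_mono2)
    also have "\<dots> \<le> \<sigma> powr q * (1 + y\<^sup>2 / \<sigma>\<^sup>2)" by (intro mult_left_mono) auto
    finally show ?thesis .
  next
    case False
    have "\<bar>y\<bar> powr q = \<sigma> powr q * (\<bar>y\<bar> / \<sigma>) powr q"
      using assms False by (simp add: powr_mult[symmetric])
    also have "(\<bar>y\<bar> / \<sigma>) powr q \<le> (\<bar>y\<bar> / \<sigma>) powr 2"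
      using assms False by (intro powr_mono) auto
    also have "(\<bar>y\<bar> / \<sigma>) powr 2 = y\<^sup>2 / \<sigma>\<^sup>2"
      using assms False by (simp add: power_divide)
    finally show ?thesis using assms by (simp add: algebra_simps add_increasing)
  qed
  then have "y\<^sup>2 * \<bar>y\<bar> powr q \<le> y\<^sup>2 * (\<sigma> powr q * (1 + y\<^sup>2 / \<sigma>\<^sup>2))"
    by (intro mult_left_mono) auto
  moreover have "\<bar>y\<bar> powr (2 + q) = y\<^sup>2 * \<bar>y\<bar> powr q"
    by (cases "y = 0") (simp_all add: powr_add)
  ultimately show ?thesis by (simp add: algebra_simps power2_eq_square power4_eq_xxxx)
qed

text \<open>Trades a linear deviation for a square, so that only variances have to be known; with
  \<open>\<eta>\<close> of the size of the standard deviation this loses only a constant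
  factor.\<close>

lemma abs_le_add_square_div: "(\<eta>::real) > 0 \<Longrightarrow> \<bar>y\<bar> \<le> \<eta> + y\<^sup>2 / \<eta>"
proof -
  assume \<eta>: "\<eta> > 0"
  have "0 \<le> (\<bar>y\<bar> - \<eta>)\<^sup>2 + \<bar>y\<bar> * \<eta>" using \<eta> by simp
  then have "\<bar>y\<bar> * \<eta> \<le> \<eta> * \<eta> + y\<^sup>2" by (simp add: power2_eq_square algebra_simps)
  then show ?thesis using \<eta> by (simp add: field_simps power2_eq_square)
qed

text \<open>Coefficients, in the majorant used in \<open>tilted_weight_approx\<close>, of the statistics
  $1$, $p_2$, $p_4$, $p_6$, $p_1^2$, $p_3^2$, $(p_2 - \mathbb{E} p_2)^2$ and $(p_4 - \mathbb{E} p_4)^2$, where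
  $p_k = \sum_j x_j^k$; \<open>tilt_error\<close> below is the resulting expectation. The numbers \<open>\<eta>\<close> and \<open>\<zeta>\<close> are the
  thresholds in $|y| \le \eta + y^2 / \eta$.\<close>

definition tilt_coeffs :: "real \<Rightarrow> real \<Rightarrow> real \<Rightarrow> real \<Rightarrow> real \<Rightarrow> real \<Rightarrow> real \<Rightarrow> real \<Rightarrow> real \<Rightarrow> nat \<Rightarrow> real list" where
  "tilt_coeffs \<beta> C q d1 d2 r s s0 \<sigma> n = 
    (let \<eta> = 1 / sqrt n; \<zeta> = 1 / (n * sqrt n) in
     [\<bar>s - s0\<bar> * \<bar>d1\<bar> + \<bar>s\<bar> * \<bar>d2\<bar> / 2 * \<eta> + \<bar>s * (d2 / 2 * (n * \<sigma>\<^sup>2)) - s0 * (2 * d2 / \<beta>)\<bar>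
        + \<beta> / 192 * ((n + 8) * \<zeta> + 6 * (n * \<sigma>\<^sup>2) * \<eta> + \<bar>(real n - 8) * (3 * n * \<sigma>^4) + 3 * (n * \<sigma>\<^sup>2)\<^sup>2 - 96 / \<beta>\<^sup>2\<bar>),
      \<bar>s\<bar> * (C * \<sigma> powr q),
      2 / r^4 + \<bar>s\<bar> * (C * \<sigma> powr q) / \<sigma>\<^sup>2,
      \<beta> * n,
      \<bar>s - s0\<bar> * \<bar>d1\<bar> + \<beta> / 192 * (2 / n),
      \<beta> / 192 * (2 * n),
      \<bar>s\<bar> * \<bar>d2\<bar> / 2 / \<eta> + \<beta> / 192 * (3 + 6 * (n * \<sigma>\<^sup>2) / \<eta>),
      \<beta> / 192 * ((n + 8) / \<zeta>)])"

definition tilt_error :: "real list \<Rightarrow> real \<Rightarrow> nat \<Rightarrow> real" where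
  "tilt_error a \<sigma> n = a!0 + a!1 * (n * \<sigma>\<^sup>2) + a!2 * (3 * n * \<sigma>^4) + a!3 * (15 * n * \<sigma>^6) + a!4 * (n * \<sigma>\<^sup>2)
     + a!5 * (15 * n * \<sigma>^6) + a!6 * (2 * n * \<sigma>^4) + a!7 * (96 * n * \<sigma>^8)"

context iid_normal
begin

text \<open>The mirror weight relative to the Gaussian product measure. By \<open>sum_pairs_square\<close> it equals
  $e^{-\beta p_1^2/8}$ times a correction of quartic order, which is why it never exceeds $1$.\<close>

definition tilted_weight :: "real \<Rightarrow> 'a \<Rightarrow> real" where
  "tilted_weight \<beta> \<omega> = (\<Prod>j\<in>{1..n}. indicator {-pi/2<..pi/2} (x j \<omega>)) * cos_weight \<beta> n (\<lambda>j. x j \<omega>)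
     * exp (\<beta> * (real n - 2) / 8 * psum 2 \<omega>)"

lemma cos_weight_measurable[measurable]: "(\<lambda>\<omega>. cos_weight \<beta> n (\<lambda>j. x j \<omega>)) \<in> borel_measurable G"
  unfolding cos_weight_def
proof (intro borel_measurable_prod)
  fix j k assume "k \<in> {1..n}" "j \<in> {1..<k}"
  then have [measurable]: "x k \<in> borel_measurable G" "x j \<in> borel_measurable G" by auto
  show "(\<lambda>\<omega>. \<bar>cos ((x j \<omega> + x k \<omega>) / 2)\<bar> powr \<beta>) \<in> borel_measurable G" by measurable
qed

lemma tilted_weight_measurable[measurable]: "tilted_weight \<beta> \<in> borel_measurable G"
  unfolding tilted_weight_def[abs_def] by measurable

lemma tilted_weight_nonneg: "0 \<le> tilted_weight \<beta> \<omega>"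
  unfolding tilted_weight_def by (intro mult_nonneg_nonneg prod_nonneg cos_weight_nonneg) auto

lemma tilted_weight_le_1:
  assumes "\<beta> > 0"
  shows "tilted_weight \<beta> \<omega> \<le> 1"
proof (cases "\<forall>j\<in>{1..n}. x j \<omega> \<in> {-pi/2<..pi/2}")
  case True
  have "cos_weight \<beta> n (\<lambda>j. x j \<omega>) \<le> exp (- (\<beta> / 8 * ((real n - 2) * psum 2 \<omega> + (psum 1 \<omega>)\<^sup>2)))"
    unfolding psum_def power_one_right
  proof (intro cos_weight_le_gaussian assms)
    fix j assume "j \<in> {1..n}"
    then have "x j \<omega> \<in> {-pi/2<..pi/2}" using True by blast
    then show "\<bar>x j \<omega>\<bar> \<le> pi/2" by auto
  qed
  then have "tilted_weight \<beta> \<omega> \<le> exp (- (\<beta> / 8 * ((real n - 2) * psum 2 \<omega> + (psum 1 \<omega>)\<^sup>2))) * exp (\<beta> * (real n - 2) / 8 * psum 2 \<omega>)"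
    using True unfolding tilted_weight_def by (subst prod.neutral) (auto intro!: mult_right_mono)
  also have "\<dots> = exp (- (\<beta> / 8 * (psum 1 \<omega>)\<^sup>2))"
    unfolding exp_add[symmetric] exp_inj_iff by (simp add: field_simps)
  also have "\<dots> \<le> 1" using assms by simp
  finally show ?thesis .
next
  case False
  then obtain j where "j \<in> {1..n}" "x j \<omega> \<notin> {-pi/2<..pi/2}" by blast
  then have "(\<Prod>j\<in>{1..n}. indicator {-pi/2<..pi/2} (x j \<omega>)) = (0::real)"
    by (intro prod_zero bexI[of _ j]) auto
  then show ?thesis by (simp only: tilted_weight_def mult_zero_left zero_le_one)
qed

text \<open>The comparison is pointwise: one majorant \<open>D\<close>, a combination of power sums
  and squared deviations with known expectations, dominates the difference of the integrands on the
  whole space, and its mean is \<open>tilt_error\<close>. In the limiting integrand only p_1 stays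
  random; p_2 and the quartic exponent are replaced by 4/\<beta> and 1/(2\<beta>).\<close>

lemma tilted_weight_approx:
  fixes h :: "real \<Rightarrow> real" and s s0 d1 d2 C q r :: real
  assumes "\<beta> > 0" "n \<ge> 1" and [measurable]: "h \<in> borel_measurable borel"
    and r: "0 < r" "r < pi/2" "\<And>u::real. \<bar>u\<bar> \<le> r \<Longrightarrow> \<bar>- ln (cos u) - u\<^sup>2 / 2 - u^4 / 12\<bar> \<le> u^6"
    and q: "0 < q" "q \<le> 1" and C: "C \<ge> 0"
    and h: "\<And>y. \<bar>y\<bar> \<le> r \<Longrightarrow> \<bar>h y - d1 * y - d2 / 2 * y\<^sup>2\<bar> \<le> C * \<bar>y\<bar> powr (2 + q)"
  shows "cmod ((CLINT \<omega>|G. iexp (s * (\<Sum>j\<in>{1..n}. h (x j \<omega>))) * tilted_weight \<beta> \<omega>)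
      - (CLINT \<omega>|G. iexp (s0 * (d1 * psum 1 \<omega> + 2 * d2 / \<beta>)) * exp (- (\<beta> / 8 * (psum 1 \<omega>)\<^sup>2 + 1 / (2 * \<beta>)))))
    \<le> tilt_error (tilt_coeffs \<beta> C q d1 d2 r s s0 \<sigma> n) \<sigma> n"
proof -
  define J where "J \<omega> = iexp (s * (\<Sum>j\<in>{1..n}. h (x j \<omega>))) * tilted_weight \<beta> \<omega>" for \<omega>
  define J0 where "J0 \<omega> = iexp (s0 * (d1 * psum 1 \<omega> + 2 * d2 / \<beta>)) * exp (- (\<beta> / 8 * (psum 1 \<omega>)\<^sup>2 + 1 / (2 * \<beta>)))" for \<omega>
  define a where "a = tilt_coeffs \<beta> C q d1 d2 r s s0 \<sigma> n"
  \<comment> \<open>Up to constants \<open>\<eta>\<close> and \<open>\<zeta>\<close> are the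
    standard deviations of p_2 and p_4 when \<sigma>^2 is of order 1/n: the variances 2n\<sigma>^4
    and 96n\<sigma>^8 are then of order 1/n and 1/n^3.\<close>
  define \<eta> where "\<eta> = 1 / sqrt n"
  define \<zeta> where "\<zeta> = 1 / (n * sqrt n)"
  define \<kappa> where "\<kappa> = n * \<sigma>\<^sup>2"
  have n: "real n > 0" using assms(2) by simp
  have pos: "\<eta> > 0" "\<zeta> > 0" "\<kappa> \<ge> 0" using n \<sigma>_pos by (auto simp: \<eta>_def \<zeta>_def \<kappa>_def)
  define a0 where "a0 = \<bar>s - s0\<bar> * \<bar>d1\<bar> + \<bar>s\<bar> * \<bar>d2\<bar> / 2 * \<eta> + \<bar>s * (d2 / 2 * \<kappa>) - s0 * (2 * d2 / \<beta>)\<bar>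
        + \<beta> / 192 * ((n + 8) * \<zeta> + 6 * \<kappa> * \<eta> + \<bar>(real n - 8) * (3 * n * \<sigma>^4) + 3 * \<kappa>\<^sup>2 - 96 / \<beta>\<^sup>2\<bar>)"
  define C' where "C' = C * \<sigma> powr q"
  have C': "C' \<ge> 0" using C by (simp add: C'_def)
  define D where "D \<omega> = a0 + \<bar>s\<bar> * C' * psum 2 \<omega> + (2 / r^4 + \<bar>s\<bar> * C' / \<sigma>\<^sup>2) * psum 4 \<omega> + \<beta> * n * psum 6 \<omega>
      + (\<bar>s - s0\<bar> * \<bar>d1\<bar> + \<beta> / 192 * (2 / n)) * (psum 1 \<omega>)\<^sup>2 + \<beta> / 192 * (2 * n) * (psum 3 \<omega>)\<^sup>2
      + (\<bar>s\<bar> * \<bar>d2\<bar> / 2 / \<eta> + \<beta> / 192 * (3 + 6 * \<kappa> / \<eta>)) * (psum 2 \<omega> - n * \<sigma>\<^sup>2)\<^sup>2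
      + \<beta> / 192 * ((n + 8) / \<zeta>) * (psum 4 \<omega> - 3 * n * \<sigma>^4)\<^sup>2" for \<omega>
  have p_nonneg: "psum 2 \<omega> \<ge> 0" "psum 4 \<omega> \<ge> 0" "psum 6 \<omega> \<ge> 0" for \<omega>
    unfolding psum_def by (auto intro!: sum_nonneg)
  have J1: "cmod (J \<omega>) \<le> 1" for \<omega>
    unfolding J_def using tilted_weight_nonneg tilted_weight_le_1[OF assms(1)] by (simp add: norm_mult)
  have J01: "cmod (J0 \<omega>) \<le> 1" for \<omega>
  proof -
    have "0 \<le> \<beta> / 8 * (psum 1 \<omega>)\<^sup>2 + 1 / (2 * \<beta>)" using assms(1) by (intro add_nonneg_nonneg) auto
    then show ?thesis unfolding J0_def by (simp add: norm_mult)
  qed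
  have [measurable]: "J \<in> borel_measurable G" "J0 \<in> borel_measurable G"
    unfolding J_def[abs_def] J0_def[abs_def] by measurable
  have intJ: "integrable G J" "integrable G J0"
    using J1 J01 by (auto intro!: integrable_const_bound[where B=1])
  have intD: "integrable G D"
    unfolding D_def[abs_def] using psum_squares
    by (intro Bochner_Integration.integrable_add integrable_mult_right integrable_const integrable_psum) auto
  have ED: "expectation D = tilt_error a \<sigma> n"
    unfolding D_def[abs_def] using psum_squares
    by (simp add: expectation_psum prob_space a_def tilt_coeffs_def tilt_error_def Let_def a0_def \<eta>_def \<zeta>_def \<kappa>_def C'_def)
  have a0: "a0 \<ge> 0"
    unfolding a0_def using pos assms(1) n by (intro add_nonneg_nonneg mult_nonneg_nonneg) auto
  have bound: "cmod (J \<omega> - J0 \<omega>) \<le> D \<omega>" for \<omega>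
  proof (cases "\<forall>j\<in>{1..n}. \<bar>x j \<omega>\<bar> \<le> r")
    \<comment> \<open>Outside the Taylor range the trivial bound 2 on the difference suffices, since
      a single large coordinate already makes 2 p_4/r^4 at least 2.\<close>
    case False
    then obtain j where j: "j \<in> {1..n}" "\<bar>x j \<omega>\<bar> > r" by auto
    have "r^4 \<le> \<bar>x j \<omega>\<bar>^4" using j r by (intro power_mono) auto
    also have "\<dots> = x j \<omega> ^ 4" by (rule power_even_abs) simp
    also have "\<dots> \<le> psum 4 \<omega>" unfolding psum_def using j by (intro member_le_sum) auto
    finally have "2 \<le> 2 / r^4 * psum 4 \<omega>" using r by (simp add: field_simps)
    also have "\<dots> \<le> (2 / r^4 + \<bar>s\<bar> * C' / \<sigma>\<^sup>2) * psum 4 \<omega>"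
      using C' p_nonneg by (intro mult_right_mono) auto
    also have "\<dots> \<le> D \<omega>"
    proof -
      have "0 \<le> \<bar>s\<bar> * C' * psum 2 \<omega>" "0 \<le> \<beta> * n * psum 6 \<omega>"
        "0 \<le> (\<bar>s - s0\<bar> * \<bar>d1\<bar> + \<beta> / 192 * (2 / n)) * (psum 1 \<omega>)\<^sup>2" "0 \<le> \<beta> / 192 * (2 * n) * (psum 3 \<omega>)\<^sup>2"
        "0 \<le> (\<bar>s\<bar> * \<bar>d2\<bar> / 2 / \<eta> + \<beta> / 192 * (3 + 6 * \<kappa> / \<eta>)) * (psum 2 \<omega> - n * \<sigma>\<^sup>2)\<^sup>2"
        "0 \<le> \<beta> / 192 * ((n + 8) / \<zeta>) * (psum 4 \<omega> - 3 * n * \<sigma>^4)\<^sup>2"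
        using C' p_nonneg assms(1) n pos by auto
      then show ?thesis unfolding D_def using a0 by linarith
    qed
    finally have "2 \<le> D \<omega>" .
    moreover have "cmod (J \<omega> - J0 \<omega>) \<le> 2" using norm_triangle_ineq4[of "J \<omega>" "J0 \<omega>"] J1[of \<omega>] J01[of \<omega>] by linarith
    ultimately show ?thesis by linarith
  next
    case True
    obtain Q where Q: "cos_weight \<beta> n (\<lambda>j. x j \<omega>) = exp (- (\<beta> / 8 * ((real n - 2) * psum 2 \<omega> + (psum 1 \<omega>)\<^sup>2)) - Q)"
        "Q \<ge> 0"
        "\<bar>Q - \<beta> / 192 * ((real n - 8) * psum 4 \<omega> + 4 * (psum 1 \<omega> * psum 3 \<omega>) + 3 * (psum 2 \<omega>)^2)\<bar> \<le> \<beta> * n * psum 6 \<omega>"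
      unfolding psum_def power_one_right
      using cos_weight_expansion[of \<beta> r n "\<lambda>j. x j \<omega>"] True r assms(1) by blast
    have ind: "(\<Prod>j\<in>{1..n}. indicator {-pi/2<..pi/2} (x j \<omega>)) = (1::real)"
    proof (intro prod.neutral ballI)
      fix j assume "j \<in> {1..n}"
      then have "\<bar>x j \<omega>\<bar> \<le> r" using True by blast
      then have "x j \<omega> \<in> {-pi/2<..pi/2}" using r by auto
      then show "indicator {-pi/2<..pi/2} (x j \<omega>) = (1::real)" by simp
    qed
    have H: "tilted_weight \<beta> \<omega> = exp (- (\<beta> / 8 * (psum 1 \<omega>)\<^sup>2 + Q))"
      unfolding tilted_weight_def ind Q(1) mult_1 exp_add[symmetric] exp_inj_iff by (simp add: field_simps)
    define T where "T = (\<Sum>j\<in>{1..n}. h (x j \<omega>))"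
    have "cmod (J \<omega> - J0 \<omega>) \<le> \<bar>s * T - s0 * (d1 * psum 1 \<omega> + 2 * d2 / \<beta>)\<bar>
        + \<bar>(\<beta> / 8 * (psum 1 \<omega>)\<^sup>2 + Q) - (\<beta> / 8 * (psum 1 \<omega>)\<^sup>2 + 1 / (2 * \<beta>))\<bar>"
      unfolding J_def J0_def H T_def[symmetric] using assms(1) Q(2) by (intro norm_iexp_exp_diff_le) auto
    also have "\<dots> = \<bar>s * T - s0 * (d1 * psum 1 \<omega> + 2 * d2 / \<beta>)\<bar> + \<bar>Q - 1 / (2 * \<beta>)\<bar>" by simp
    finally have J: "cmod (J \<omega> - J0 \<omega>) \<le> \<bar>s * T - s0 * (d1 * psum 1 \<omega> + 2 * d2 / \<beta>)\<bar> + \<bar>Q - 1 / (2 * \<beta>)\<bar>" .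
    define p1 p2 p3 p4 where "p1 = psum 1 \<omega>" "p2 = psum 2 \<omega>" "p3 = psum 3 \<omega>" "p4 = psum 4 \<omega>"
    note p_def = this
    have T: "\<bar>T - d1 * p1 - d2 / 2 * p2\<bar> \<le> C' * (p2 + p4 / \<sigma>\<^sup>2)"
    proof -
      have "T - d1 * p1 - d2 / 2 * p2 = (\<Sum>j\<in>{1..n}. h (x j \<omega>) - d1 * x j \<omega> - d2 / 2 * (x j \<omega>)\<^sup>2)"
        by (simp add: T_def p_def psum_def sum_subtractf sum_distrib_left)
      also have "\<bar>\<dots>\<bar> \<le> (\<Sum>j\<in>{1..n}. C * (\<sigma> powr q * ((x j \<omega>)^2 + (x j \<omega>)^4 / \<sigma>\<^sup>2)))"
      proof (intro order.trans[OF sum_abs] sum_mono)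
        fix j assume "j \<in> {1..n}"
        then have "\<bar>h (x j \<omega>) - d1 * x j \<omega> - d2 / 2 * (x j \<omega>)\<^sup>2\<bar> \<le> C * \<bar>x j \<omega>\<bar> powr (2 + q)"
          using True by (intro h) auto
        also have "\<dots> \<le> C * (\<sigma> powr q * ((x j \<omega>)^2 + (x j \<omega>)^4 / \<sigma>\<^sup>2))"
          using C q \<sigma>_pos by (intro mult_left_mono powr_two_plus_le) auto
        finally show "\<bar>h (x j \<omega>) - d1 * x j \<omega> - d2 / 2 * (x j \<omega>)\<^sup>2\<bar> \<le> C * (\<sigma> powr q * ((x j \<omega>)^2 + (x j \<omega>)^4 / \<sigma>\<^sup>2))" .
      qed
      also have "\<dots> = C' * (p2 + p4 / \<sigma>\<^sup>2)"
        by (simp add: C'_def p_def psum_def sum_distrib_left sum_divide_distrib sum.distrib algebra_simps)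
      finally show ?thesis .
    qed
    have d2b: "\<bar>p2 - \<kappa>\<bar> \<le> \<eta> + (p2 - \<kappa>)\<^sup>2 / \<eta>" and d4b: "\<bar>p4 - 3 * n * \<sigma>^4\<bar> \<le> \<zeta> + (p4 - 3 * n * \<sigma>^4)\<^sup>2 / \<zeta>"
      using pos by (auto intro!: abs_le_add_square_div)
    have d1b: "\<bar>p1\<bar> \<le> 1 + p1\<^sup>2" using abs_le_add_square_div[of 1 p1] by simp
    have sT: "\<bar>s * T - s0 * (d1 * p1 + 2 * d2 / \<beta>)\<bar>
        \<le> \<bar>s\<bar> * (C' * (p2 + p4 / \<sigma>\<^sup>2)) + \<bar>s - s0\<bar> * \<bar>d1\<bar> * (1 + p1\<^sup>2)
          + \<bar>s\<bar> * \<bar>d2\<bar> / 2 * (\<eta> + (p2 - \<kappa>)\<^sup>2 / \<eta>) + \<bar>s * (d2 / 2 * \<kappa>) - s0 * (2 * d2 / \<beta>)\<bar>"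
    proof -
      have "s * T - s0 * (d1 * p1 + 2 * d2 / \<beta>) = s * (T - d1 * p1 - d2 / 2 * p2) + (s - s0) * d1 * p1
          + s * d2 / 2 * (p2 - \<kappa>) + (s * (d2 / 2 * \<kappa>) - s0 * (2 * d2 / \<beta>))"
        by (simp add: algebra_simps diff_divide_distrib)
      also have "\<bar>\<dots>\<bar> \<le> \<bar>s * (T - d1 * p1 - d2 / 2 * p2)\<bar> + \<bar>(s - s0) * d1 * p1\<bar>
          + \<bar>s * d2 / 2 * (p2 - \<kappa>)\<bar> + \<bar>s * (d2 / 2 * \<kappa>) - s0 * (2 * d2 / \<beta>)\<bar>"
        by (intro order.trans[OF abs_triangle_ineq] add_mono order.refl)
      also have "\<bar>s * (T - d1 * p1 - d2 / 2 * p2)\<bar> \<le> \<bar>s\<bar> * (C' * (p2 + p4 / \<sigma>\<^sup>2))"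
        unfolding abs_mult by (intro mult_left_mono T) auto
      also have "\<bar>(s - s0) * d1 * p1\<bar> \<le> \<bar>s - s0\<bar> * \<bar>d1\<bar> * (1 + p1\<^sup>2)"
        unfolding abs_mult by (intro mult_left_mono d1b) auto
      also have "\<bar>s * d2 / 2 * (p2 - \<kappa>)\<bar> = \<bar>s\<bar> * \<bar>d2\<bar> / 2 * \<bar>p2 - \<kappa>\<bar>" by (simp add: abs_mult)
      also have "\<dots> \<le> \<bar>s\<bar> * \<bar>d2\<bar> / 2 * (\<eta> + (p2 - \<kappa>)\<^sup>2 / \<eta>)" by (intro mult_left_mono d2b) auto
      finally show ?thesis by simp
    qed
    have Qb: "\<bar>Q - 1 / (2 * \<beta>)\<bar> \<le> \<beta> * n * psum 6 \<omega> + \<beta> / 192 * ((n + 8) * (\<zeta> + (p4 - 3 * n * \<sigma>^4)\<^sup>2 / \<zeta>)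
        + 2 * (p1\<^sup>2 / n + n * p3\<^sup>2) + 3 * ((p2 - \<kappa>)\<^sup>2 + 2 * \<kappa> * (\<eta> + (p2 - \<kappa>)\<^sup>2 / \<eta>))
        + \<bar>(real n - 8) * (3 * n * \<sigma>^4) + 3 * \<kappa>\<^sup>2 - 96 / \<beta>\<^sup>2\<bar>)"
    proof -
      \<comment> \<open>Centring p_2 and p_4 at their expectations leaves a deterministic term. It
        tends to 0 when n\<sigma>^2 tends to 4/\<beta>, because 3 * 16/\<beta>^2 + 3 * 16/\<beta>^2
        = 96/\<beta>^2.\<close>
      have split: "(real n - 8) * p4 + 4 * (p1 * p3) + 3 * p2^2 - 96 / \<beta>\<^sup>2 = (real n - 8) * (p4 - 3 * n * \<sigma>^4)
          + 4 * (p1 * p3) + 3 * ((p2 - \<kappa>)\<^sup>2 + 2 * \<kappa> * (p2 - \<kappa>)) + ((real n - 8) * (3 * n * \<sigma>^4) + 3 * \<kappa>\<^sup>2 - 96 / \<beta>\<^sup>2)"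
        by (simp add: algebra_simps power2_eq_square)
      have tri: "\<bar>A + 4 * B + 3 * (S + T) + D\<bar> \<le> \<bar>A\<bar> + 4 * \<bar>B\<bar> + 3 * (S + \<bar>T\<bar>) + \<bar>D\<bar>"
        if "0 \<le> S" for A B S T D :: real
      proof -
        have "\<bar>A + 4 * B + 3 * (S + T) + D\<bar> \<le> \<bar>A\<bar> + \<bar>4 * B\<bar> + \<bar>3 * (S + T)\<bar> + \<bar>D\<bar>"
          by (intro order.trans[OF abs_triangle_ineq] add_mono order.refl)
        moreover have "\<bar>3 * (S + T)\<bar> \<le> 3 * (S + \<bar>T\<bar>)"
          using that abs_triangle_ineq[of S T] by (simp add: abs_mult)
        ultimately show ?thesis by (simp add: abs_mult)
      qed
      have "\<bar>2 * \<kappa> * (p2 - \<kappa>)\<bar> = 2 * \<kappa> * \<bar>p2 - \<kappa>\<bar>" using pos by (simp add: abs_mult)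
      with tri[OF zero_le_power2[of "p2 - \<kappa>"], of "(real n - 8) * (p4 - 3 * n * \<sigma>^4)" "p1 * p3" "2 * \<kappa> * (p2 - \<kappa>)"
          "(real n - 8) * (3 * n * \<sigma>^4) + 3 * \<kappa>\<^sup>2 - 96 / \<beta>\<^sup>2"]
      have g0: "\<bar>(real n - 8) * p4 + 4 * (p1 * p3) + 3 * p2^2 - 96 / \<beta>\<^sup>2\<bar>
          \<le> \<bar>(real n - 8) * (p4 - 3 * n * \<sigma>^4)\<bar> + 4 * \<bar>p1 * p3\<bar> + 3 * ((p2 - \<kappa>)\<^sup>2 + 2 * \<kappa> * \<bar>p2 - \<kappa>\<bar>)
          + \<bar>(real n - 8) * (3 * n * \<sigma>^4) + 3 * \<kappa>\<^sup>2 - 96 / \<beta>\<^sup>2\<bar>"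
        unfolding split by (simp only:)
      have g1: "\<bar>(real n - 8) * (p4 - 3 * n * \<sigma>^4)\<bar> \<le> (n + 8) * (\<zeta> + (p4 - 3 * n * \<sigma>^4)\<^sup>2 / \<zeta>)"
        unfolding abs_mult using d4b by (intro mult_mono) auto
      \<comment> \<open>The weight n balances the sizes: for \<sigma>^2 of order 1/n, p_1 is of
        order 1 and p_3 of order 1/n, so both squares contribute at order 1/n.\<close>
      have g2: "4 * \<bar>p1 * p3\<bar> \<le> 2 * (p1\<^sup>2 / n + n * p3\<^sup>2)"
      proof -
        have "0 \<le> (\<bar>p1\<bar> - n * \<bar>p3\<bar>)\<^sup>2" by simp
        then have "2 * (n * \<bar>p1 * p3\<bar>) \<le> p1\<^sup>2 + n * (n * p3\<^sup>2)"
          by (simp add: power2_diff power_mult_distrib abs_mult mult_ac power2_eq_square[of "real n"])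
        then show ?thesis using n by (simp add: field_simps)
      qed
      have g3: "2 * \<kappa> * \<bar>p2 - \<kappa>\<bar> \<le> 2 * \<kappa> * (\<eta> + (p2 - \<kappa>)\<^sup>2 / \<eta>)"
        using pos by (intro mult_left_mono d2b) auto
      have *: "\<bar>(real n - 8) * p4 + 4 * (p1 * p3) + 3 * p2^2 - 96 / \<beta>\<^sup>2\<bar>
          \<le> (n + 8) * (\<zeta> + (p4 - 3 * n * \<sigma>^4)\<^sup>2 / \<zeta>) + 2 * (p1\<^sup>2 / n + n * p3\<^sup>2)
          + 3 * ((p2 - \<kappa>)\<^sup>2 + 2 * \<kappa> * (\<eta> + (p2 - \<kappa>)\<^sup>2 / \<eta>)) + \<bar>(real n - 8) * (3 * n * \<sigma>^4) + 3 * \<kappa>\<^sup>2 - 96 / \<beta>\<^sup>2\<bar>"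
        (is "\<bar>?S - _\<bar> \<le> ?R")
        by (rule order.trans[OF g0]) (intro add_mono g1 g2 g3 mult_left_mono order.refl; simp)
      \<comment> \<open>Here \<beta>/192 * 96/\<beta>^2 = 1/(2\<beta>).\<close>
      have "Q - 1 / (2 * \<beta>) = (Q - \<beta> / 192 * ?S) + \<beta> / 192 * (?S - 96 / \<beta>\<^sup>2)"
        using assms(1) by (simp add: right_diff_distrib power2_eq_square)
      then have "\<bar>Q - 1 / (2 * \<beta>)\<bar> \<le> \<bar>Q - \<beta> / 192 * ?S\<bar> + \<bar>\<beta> / 192 * (?S - 96 / \<beta>\<^sup>2)\<bar>" by linarith
      also have "\<bar>\<beta> / 192 * (?S - 96 / \<beta>\<^sup>2)\<bar> = \<beta> / 192 * \<bar>?S - 96 / \<beta>\<^sup>2\<bar>" using assms(1) by (simp add: abs_mult)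
      also have "\<dots> \<le> \<beta> / 192 * ?R" using * assms(1) by (intro mult_left_mono) auto
      finally show ?thesis using Q(3) unfolding p_def by linarith
    qed
    \<comment> \<open>\<open>D\<close> exceeds the sum of the two bounds exactly by the escape term
      2 p_4/r^4, which is nonnegative.\<close>
    have "D \<omega> \<ge> (\<bar>s\<bar> * (C' * (p2 + p4 / \<sigma>\<^sup>2)) + \<bar>s - s0\<bar> * \<bar>d1\<bar> * (1 + p1\<^sup>2)
          + \<bar>s\<bar> * \<bar>d2\<bar> / 2 * (\<eta> + (p2 - \<kappa>)\<^sup>2 / \<eta>) + \<bar>s * (d2 / 2 * \<kappa>) - s0 * (2 * d2 / \<beta>)\<bar>)
       + (\<beta> * n * psum 6 \<omega> + \<beta> / 192 * ((n + 8) * (\<zeta> + (p4 - 3 * n * \<sigma>^4)\<^sup>2 / \<zeta>)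
        + 2 * (p1\<^sup>2 / n + n * p3\<^sup>2) + 3 * ((p2 - \<kappa>)\<^sup>2 + 2 * \<kappa> * (\<eta> + (p2 - \<kappa>)\<^sup>2 / \<eta>))
        + \<bar>(real n - 8) * (3 * n * \<sigma>^4) + 3 * \<kappa>\<^sup>2 - 96 / \<beta>\<^sup>2\<bar>))"
    proof -
      define E where "E = \<bar>(real n - 8) * (3 * n * \<sigma>^4) + 3 * \<kappa>\<^sup>2 - 96 / \<beta>\<^sup>2\<bar>"
      define F where "F = \<bar>s * (d2 / 2 * \<kappa>) - s0 * (2 * d2 / \<beta>)\<bar>"
      have "0 \<le> 2 / r^4 * p4" using p_nonneg by (simp add: p_def)
      then show ?thesis
        unfolding D_def a0_def p_def[symmetric] \<kappa>_def[symmetric] E_def[symmetric] F_def[symmetric]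
        by (simp add: algebra_simps add_divide_distrib)
    qed
    then show ?thesis using J sT Qb unfolding p_def by linarith
  qed
  have "cmod (expectation J - expectation J0) = cmod (expectation (\<lambda>\<omega>. J \<omega> - J0 \<omega>))"
    using intJ by simp
  also have "\<dots> \<le> expectation (\<lambda>\<omega>. cmod (J \<omega> - J0 \<omega>))" by (rule integral_norm_bound)
  also have "\<dots> \<le> expectation D"
    using bound intJ intD by (intro integral_mono) auto
  finally show ?thesis unfolding ED a_def J_def[abs_def] J0_def[abs_def] .
qed

end

section \<open>Choice of the variance and decay of the error\<close>

definition mirror_sd :: "real \<Rightarrow> nat \<Rightarrow> real" where
  "mirror_sd \<beta> n = sqrt (4 / (\<beta> * (real n - 2)))"

lemma mirror_sd_pos: "\<beta> > 0 \<Longrightarrow> n \<ge> 3 \<Longrightarrow> mirror_sd \<beta> n > 0"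
  by (simp add: mirror_sd_def)

lemma mirror_sd_square: "\<beta> > 0 \<Longrightarrow> n \<ge> 3 \<Longrightarrow> (mirror_sd \<beta> n)\<^sup>2 = 4 / (\<beta> * (real n - 2))"
  by (simp add: mirror_sd_def)

lemma n_mirror_sd_square_tendsto:
  assumes "\<beta> > 0"
  shows "(\<lambda>n. real n * (mirror_sd \<beta> n)\<^sup>2) \<longlonglongrightarrow> 4 / \<beta>"
proof -
  have "(\<lambda>n. 4 / \<beta> * (real n / (real n - 2))) \<longlonglongrightarrow> 4 / \<beta> * 1"
    by (intro tendsto_mult tendsto_const) real_asymp
  moreover have "\<forall>\<^sub>F n in sequentially. 4 / \<beta> * (real n / (real n - 2)) = real n * (mirror_sd \<beta> n)\<^sup>2"
    using eventually_ge_at_top[of 3] by eventually_elim (use assms in \<open>simp add: mirror_sd_square\<close>)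
  ultimately show ?thesis by (simp add: Lim_transform_eventually)
qed

text \<open>Everything is built from n\<sigma>^2, which has a finite limit, and from null sequences.
  Only two groups of terms do not vanish factor by factor, and there the limits cancel: s d_2/2
  times n\<sigma>^2 against 2 s_0 d_2/\<beta>, and the quartic mean against 96/\<beta>^2.\<close>

lemma tilt_error_tendsto_0:
  assumes "\<beta> > 0" "q > 0" "s \<longlonglongrightarrow> s0" "r > 0"
  shows "(\<lambda>n. tilt_error (tilt_coeffs \<beta> C q d1 d2 r (s n) s0 (mirror_sd \<beta> n) n) (mirror_sd \<beta> n) n) \<longlonglongrightarrow> 0"
proof -
  define \<sigma> where "\<sigma> = mirror_sd \<beta>"
  define c where "c = \<beta> / 192"
  define \<kappa> where "\<kappa> n = real n * (\<sigma> n)\<^sup>2" for n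
  define w where "w n = sqrt (real n) * (\<sigma> n)\<^sup>2" for n
  define u1 u2 u3 u4 u5 where "u1 n = 1 / real n" "u2 n = 1 / sqrt (real n)" "u3 n = (real n + 8) * (1 / (real n * sqrt (real n)))"
    "u4 n = (real n + 8) * (1 / real n)" "u5 n = 8 / real n" for n
  note u_def = this
  define v where "v n = (\<sigma> n)\<^sup>2" for n
  define p where "p n = \<sigma> n powr q" for n
  \<comment> \<open>The error regrouped so that every factor converges and no unbounded factor such
    as n is left over.\<close>
  define E where "E n = 
     \<bar>s n - s0\<bar> * \<bar>d1\<bar> + \<bar>s n\<bar> * \<bar>d2\<bar> / 2 * u2 n + \<bar>s n * (d2 / 2 * \<kappa> n) - s0 * (2 * d2 / \<beta>)\<bar>
        + c * (u3 n + 6 * \<kappa> n * u2 n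
            + \<bar>3 * ((1 - u5 n) * (\<kappa> n)\<^sup>2) + 3 * (\<kappa> n)\<^sup>2 - 96 / \<beta>\<^sup>2\<bar>)
     + \<bar>s n\<bar> * (C * p n) * \<kappa> n
     + (2 / r^4 * (3 * \<kappa> n * v n) + \<bar>s n\<bar> * (C * p n) * (3 * \<kappa> n))
     + \<beta> * 15 * ((\<kappa> n)\<^sup>2 * v n)
     + (\<bar>s n - s0\<bar> * \<bar>d1\<bar> + c * (2 * u1 n)) * \<kappa> n
     + 30 * c * ((\<kappa> n)\<^sup>2 * v n)
     + (\<bar>s n\<bar> * \<bar>d2\<bar> * (w n * \<kappa> n)
         + c * 2 * (3 * (\<kappa> n * v n) + 6 * (\<kappa> n)\<^sup>2 * w n))
     + 96 * c * ((\<kappa> n)\<^sup>2 * (u4 n * (\<kappa> n * w n)))" for n :: nat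
  have \<kappa>: "\<kappa> \<longlonglongrightarrow> 4 / \<beta>"
    unfolding \<sigma>_def \<kappa>_def by (rule n_mirror_sd_square_tendsto[OF assms(1)])
  have i: "u1 \<longlonglongrightarrow> 0" "u2 \<longlonglongrightarrow> 0" "u3 \<longlonglongrightarrow> 0" "u4 \<longlonglongrightarrow> 1" "u5 \<longlonglongrightarrow> 0"
    unfolding u_def[abs_def] by real_asymp+
  have "(\<lambda>n. u1 n * \<kappa> n) \<longlonglongrightarrow> 0 * (4 / \<beta>)" by (intro tendsto_mult i \<kappa>)
  moreover have "\<forall>\<^sub>F n in sequentially. u1 n * \<kappa> n = v n"
    using eventually_gt_at_top[of 0] by eventually_elim (simp add: \<kappa>_def u_def v_def)
  ultimately have v: "v \<longlonglongrightarrow> 0"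
    by (simp add: Lim_transform_eventually)
  then have "(\<lambda>n. sqrt (v n)) \<longlonglongrightarrow> sqrt 0" by (intro tendsto_real_sqrt)
  then have s: "\<sigma> \<longlonglongrightarrow> 0" by (simp add: v_def tendsto_rabs_zero_iff)
  have \<sigma>_pos: "\<forall>\<^sub>F n in sequentially. \<sigma> n > 0"
    using eventually_ge_at_top[of 3] by eventually_elim (use assms in \<open>simp add: \<sigma>_def mirror_sd_pos\<close>)
  have p: "p \<longlonglongrightarrow> 0"
    unfolding p_def[abs_def] using \<sigma>_pos by (intro tendsto_zero_powrI[OF s tendsto_const _ assms(2)]) (auto elim: eventually_mono)
  have *: "(\<lambda>n. u2 n * \<kappa> n) \<longlonglongrightarrow> 0 * (4 / \<beta>)" by (intro tendsto_mult i \<kappa>)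
  have w: "w \<longlonglongrightarrow> 0"
  proof -
    have "1 / sqrt (real n) * (real n * (\<sigma> n)\<^sup>2) = sqrt n * (\<sigma> n)\<^sup>2" for n
      using real_div_sqrt[of "real n"] by (metis mult.commute mult_1 of_nat_0_le_iff times_divide_eq_left times_divide_eq_right)
    then show ?thesis using * by (simp add: \<kappa>_def w_def[abs_def] u_def)
  qed
  note lims = \<kappa> i v p w assms(3)
  have "E \<longlonglongrightarrow> \<bar>s0 - s0\<bar> * \<bar>d1\<bar> + \<bar>s0\<bar> * \<bar>d2\<bar> / 2 * 0 + \<bar>s0 * (d2 / 2 * (4 / \<beta>)) - s0 * (2 * d2 / \<beta>)\<bar>
        + c * (0 + 6 * (4 / \<beta>) * 0 + \<bar>3 * ((1 - 0) * (4 / \<beta>)\<^sup>2) + 3 * (4 / \<beta>)\<^sup>2 - 96 / \<beta>\<^sup>2\<bar>)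
     + \<bar>s0\<bar> * (C * 0) * (4 / \<beta>)
     + (2 / r^4 * (3 * (4 / \<beta>) * 0) + \<bar>s0\<bar> * (C * 0) * (3 * (4 / \<beta>)))
     + \<beta> * 15 * ((4 / \<beta>)\<^sup>2 * 0)
     + (\<bar>s0 - s0\<bar> * \<bar>d1\<bar> + c * (2 * 0)) * (4 / \<beta>)
     + 30 * c * ((4 / \<beta>)\<^sup>2 * 0)
     + (\<bar>s0\<bar> * \<bar>d2\<bar> * (0 * (4 / \<beta>)) + c * 2 * (3 * ((4 / \<beta>) * 0) + 6 * (4 / \<beta>)\<^sup>2 * 0))
     + 96 * c * ((4 / \<beta>)\<^sup>2 * (1 * ((4 / \<beta>) * 0)))"
    unfolding E_def[abs_def] by (intro tendsto_intros lims) auto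
  then have "E \<longlonglongrightarrow> 0" by (simp add: power_divide)
  moreover have "\<forall>\<^sub>F n in sequentially. E n = tilt_error (tilt_coeffs \<beta> C q d1 d2 r (s n) s0 (\<sigma> n) n) (\<sigma> n) n"
    using \<sigma>_pos eventually_gt_at_top[of 0]
  proof eventually_elim
    case (elim n)
    \<comment> \<open>Writing n as the square of \<open>R\<close> removes the square roots, and the
      identity becomes one between rational expressions.\<close>
    define R where "R = sqrt n"
    have R: "R > 0" "real n = R\<^sup>2" using elim by (auto simp: R_def)
    have e: "3 * ((1 - 8 / real n) * (real n * (\<sigma> n)\<^sup>2)\<^sup>2) = (real n - 8) * (real (3 * n) * \<sigma> n ^ 4)"
      using elim by (simp add: field_simps numeral_nat)
    show ?case
      unfolding E_def \<kappa>_def w_def u_def v_def p_def tilt_error_def tilt_coeffs_def Let_def c_def[symmetric] R_def[symmetric] e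
        nth_Cons_0 nth_Cons_numeral
      by (intro arg_cong2[where f="(+)"]; (rule refl | use elim R(1) in \<open>simp add: R(2) field_simps\<close>; simp add: numeral_nat)?)
  qed
  ultimately show ?thesis unfolding \<sigma>_def by (rule Lim_transform_eventually)
qed

section \<open>Change of measure\<close>

lemma density_PiM_lborel:
  fixes f :: "real \<Rightarrow> ennreal"
  assumes "finite I" and [measurable]: "f \<in> borel_measurable borel" and sf: "sigma_finite_measure (density lborel f)"
  shows "density (PiM I (\<lambda>_. lborel)) (\<lambda>x. \<Prod>i\<in>I. f (x i)) = PiM I (\<lambda>_. density lborel f)"
proof -
  interpret N: product_sigma_finite "\<lambda>_. density lborel f"
    using sf by (simp add: product_sigma_finite_def)
  interpret L: product_sigma_finite "\<lambda>_. lborel :: real measure"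
    by (simp add: product_sigma_finite_def sigma_finite_lborel)
  show ?thesis
  proof (rule N.PiM_eqI[OF assms(1)])
    show "sets (density (PiM I (\<lambda>_. lborel)) (\<lambda>x. \<Prod>i\<in>I. f (x i))) = sets (PiM I (\<lambda>_. density lborel f))"
      by (simp cong: sets_PiM_cong)
  next
    fix A assume "\<And>i. i \<in> I \<Longrightarrow> A i \<in> sets (density lborel f)"
    then have A: "A i \<in> sets borel" if "i \<in> I" for i using that by simp
    then have [measurable]: "Pi\<^sub>E I A \<in> sets (PiM I (\<lambda>_. lborel))"
      using assms(1) by (intro sets_PiM_I_finite) auto
    have "emeasure (density (PiM I (\<lambda>_. lborel)) (\<lambda>x. \<Prod>i\<in>I. f (x i))) (Pi\<^sub>E I A)
        = (\<integral>\<^sup>+x. (\<Prod>i\<in>I. f (x i)) * indicator (Pi\<^sub>E I A) x \<partial>PiM I (\<lambda>_. lborel))"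
      by (rule emeasure_density) measurable
    also have "\<dots> = (\<integral>\<^sup>+x. (\<Prod>i\<in>I. f (x i) * indicator (A i) (x i)) \<partial>PiM I (\<lambda>_. lborel))"
    proof (rule nn_integral_cong)
      fix x assume "x \<in> space (PiM I (\<lambda>_. lborel :: real measure))"
      then have "x \<in> extensional I" by (simp add: space_PiM PiE_def)
      then have "indicator (Pi\<^sub>E I A) x = (\<Prod>i\<in>I. indicator (A i) (x i) :: ennreal)"
        using assms(1) by (auto simp: indicator_def PiE_def Pi_def prod_zero_iff)
      then show "(\<Prod>i\<in>I. f (x i)) * indicator (Pi\<^sub>E I A) x = (\<Prod>i\<in>I. f (x i) * indicator (A i) (x i))"
        by (simp add: prod.distrib)
    qed
    also have "\<dots> = (\<Prod>i\<in>I. \<integral>\<^sup>+x. f x * indicator (A i) x \<partial>lborel)"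
      using A assms(1) by (intro L.product_nn_integral_prod) auto
    also have "\<dots> = (\<Prod>i\<in>I. emeasure (density lborel f) (A i))"
      using A by (intro prod.cong) (simp_all add: emeasure_density)
    finally show "emeasure (density (PiM I (\<lambda>_. lborel)) (\<lambda>x. \<Prod>i\<in>I. f (x i))) (Pi\<^sub>E I A)
        = (\<Prod>i\<in>I. emeasure (density lborel f) (A i))" .
  qed
qed

abbreviation lborel_pow :: "nat \<Rightarrow> (nat \<Rightarrow> real) measure" where
  "lborel_pow n \<equiv> PiM {1..n} (\<lambda>_. lborel)"

lemma measurable_id_mirror_base: "(\<lambda>x. x) \<in> measurable (mirror_base n) (lborel_pow n)"
  unfolding mirror_base_def
proof (rule measurable_PiM_single')
  show "(\<lambda>x. x i) \<in> measurable (PiM {1..n} (\<lambda>_. restrict_space lborel {-pi<..pi})) lborel" if "i \<in> {1..n}" for i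
    by (rule measurable_compose[OF measurable_component_singleton[OF that]])
       (simp add: measurable_restrict_space1)
  show "(\<lambda>x. x) \<in> space (PiM {1..n} (\<lambda>_. restrict_space lborel {-pi<..pi})) \<rightarrow> {1..n} \<rightarrow>\<^sub>E space lborel"
    by (auto simp: space_PiM PiE_def)
qed

text \<open>\<open>mirror_base\<close> is a product of restricted spaces, so its sigma-algebra
  differs from that of the Gaussian comparison measures. The push-forward along the identity puts
  both on \<open>lborel_pow n\<close> as densities.\<close>

lemma distr_mirror_base:
  "distr (mirror_base n) (lborel_pow n) (\<lambda>x. x) = density (lborel_pow n) (\<lambda>x. \<Prod>i\<in>{1..n}. indicator {-pi<..pi} (x i))"
proof -
  let ?f = "indicator {-pi<..pi} :: real \<Rightarrow> ennreal"
  let ?R = "restrict_space lborel {-pi<..pi}"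
  have fin: "finite_measure (density lborel ?f)"
    by (rule finite_measureI) (simp add: emeasure_density)
  have finR: "finite_measure ?R"
    by (rule finite_measureI) (simp add: emeasure_restrict_space space_restrict_space)
  interpret N: product_sigma_finite "\<lambda>_::nat. density lborel ?f"
    unfolding product_sigma_finite_def using fin by (simp add: finite_measure_def)
  interpret R: product_sigma_finite "\<lambda>_::nat. ?R"
    unfolding product_sigma_finite_def using finR by (simp add: finite_measure_def)
  have "distr (mirror_base n) (lborel_pow n) (\<lambda>x. x) = PiM {1..n} (\<lambda>_. density lborel ?f)"
  proof (rule N.PiM_eqI)
    show "sets (distr (mirror_base n) (lborel_pow n) (\<lambda>x. x)) = sets (PiM {1..n} (\<lambda>_. density lborel ?f))"
      by (simp cong: sets_PiM_cong)
  next
    fix A assume "\<And>i. i \<in> {1..n} \<Longrightarrow> A i \<in> sets (density lborel ?f)"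
    then have A: "A i \<in> sets borel" if "i \<in> {1..n}" for i using that by simp
    have AR: "A i \<inter> {-pi<..pi} \<in> sets ?R" if "i \<in> {1..n}" for i
      using A[OF that] by (subst sets_restrict_space_iff) auto
    have S: "Pi\<^sub>E {1..n} A \<in> sets (lborel_pow n)"
      using A by (intro sets_PiM_I_finite) auto
    have "emeasure (distr (mirror_base n) (lborel_pow n) (\<lambda>x. x)) (Pi\<^sub>E {1..n} A)
        = emeasure (mirror_base n) (Pi\<^sub>E {1..n} A \<inter> space (mirror_base n))"
      using S measurable_id_mirror_base by (subst emeasure_distr) auto
    also have "Pi\<^sub>E {1..n} A \<inter> space (mirror_base n) = Pi\<^sub>E {1..n} (\<lambda>i. A i \<inter> {-pi<..pi})"
      by (auto simp: mirror_base_def space_PiM space_restrict_space PiE_def)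
    also have "emeasure (mirror_base n) \<dots> = (\<Prod>i\<in>{1..n}. emeasure ?R (A i \<inter> {-pi<..pi}))"
      unfolding mirror_base_def using AR by (intro R.emeasure_PiM) auto
    also have "\<dots> = (\<Prod>i\<in>{1..n}. emeasure (density lborel ?f) (A i))"
      using A by (intro prod.cong)
        (auto simp: emeasure_density emeasure_restrict_space indicator_inter_arith[symmetric] Int_commute mult.commute)
    finally show "emeasure (distr (mirror_base n) (lborel_pow n) (\<lambda>x. x)) (Pi\<^sub>E {1..n} A)
        = (\<Prod>i\<in>{1..n}. emeasure (density lborel ?f) (A i))" .
  qed simp
  also have "\<dots> = density (lborel_pow n) (\<lambda>x. \<Prod>i\<in>{1..n}. ?f (x i))"
    using fin by (intro density_PiM_lborel[symmetric]) (auto simp: finite_measure_def)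
  finally show ?thesis .
qed

definition gaussian_pow :: "real \<Rightarrow> real \<Rightarrow> nat \<Rightarrow> (nat \<Rightarrow> real) measure" where
  "gaussian_pow a \<sigma> n = PiM {1..n} (\<lambda>_. density lborel (normal_density a \<sigma>))"

lemma gaussian_pow_eq_density:
  assumes "\<sigma> > 0"
  shows "gaussian_pow a \<sigma> n = density (lborel_pow n) (\<lambda>x. ennreal (\<Prod>i\<in>{1..n}. normal_density a \<sigma> (x i)))"
proof -
  interpret prob_space "density lborel (normal_density a \<sigma>)"
    using assms by (rule prob_space_normal_density)
  have "gaussian_pow a \<sigma> n = density (lborel_pow n) (\<lambda>x. \<Prod>i\<in>{1..n}. ennreal (normal_density a \<sigma> (x i)))"
    unfolding gaussian_pow_def
    by (rule density_PiM_lborel[symmetric]) (auto intro: sigma_finite_measure_axioms)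
  then show ?thesis by (simp add: prod_ennreal)
qed

lemma iid_normal_gaussian_pow:
  assumes \<sigma>: "\<sigma> > 0" and n: "n \<ge> 1"
  shows "iid_normal (gaussian_pow a \<sigma> n) (\<lambda>i \<theta>. \<theta> i - a) \<sigma> n"
proof -
  let ?N = "density lborel (normal_density a \<sigma>)"
  interpret N: prob_space ?N using \<sigma> by (rule prob_space_normal_density)
  interpret P: prob_space "gaussian_pow a \<sigma> n"
    unfolding gaussian_pow_def by (rule prob_space_PiM) (rule N.prob_space_axioms)
  have comp: "distr (gaussian_pow a \<sigma> n) ?N (\<lambda>\<theta>. \<theta> i) = ?N" if "i \<in> {1..n}" for i
    unfolding gaussian_pow_def using that
    by (intro distr_PiM_component N.prob_space_axioms) auto
  have rv: "(\<lambda>\<theta>. \<theta> i) \<in> measurable (gaussian_pow a \<sigma> n) ?N" if "i \<in> {1..n}" for i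
    unfolding gaussian_pow_def using that by (rule measurable_component_singleton)
  have "P.indep_vars (\<lambda>_. ?N) (\<lambda>i \<theta>. \<theta> i) {1..n}"
  proof (subst P.indep_vars_iff_distr_eq_PiM')
    have "distr (gaussian_pow a \<sigma> n) (PiM {1..n} (\<lambda>_. ?N)) (\<lambda>\<theta>. restrict \<theta> {1..n})
        = distr (gaussian_pow a \<sigma> n) (gaussian_pow a \<sigma> n) (\<lambda>\<theta>. \<theta>)"
      by (rule distr_cong) (auto simp: gaussian_pow_def space_PiM PiE_def extensional_restrict)
    also have "\<dots> = PiM {1..n} (\<lambda>_. ?N)" by (simp add: distr_id gaussian_pow_def)
    also have "\<dots> = PiM {1..n} (\<lambda>i. distr (gaussian_pow a \<sigma> n) ?N (\<lambda>\<theta>. \<theta> i))"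
      by (rule PiM_cong) (use comp in auto)
    finally show "distr (gaussian_pow a \<sigma> n) (PiM {1..n} (\<lambda>_. ?N)) (\<lambda>x. \<lambda>i\<in>{1..n}. x i)
      = PiM {1..n} (\<lambda>i. distr (gaussian_pow a \<sigma> n) ?N (\<lambda>\<theta>. \<theta> i))" .
  qed (use n rv in auto)
  then have indep: "P.indep_vars (\<lambda>_. borel) (\<lambda>i \<theta>. \<theta> i - a) {1..n}"
    by (rule P.indep_vars_compose2) measurable
  have dist: "distributed (gaussian_pow a \<sigma> n) lborel (\<lambda>\<theta>. \<theta> i - a) (normal_density 0 \<sigma>)" if i: "i \<in> {1..n}" for i
  proof -
    have "distr (gaussian_pow a \<sigma> n) lborel (\<lambda>\<theta>. \<theta> i) = distr (gaussian_pow a \<sigma> n) ?N (\<lambda>\<theta>. \<theta> i)"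
      by (rule distr_cong) auto
    then have "distributed (gaussian_pow a \<sigma> n) lborel (\<lambda>\<theta>. \<theta> i) (normal_density a \<sigma>)"
      using comp[OF i] rv[OF i] by (simp add: distributed_def cong: measurable_cong_sets)
    from P.normal_density_affine[OF this \<sigma>, of 1 "-a"] show ?thesis by simp
  qed
  show ?thesis
    by unfold_locales (use \<sigma> indep dist in auto)
qed

section \<open>The mirror density in terms of sines\<close>

definition sin_weight :: "real \<Rightarrow> nat \<Rightarrow> (nat \<Rightarrow> real) \<Rightarrow> real" where
  "sin_weight \<beta> n \<theta> = (\<Prod>k\<in>{1..n}. \<Prod>j\<in>{1..<k}. \<bar>sin ((\<theta> j + \<theta> k) / 2)\<bar> powr \<beta>)"

lemma mirror_weight_eq_sin_weight:
  "mirror_weight n \<beta> \<theta> = (\<Prod>k\<in>{1..n}. \<Prod>j\<in>{1..<k}. 2 powr \<beta>) * sin_weight \<beta> n \<theta>"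
  unfolding mirror_weight_def sin_weight_def cmod_cis_diff_mirror
  by (simp add: powr_mult prod.distrib)

lemma sin_weight_nonneg: "0 \<le> sin_weight \<beta> n \<theta>"
  unfolding sin_weight_def by (intro prod_nonneg) auto

lemma sin_weight_measurable[measurable]: "sin_weight \<beta> n \<in> borel_measurable (lborel_pow n)"
  unfolding sin_weight_def[abs_def]
proof (intro borel_measurable_prod)
  fix j k assume "k \<in> {1..n}" "j \<in> {1..<k}"
  then have [measurable]: "(\<lambda>\<theta>. \<theta> k) \<in> borel_measurable (lborel_pow n)" "(\<lambda>\<theta>. \<theta> j) \<in> borel_measurable (lborel_pow n)"
    by auto
  show "(\<lambda>\<theta>. \<bar>sin ((\<theta> j + \<theta> k) / 2)\<bar> powr \<beta>) \<in> borel_measurable (lborel_pow n)" by measurable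
qed

text \<open>Since cos a = 0 and |sin a| = 1, |sin u| = |cos (u - a)|, and centring both points at
  \<open>a\<close> shifts their half sum by \<open>a\<close>. Both centres lead to the same weight;
  this is the symmetry behind the fair coin.\<close>

lemma sin_weight_shift:
  assumes "a = pi/2 \<or> a = -pi/2"
  shows "sin_weight \<beta> n \<theta> = cos_weight \<beta> n (\<lambda>j. \<theta> j - a)"
proof -
  have "cos a = 0 \<and> \<bar>sin a\<bar> = 1"
    using assms
  proof (elim disjE)
    assume "a = pi/2"
    then show ?thesis by (simp only: cos_pi_half sin_pi_half) simp
  next
    assume "a = - pi/2"
    then show ?thesis by (simp only: minus_divide_left[symmetric] cos_minus sin_minus cos_pi_half sin_pi_half) simp
  qed
  then have "\<bar>sin u\<bar> = \<bar>cos (u - a)\<bar>" for u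
    by (simp add: cos_diff abs_mult)
  moreover have "(\<theta> j - a + (\<theta> k - a)) / 2 = (\<theta> j + \<theta> k) / 2 - a" for j k by (simp add: field_simps)
  ultimately show ?thesis unfolding sin_weight_def cos_weight_def by (simp only:)
qed

lemma integral_mirror_base:
  fixes F :: "(nat \<Rightarrow> real) \<Rightarrow> 'b :: {banach, second_countable_topology}"
  assumes [measurable]: "F \<in> borel_measurable (lborel_pow n)"
  shows "(LINT \<theta>|mirror_base n. F \<theta>) = (LINT \<theta>|lborel_pow n. (\<Prod>i\<in>{1..n}. indicator {-pi<..pi} (\<theta> i)) *\<^sub>R F \<theta>)"
proof -
  have "(LINT \<theta>|mirror_base n. F \<theta>) = (LINT \<theta>|distr (mirror_base n) (lborel_pow n) (\<lambda>x. x). F \<theta>)"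
    by (rule integral_distr[OF measurable_id_mirror_base assms, symmetric])
  also have "distr (mirror_base n) (lborel_pow n) (\<lambda>x. x)
      = density (lborel_pow n) (\<lambda>x. ennreal (\<Prod>i\<in>{1..n}. indicator {-pi<..pi} (x i)))"
    unfolding distr_mirror_base by (simp add: prod_ennreal[symmetric] ennreal_indicator)
  also have "(LINT \<theta>|\<dots>. F \<theta>) = (LINT \<theta>|lborel_pow n. (\<Prod>i\<in>{1..n}. indicator {-pi<..pi} (\<theta> i)) *\<^sub>R F \<theta>)"
    by (intro integral_density assms) (auto intro!: prod_nonneg)
  finally show ?thesis .
qed

text \<open>The powers of 2 from the chord lengths cancel in the quotient. The denominator has the
  form of the numerator with \<open>F = 1\<close>, so that one asymptotic statement treats
  both.\<close>

lemma integral_mirror_process: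
  fixes F :: "(nat \<Rightarrow> real) \<Rightarrow> complex"
  assumes [measurable]: "F \<in> borel_measurable (lborel_pow n)"
  shows "(CLINT \<theta>|mirror_process n \<beta>. F \<theta>) =
      (CLINT \<theta>|lborel_pow n. ((\<Prod>i\<in>{1..n}. indicator {-pi<..pi} (\<theta> i)) * sin_weight \<beta> n \<theta>) *\<^sub>R F \<theta>)
    / (CLINT \<theta>|lborel_pow n. ((\<Prod>i\<in>{1..n}. indicator {-pi<..pi} (\<theta> i)) * sin_weight \<beta> n \<theta>) *\<^sub>R 1)"
proof -
  define c where "c = (\<Prod>k\<in>{1..n}. \<Prod>j\<in>{1..<k}. 2 powr \<beta>)"
  have c: "c > 0" unfolding c_def by (intro prod_pos) auto
  have W: "mirror_weight n \<beta> \<theta> = c * sin_weight \<beta> n \<theta>" for \<theta>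
    by (simp add: mirror_weight_eq_sin_weight c_def)
  have Z0: "mirror_Z n \<beta> \<ge> 0"
    unfolding mirror_Z_def W using c by (intro Bochner_Integration.integral_nonneg) (simp add: sin_weight_nonneg)
  have Fm: "F \<in> borel_measurable (mirror_base n)" and sm: "sin_weight \<beta> n \<in> borel_measurable (mirror_base n)"
    using measurable_compose[OF measurable_id_mirror_base assms] measurable_compose[OF measurable_id_mirror_base sin_weight_measurable] by auto
  have "mirror_Z n \<beta> = (LINT \<theta>|lborel_pow n. (\<Prod>i\<in>{1..n}. indicator {-pi<..pi} (\<theta> i)) *\<^sub>R (c * sin_weight \<beta> n \<theta>))"
    unfolding mirror_Z_def W by (rule integral_mirror_base) measurable
  also have "\<dots> = c * (LINT \<theta>|lborel_pow n. (\<Prod>i\<in>{1..n}. indicator {-pi<..pi} (\<theta> i)) * sin_weight \<beta> n \<theta>)"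
    by (subst integral_mult_right_zero[symmetric]) (simp add: mult_ac)
  finally have Z: "complex_of_real (mirror_Z n \<beta>)
      = c * (CLINT \<theta>|lborel_pow n. ((\<Prod>i\<in>{1..n}. indicator {-pi<..pi} (\<theta> i)) * sin_weight \<beta> n \<theta>) *\<^sub>R 1)"
    by (simp only: of_real_mult integral_complex_of_real[symmetric] scaleR_conv_of_real mult_1_right)
  have "(CLINT \<theta>|mirror_process n \<beta>. F \<theta>) = (CLINT \<theta>|mirror_base n. (mirror_weight n \<beta> \<theta> / mirror_Z n \<beta>) *\<^sub>R F \<theta>)"
    unfolding mirror_process_def W using Fm sm Z0 c
    by (intro integral_density) (auto intro!: AE_I2 divide_nonneg_nonneg mult_nonneg_nonneg sin_weight_nonneg)
  also have "\<dots> = (CLINT \<theta>|lborel_pow n. (\<Prod>i\<in>{1..n}. indicator {-pi<..pi} (\<theta> i)) *\<^sub>R ((c * sin_weight \<beta> n \<theta> / mirror_Z n \<beta>) *\<^sub>R F \<theta>))"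
    unfolding W by (rule integral_mirror_base) measurable
  also have "\<dots> = (CLINT \<theta>|lborel_pow n. (c / mirror_Z n \<beta>) *\<^sub>R (((\<Prod>i\<in>{1..n}. indicator {-pi<..pi} (\<theta> i)) * sin_weight \<beta> n \<theta>) *\<^sub>R F \<theta>))"
    by (intro Bochner_Integration.integral_cong) (simp_all add: mult_ac)
  also have "\<dots> = (c / mirror_Z n \<beta>) *\<^sub>R (CLINT \<theta>|lborel_pow n. ((\<Prod>i\<in>{1..n}. indicator {-pi<..pi} (\<theta> i)) * sin_weight \<beta> n \<theta>) *\<^sub>R F \<theta>)"
    by (rule integral_scaleR_right)
  finally show ?thesis
    using c by (simp add: scaleR_conv_of_real Z)
qed

section \<open>Mixed configurations\<close>

lemma sum_pow_card_subsets:
  fixes \<rho> :: real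
  assumes "finite I"
  shows "(\<Sum>J\<in>Pow I. \<rho> ^ card J) = (1 + \<rho>) ^ card I"
  using assms
proof (induction I rule: finite_induct)
  case (insert i I)
  have inj: "inj_on (insert i) (Pow I)" using insert by (auto simp: inj_on_def)
  have "(\<Sum>J\<in>Pow (insert i I). \<rho> ^ card J) = (\<Sum>J\<in>Pow I. \<rho> ^ card J) + (\<Sum>J\<in>insert i ` Pow I. \<rho> ^ card J)"
    unfolding Pow_insert using insert by (intro sum.union_disjoint) auto
  also have "(\<Sum>J\<in>insert i ` Pow I. \<rho> ^ card J) = (\<Sum>J\<in>Pow I. \<rho> * \<rho> ^ card J)"
    unfolding sum.reindex[OF inj] o_def
  proof (intro sum.cong refl)
    fix J assume "J \<in> Pow I"
    then have "i \<notin> J" "finite J" using insert by (auto dest: finite_subset)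
    then show "\<rho> ^ card (insert i J) = \<rho> * \<rho> ^ card J" by simp
  qed
  finally show ?case using insert by (simp add: sum_distrib_left[symmetric] algebra_simps)
qed simp

text \<open>Pairs inside the minority set \<open>J\<close> are bounded by 1, cross pairs through
  \<kappa>, pairs inside the majority by the Gaussian. With m = card J, the square of a majority
  coordinate gets the coefficient -(n - m - 2)/8 from majority pairs and m/16 from cross pairs,
  together -(2n - 3m - 4)/16. The bound is arranged as a product over points so that its integral
  factors.\<close>

lemma sin_weight_mixed_le:
  fixes a :: real
  assumes "\<beta> > 0" and \<kappa>: "\<kappa> > 0"
      "\<And>x y::real. \<bar>x\<bar> \<le> pi/2 \<Longrightarrow> \<bar>y\<bar> \<le> pi/2 \<Longrightarrow> \<bar>sin ((x + y) / 2)\<bar> \<le> \<kappa> * exp (x\<^sup>2 / 16)"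
    and a: "a = pi/2 \<or> a = -pi/2" and J: "J \<subseteq> {1..n}"
    and N: "\<And>j. j \<in> {1..n} - J \<Longrightarrow> \<bar>\<theta> j - a\<bar> \<le> pi/2" and JJ: "\<And>j. j \<in> J \<Longrightarrow> \<bar>\<theta> j + a\<bar> \<le> pi/2"
  shows "sin_weight \<beta> n \<theta> \<le> (\<Prod>i\<in>{1..n}. if i \<in> J then \<kappa> powr (\<beta> * (real n - card J))
      else exp (- (\<beta> / 16 * (2 * real n - 3 * card J - 4) * (\<theta> i - a)\<^sup>2)))"
proof -
  define x where "x j = \<theta> j - a" for j
  define m where "m = card J"
  define N' where "N' = {1..n} - J"
  define e where "e j k = (if j \<in> J then (if k \<in> J then 0 else ln \<kappa> + (x k)\<^sup>2 / 16)
      else if k \<in> J then ln \<kappa> + (x j)\<^sup>2 / 16 else - ((x j + x k)\<^sup>2 / 8))" for j k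
  have finJ: "finite J" using J finite_subset by blast
  have cardN: "real (card N') = real n - m"
    unfolding N'_def m_def using J finJ by (simp add: card_Diff_subset of_nat_diff card_mono[of "{1..n}" J, simplified])
  have factor: "\<bar>sin ((\<theta> j + \<theta> k) / 2)\<bar> \<le> exp (e j k)" if jk: "j \<in> {1..n}" "k \<in> {1..n}" for j k
  proof -
    consider "j \<in> J" "k \<in> J" | "j \<in> J" "k \<notin> J" | "j \<notin> J" "k \<in> J" | "j \<notin> J" "k \<notin> J" by blast
    then show ?thesis
    proof cases
      case 1
      then show ?thesis by (simp add: e_def)
    next
      case 2
      \<comment> \<open>Around the opposite centre \<open>- a\<close> the coordinate of
        \<open>\<theta> j\<close> is \<open>\<theta> j + a\<close>, and the two shifts cancel in the
        sum.\<close>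
      have "\<bar>sin ((x k + (\<theta> j + a)) / 2)\<bar> \<le> \<kappa> * exp ((x k)\<^sup>2 / 16)"
        unfolding x_def using 2 jk by (intro \<kappa>(2) N JJ) auto
      then show ?thesis using 2 \<kappa>(1) by (simp add: e_def exp_add x_def algebra_simps)
    next
      case 3
      have "\<bar>sin ((x j + (\<theta> k + a)) / 2)\<bar> \<le> \<kappa> * exp ((x j)\<^sup>2 / 16)"
        unfolding x_def using 3 jk by (intro \<kappa>(2) N JJ) auto
      then show ?thesis using 3 \<kappa>(1) by (simp add: e_def exp_add x_def algebra_simps)
    next
      case 4
      define u where "u = (x j + x k) / 2"
      have "\<bar>x j\<bar> \<le> pi/2" "\<bar>x k\<bar> \<le> pi/2" unfolding x_def using 4 jk N[of j] N[of k] by auto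
      then have u: "\<bar>u\<bar> \<le> pi/2" unfolding u_def using abs_triangle_ineq[of "x j" "x k"] by simp
      have "(\<theta> j + \<theta> k) / 2 = u + a" by (simp add: u_def x_def field_simps)
      then have "\<bar>sin ((\<theta> j + \<theta> k) / 2)\<bar> = \<bar>cos u\<bar>"
        using a
      proof (elim disjE)
        assume "a = pi/2"
        then show "(\<theta> j + \<theta> k) / 2 = u + a \<Longrightarrow> ?thesis" 
          by (simp only: sin_add cos_pi_half sin_pi_half)
      next
        assume "a = - pi/2"
        then show "(\<theta> j + \<theta> k) / 2 = u + a \<Longrightarrow> ?thesis"
          by (simp only: minus_divide_left[symmetric] sin_add cos_minus sin_minus cos_pi_half sin_pi_half)
      qed
      also have "\<dots> = cos u" using u by (intro abs_of_nonneg cos_ge_zero) auto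
      also have "\<dots> \<le> exp (- u\<^sup>2 / 2)" by (rule cos_le_exp_quadratic[OF u])
      finally show ?thesis using 4 by (simp add: e_def u_def power_divide)
    qed
  qed
  have sym: "e j k = e k j" for j k by (simp add: e_def add.commute)
  have "sin_weight \<beta> n \<theta> \<le> (\<Prod>k\<in>{1..n}. \<Prod>j\<in>{1..<k}. exp (\<beta> * e j k))"
    unfolding sin_weight_def
  proof (intro prod_mono conjI prod_nonneg ballI)
    fix k j assume kj: "k \<in> {1..n}" "j \<in> {1..<k}"
    have "\<bar>sin ((\<theta> j + \<theta> k) / 2)\<bar> powr \<beta> \<le> exp (e j k) powr \<beta>"
      using factor[of j k] kj assms(1) by (intro powr_mono2) auto
    then show "\<bar>sin ((\<theta> j + \<theta> k) / 2)\<bar> powr \<beta> \<le> exp (\<beta> * e j k)" by (simp add: powr_def)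
  qed auto
  also have "\<dots> = exp (\<beta> * (\<Sum>k\<in>{1..n}. \<Sum>j\<in>{1..<k}. e j k))"
    by (simp add: exp_sum[symmetric] sum_distrib_left)
  finally have 1: "sin_weight \<beta> n \<theta> \<le> exp (\<beta> * (\<Sum>k\<in>{1..n}. \<Sum>j\<in>{1..<k}. e j k))" .
  define X where "X = (\<Sum>j\<in>N'. (x j)\<^sup>2)"
  define S where "S = (\<Sum>j\<in>N'. x j)"
  have split: "(\<Sum>j\<in>{1..n}. f j) = (\<Sum>j\<in>J. f j) + (\<Sum>j\<in>N'. f j)" for f :: "nat \<Rightarrow> real"
    unfolding N'_def using J by (intro sum.subset_diff[THEN trans] add.commute) auto
  have "(\<Sum>j\<in>{1..n}. \<Sum>k\<in>{1..n}. e j k)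
      = (\<Sum>j\<in>J. \<Sum>k\<in>N'. ln \<kappa> + (x k)\<^sup>2 / 16) + (\<Sum>j\<in>N'. (\<Sum>k\<in>J. ln \<kappa> + (x j)\<^sup>2 / 16) - (\<Sum>k\<in>N'. (x j + x k)\<^sup>2 / 8))"
    unfolding split by (intro arg_cong2[where f="(+)"] sum.cong refl) (auto simp: e_def N'_def sum_negf)
  also have "(\<Sum>j\<in>J. \<Sum>k\<in>N'. ln \<kappa> + (x k)\<^sup>2 / 16) = m * ((real n - m) * ln \<kappa> + X / 16)"
    by (simp add: sum.distrib cardN X_def sum_divide_distrib m_def)
  also have "(\<Sum>j\<in>N'. (\<Sum>k\<in>J. ln \<kappa> + (x j)\<^sup>2 / 16) - (\<Sum>k\<in>N'. (x j + x k)\<^sup>2 / 8))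
      = m * ((real n - m) * ln \<kappa> + X / 16) - (\<Sum>j\<in>N'. \<Sum>k\<in>N'. (x j + x k)\<^sup>2 / 8)"
    by (simp add: sum_subtractf sum.distrib cardN X_def sum_divide_distrib m_def sum_distrib_left algebra_simps)
  also have "(\<Sum>j\<in>N'. \<Sum>k\<in>N'. (x j + x k)\<^sup>2 / 8) = (\<Sum>j\<in>N'. \<Sum>k\<in>N'. (x j)\<^sup>2 / 8 + (x k)\<^sup>2 / 8 + x j * x k / 4)"
    by (intro sum.cong refl) (simp add: power2_eq_square algebra_simps add_divide_distrib)
  also have "\<dots> = (real n - m) * X / 4 + S\<^sup>2 / 4"
    by (simp add: sum.distrib cardN X_def S_def sum_divide_distrib[symmetric] sum_distrib_left[symmetric] sum_distrib_right[symmetric]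
      power2_eq_square)
  finally have 2: "(\<Sum>j\<in>{1..n}. \<Sum>k\<in>{1..n}. e j k) = 2 * (m * ((real n - m) * ln \<kappa> + X / 16)) - ((real n - m) * X / 4 + S\<^sup>2 / 4)"
    by simp
  have 3: "(\<Sum>j\<in>{1..n}. e j j) = - (X / 2)"
  proof -
    have "(\<Sum>j\<in>N'. e j j) = (\<Sum>j\<in>N'. - ((x j)\<^sup>2 / 2))"
      by (intro sum.cong refl) (auto simp: e_def N'_def power2_eq_square algebra_simps)
    moreover have "(\<Sum>j\<in>J. e j j) = 0" by (simp add: e_def)
    ultimately show ?thesis unfolding split by (simp add: X_def sum_negf sum_divide_distrib)
  qed
  have "2 * (\<Sum>k\<in>{1..n}. \<Sum>j\<in>{1..<k}. e j k)
      = 2 * (m * ((real n - m) * ln \<kappa> + X / 16)) - ((real n - m) * X / 4 + S\<^sup>2 / 4) + X / 2"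
    unfolding sum_pairs_symmetric[of e n, OF sym] 2 3 by simp
  then have "(\<Sum>k\<in>{1..n}. \<Sum>j\<in>{1..<k}. e j k) = m * ((real n - m) * ln \<kappa>) - (2 * real n - 3 * m - 4) / 16 * X - S\<^sup>2 / 8"
    by (simp add: field_simps)
  \<comment> \<open>The square of the majority sum has a favourable sign and is dropped.\<close>
  also have "\<dots> \<le> m * ((real n - m) * ln \<kappa>) - (2 * real n - 3 * m - 4) / 16 * X" by simp
  finally have "\<beta> * (\<Sum>k\<in>{1..n}. \<Sum>j\<in>{1..<k}. e j k) \<le> \<beta> * (m * ((real n - m) * ln \<kappa>) - (2 * real n - 3 * m - 4) / 16 * X)"
    using assms(1) by (intro mult_left_mono) auto
  with 1 have "sin_weight \<beta> n \<theta> \<le> exp (\<beta> * (m * ((real n - m) * ln \<kappa>) - (2 * real n - 3 * m - 4) / 16 * X))"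
    by (meson exp_le_cancel_iff order.trans)
  \<comment> \<open>The m(n - m) factors \<kappa> of the cross pairs are shared out evenly among the
    points of \<open>J\<close>.\<close>
  also have "\<beta> * (m * ((real n - m) * ln \<kappa>) - (2 * real n - 3 * m - 4) / 16 * X)
      = (\<Sum>i\<in>{1..n}. if i \<in> J then \<beta> * (real n - m) * ln \<kappa> else - (\<beta> / 16 * (2 * real n - 3 * m - 4) * (x i)\<^sup>2))"
  proof -
    have f1: "(\<Sum>i\<in>J. if i \<in> J then \<beta> * (real n - m) * ln \<kappa> else - (\<beta> / 16 * (2 * real n - 3 * m - 4) * (x i)\<^sup>2))
        = m * (\<beta> * (real n - m) * ln \<kappa>)"
      by (simp add: m_def)
    have f2: "(\<Sum>i\<in>N'. if i \<in> J then \<beta> * (real n - m) * ln \<kappa> else - (\<beta> / 16 * (2 * real n - 3 * m - 4) * (x i)\<^sup>2))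
        = (\<Sum>i\<in>N'. - (\<beta> / 16 * (2 * real n - 3 * m - 4)) * (x i)\<^sup>2)"
      by (intro sum.cong refl) (auto simp: N'_def)
    show ?thesis
      unfolding split f1 f2 sum_distrib_left[symmetric] X_def[symmetric] by (simp add: field_simps)
  qed
  also have "exp \<dots> = (\<Prod>i\<in>{1..n}. exp (if i \<in> J then \<beta> * (real n - m) * ln \<kappa> else - (\<beta> / 16 * (2 * real n - 3 * m - 4) * (x i)\<^sup>2)))"
    by (simp add: exp_sum)
  also have "\<dots> = (\<Prod>i\<in>{1..n}. if i \<in> J then \<kappa> powr (\<beta> * (real n - card J))
      else exp (- (\<beta> / 16 * (2 * real n - 3 * card J - 4) * (\<theta> i - a)\<^sup>2)))"
    using \<kappa>(1) by (intro prod.cong refl) (auto simp: powr_def m_def x_def)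
  finally show ?thesis .
qed

section \<open>Integrating the bound for mixed configurations\<close>

lemma nn_integral_gaussian_kernel:
  assumes "\<alpha> > 0"
  shows "(\<integral>\<^sup>+ y. ennreal (exp (- (\<alpha> * (y - a)\<^sup>2))) \<partial>lborel) = ennreal (sqrt (pi / \<alpha>))"
proof -
  define \<tau> where "\<tau> = sqrt (1 / (2 * \<alpha>))"
  have \<tau>: "\<tau> > 0" "\<tau>\<^sup>2 = 1 / (2 * \<alpha>)" using assms by (auto simp: \<tau>_def)
  have *: "exp (- (\<alpha> * (y - a)\<^sup>2)) = sqrt (pi / \<alpha>) * normal_density a \<tau> y" for y
    using assms by (simp add: normal_density_def \<tau>(2) mult.commute)
  have "(\<integral>\<^sup>+ y. ennreal (exp (- (\<alpha> * (y - a)\<^sup>2))) \<partial>lborel) = ennreal (\<integral> y. sqrt (pi / \<alpha>) * normal_density a \<tau> y \<partial>lborel)"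
    unfolding * using \<tau>(1) assms by (intro nn_integral_eq_integral integrable_mult_right integrable_normal_density) (auto intro!: AE_I2 mult_nonneg_nonneg)
  then show ?thesis using \<tau>(1) by simp
qed

text \<open>Normalising constant of the Gaussian density with standard deviation
  \<open>mirror_sd\<close>; its n-th power is, up to a constant factor, the size of the integral
  over either half circle.\<close>

definition mirror_scale :: "real \<Rightarrow> nat \<Rightarrow> real" where
  "mirror_scale \<beta> n = sqrt (2 * pi * (mirror_sd \<beta> n)\<^sup>2)"

text \<open>Cost of moving one point to the opposite cluster: each of the at least \<open>n / 2\<close> pairs it forms with the
  majority contributes a factor \<open>\<kappa> powr \<beta>\<close>, which beats the gain \<open>1 / mirror_scale \<beta> n\<close> of order \<open>sqrt n\<close>.\<close>

definition mixing_ratio :: "real \<Rightarrow> real \<Rightarrow> nat \<Rightarrow> real" where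
  "mixing_ratio \<beta> \<kappa> n = pi * \<kappa> powr (\<beta> * n / 2) * exp 6 / mirror_scale \<beta> n"

lemma mirror_scale_pos: "\<beta> > 0 \<Longrightarrow> n \<ge> 3 \<Longrightarrow> mirror_scale \<beta> n > 0"
  by (simp add: mirror_scale_def mirror_sd_def)

text \<open>The integral factors over the points. A point of \<open>J\<close> contributes at most
  \<open>pi * \<kappa> powr (\<beta> * n / 2)\<close>. For each other point the weakened Gaussian
  exponent enlarges the constant by at most e^{6m/n}, where m = card J, and at most n such factors
  give e^{6m}; this is the origin of \<open>exp 6\<close> in \<open>mixing_ratio\<close>.\<close>

lemma mixed_piece_integral_le:
  fixes a b :: real
  assumes "\<beta> > 0" "0 < \<kappa>" "\<kappa> < 1" "n \<ge> 16" "J \<subseteq> {1..n}" "2 * card J \<le> n"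
  shows "(\<integral>\<^sup>+ \<theta>. (\<Prod>i\<in>{1..n}. ennreal (if i \<in> J then \<kappa> powr (\<beta> * (real n - card J)) * indicator {b<..b + pi} (\<theta> i)
      else exp (- (\<beta> / 16 * (2 * real n - 3 * card J - 4) * (\<theta> i - a)\<^sup>2)))) \<partial>lborel_pow n)
     \<le> ennreal (mirror_scale \<beta> n ^ n * mixing_ratio \<beta> \<kappa> n ^ card J)"
proof -
  interpret L: product_sigma_finite "\<lambda>_. lborel :: real measure"
    by (simp add: product_sigma_finite_def sigma_finite_lborel)
  define m where "m = card J"
  define k where "k = mirror_scale \<beta> n"
  define \<alpha> where "\<alpha> = \<beta> / 16 * (2 * real n - 3 * m - 4)"
  have m: "2 * real m \<le> n" "m \<le> n" using assms(6) by (auto simp: m_def)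
  have n: "real n \<ge> 16" using assms(4) by simp
  \<comment> \<open>By m <= n/2 the left side is at least n/2 - 4, and \<open>n \<ge> 16\<close>
    makes this at least n/4.\<close>
  have d: "2 * real n - 3 * m - 4 \<ge> n / 4" using m n by linarith
  have \<alpha>: "\<alpha> > 0" unfolding \<alpha>_def using d n assms(1) by (intro mult_pos_pos) auto
  have k: "k > 0" "k\<^sup>2 = 8 * pi / (\<beta> * (real n - 2))"
    using mirror_scale_pos[of \<beta> n] assms mirror_sd_square[of \<beta> n] by (auto simp: k_def mirror_scale_def)
  define g where "g i y = (if i \<in> J then \<kappa> powr (\<beta> * (real n - m)) * indicator {b<..b + pi} y else exp (- (\<alpha> * (y - a)\<^sup>2)))" for i y
  have "(\<integral>\<^sup>+ \<theta>. (\<Prod>i\<in>{1..n}. ennreal (g i (\<theta> i))) \<partial>lborel_pow n) = (\<Prod>i\<in>{1..n}. \<integral>\<^sup>+ y. ennreal (g i y) \<partial>lborel)"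
    unfolding g_def by (intro L.product_nn_integral_prod) auto
  also have "\<dots> = (\<Prod>i\<in>{1..n}. ennreal (if i \<in> J then \<kappa> powr (\<beta> * (real n - m)) * pi else sqrt (pi / \<alpha>)))"
  proof (intro prod.cong refl)
    fix i
    show "(\<integral>\<^sup>+ y. ennreal (g i y) \<partial>lborel) = ennreal (if i \<in> J then \<kappa> powr (\<beta> * (real n - m)) * pi else sqrt (pi / \<alpha>))"
    proof (cases "i \<in> J")
      case True
      have "(\<integral>\<^sup>+ y. ennreal (g i y) \<partial>lborel) = (\<integral>\<^sup>+ y. ennreal (\<kappa> powr (\<beta> * (real n - m))) * indicator {b<..b + pi} y \<partial>lborel)"
        using True by (intro nn_integral_cong) (auto simp: g_def indicator_def)
      also have "\<dots> = ennreal (\<kappa> powr (\<beta> * (real n - m))) * ennreal pi"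
        by (subst nn_integral_cmult_indicator) auto
      finally show ?thesis using True by (simp add: ennreal_mult)
    next
      case False
      then show ?thesis using nn_integral_gaussian_kernel[OF \<alpha>, of a] by (simp add: g_def)
    qed
  qed
  also have "\<dots> = ennreal (\<Prod>i\<in>{1..n}. if i \<in> J then \<kappa> powr (\<beta> * (real n - m)) * pi else sqrt (pi / \<alpha>))"
    using \<alpha> by (intro prod_ennreal) auto
  also have "(\<Prod>i\<in>{1..n}. if i \<in> J then \<kappa> powr (\<beta> * (real n - m)) * pi else sqrt (pi / \<alpha>))
      = (\<kappa> powr (\<beta> * (real n - m)) * pi) ^ m * sqrt (pi / \<alpha>) ^ (n - m)"
  proof -
    have "{1..n} \<inter> {i. i \<in> J} = J" "card ({1..n} \<inter> - {i. i \<in> J}) = n - m"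
      using assms(5) finite_subset[OF assms(5)] card_Diff_subset[of J "{1..n}"] by (auto simp: m_def Diff_eq)
    then show ?thesis by (subst prod.If_cases) (auto simp: m_def)
  qed
  also have "\<dots> \<le> (\<kappa> powr (\<beta> * n / 2) * pi) ^ m * (k ^ (n - m) * exp (6 * m))"
  proof (intro mult_mono power_mono)
    show "\<kappa> powr (\<beta> * (real n - m)) \<le> \<kappa> powr (\<beta> * n / 2)"
      using assms m by (intro powr_mono') (auto simp: field_simps)
    have t: "2 * real n - 4 - 3 * m > 0" using d n by linarith
    have r: "pi / \<alpha> = k\<^sup>2 * ((2 * real n - 4) / (2 * real n - 4 - 3 * m))"
    proof -
      have "pi / (\<beta> / 16 * D) = 8 * pi / (\<beta> * E) * (2 * E / D)" if "D > 0" "E > 0" for D E :: real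
        using that assms(1) by (simp add: field_simps)
      from this[of "2 * real n - 4 - 3 * m" "real n - 2"] show ?thesis
        unfolding \<alpha>_def k(2) using t n by (simp add: algebra_simps)
    qed
    have "(2 * real n - 4) / (2 * real n - 4 - 3 * m) = 1 + 3 * m / (2 * real n - 4 - 3 * m)"
      using t by (simp add: field_simps)
    also have "\<dots> \<le> 1 + 3 * m / (n / 4)"
      using t n d by (intro add_left_mono divide_left_mono) auto
    also have "\<dots> \<le> exp (12 * m / n)" using exp_ge_add_one_self[of "12 * m / n"] by simp
    finally have "pi / \<alpha> \<le> k\<^sup>2 * exp (12 * m / n)" unfolding r by (intro mult_left_mono) auto
    then have "sqrt (pi / \<alpha>) \<le> sqrt (k\<^sup>2 * exp (12 * m / n))" by (rule real_sqrt_le_mono)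
    also have "\<dots> = k * exp (6 * m / n)"
    proof -
      have "k\<^sup>2 * exp (12 * m / n) = (k * exp (6 * m / n))\<^sup>2" by (simp add: power_mult_distrib flip: exp_double)
      then show ?thesis using k by (simp add: real_sqrt_unique)
    qed
    finally have "sqrt (pi / \<alpha>) ^ (n - m) \<le> (k * exp (6 * m / n)) ^ (n - m)"
      using \<alpha> by (intro power_mono) auto
    also have "\<dots> = k ^ (n - m) * exp ((n - m) * (6 * m / n))"
      by (simp only: power_mult_distrib exp_of_nat_mult)
    also have "\<dots> \<le> k ^ (n - m) * exp (6 * m)"
    proof -
      have "(n - m) * (6 * m / n) \<le> n * (6 * m / n)" using m by (intro mult_right_mono) auto
      then show ?thesis using k n by (intro mult_left_mono) auto
    qed
    finally show "sqrt (pi / \<alpha>) ^ (n - m) \<le> k ^ (n - m) * exp (6 * m)" .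
  qed (use \<alpha> in auto)
  also have "\<dots> = k ^ n * mixing_ratio \<beta> \<kappa> n ^ m"
  proof -
    have "k ^ n = k ^ (n - m) * k ^ m" using m by (simp flip: power_add)
    moreover have "exp (6 * real m) = exp 6 ^ m" by (simp add: exp_of_nat_mult[symmetric] mult.commute)
    ultimately show ?thesis using k by (simp add: mixing_ratio_def k_def[symmetric] power_mult_distrib power_divide field_simps)
  qed
  finally show ?thesis unfolding g_def m_def \<alpha>_def k_def by (simp add: ennreal_leI)
qed

text \<open>A difference of products, rather than a set, so that integrals split by linearity. For
  \<open>n = 0\<close> all three products are empty and the value is -1, hence the restriction to
  \<open>n \<ge> 1\<close> in the case distinction.\<close>

definition mixed_indicator :: "nat \<Rightarrow> (nat \<Rightarrow> real) \<Rightarrow> real" where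
  "mixed_indicator n \<theta> = (\<Prod>i\<in>{1..n}. indicator {-pi<..pi} (\<theta> i)) - (\<Prod>i\<in>{1..n}. indicator {0<..pi} (\<theta> i))
     - (\<Prod>i\<in>{1..n}. indicator {-pi<..0} (\<theta> i))"

lemma prod_indicator_eq_if:
  fixes x :: "nat \<Rightarrow> 'a"
  assumes "finite I"
  shows "(\<Prod>i\<in>I. indicator A (x i) :: real) = (if \<forall>i\<in>I. x i \<in> A then 1 else 0)"
  using assms by (auto simp: indicator_def intro!: prod_zero)

lemma mixed_indicator_cases:
  assumes "n \<ge> 1"
  shows "mixed_indicator n \<theta> = (if (\<forall>i\<in>{1..n}. \<theta> i \<in> {-pi<..pi}) \<and> \<not> (\<forall>i\<in>{1..n}. \<theta> i \<in> {0<..pi})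
      \<and> \<not> (\<forall>i\<in>{1..n}. \<theta> i \<in> {-pi<..0}) then 1 else 0)"
proof -
  have 1: "1 \<in> {1..n}" using assms by simp
  have sub: "{0<..pi} \<subseteq> {-pi<..pi}" "{-pi<..0} \<subseteq> {-pi<..pi}" by auto
  have dis: "\<not> ((\<forall>i\<in>{1..n}. \<theta> i \<in> {0<..pi}) \<and> (\<forall>i\<in>{1..n}. \<theta> i \<in> {-pi<..0}))"
  proof
    assume "(\<forall>i\<in>{1..n}. \<theta> i \<in> {0<..pi}) \<and> (\<forall>i\<in>{1..n}. \<theta> i \<in> {-pi<..0})"
    then have "\<theta> 1 \<in> {0<..pi} \<and> \<theta> 1 \<in> {-pi<..0}" using 1 by blast
    then show False by auto
  qed
  show ?thesis
    unfolding mixed_indicator_def prod_indicator_eq_if[OF finite_atLeastAtMost] using sub dis by (smt (verit, best) subsetD)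
qed

text \<open>Each mixed configuration is charged to a centre \<open>a\<close> whose half circle holds
  at least half of the points and to the nonempty set \<open>J\<close> of the remaining ones.
  Summing \<open>mixing_ratio \<beta> \<kappa> n ^ card J\<close> over nonempty subsets gives the
  binomial expression; the factor 2 counts the centres.\<close>

lemma mixed_integral_le:
  assumes "\<beta> > 0" and \<kappa>: "0 < \<kappa>" "\<kappa> < 1"
      "\<And>x y::real. \<bar>x\<bar> \<le> pi/2 \<Longrightarrow> \<bar>y\<bar> \<le> pi/2 \<Longrightarrow> \<bar>sin ((x + y) / 2)\<bar> \<le> \<kappa> * exp (x\<^sup>2 / 16)"
    and n: "n \<ge> 16"
  shows "(\<integral>\<^sup>+ \<theta>. ennreal (mixed_indicator n \<theta> * sin_weight \<beta> n \<theta>) \<partial>lborel_pow n)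
     \<le> ennreal (mirror_scale \<beta> n ^ n * (2 * ((1 + mixing_ratio \<beta> \<kappa> n) ^ n - 1)))"
proof -
  define \<J> where "\<J> = {J. J \<subseteq> {1..n} \<and> J \<noteq> {} \<and> 2 * card J \<le> n}"
  define g where "g a J i y = (if i \<in> J then \<kappa> powr (\<beta> * (real n - card J)) * indicator {- a - pi/2<..- a - pi/2 + pi} y
      else exp (- (\<beta> / 16 * (2 * real n - 3 * card J - 4) * (y - a)\<^sup>2)))" for a :: real and J and i :: nat and y :: real
  define \<rho> where "\<rho> = mixing_ratio \<beta> \<kappa> n"
  define k where "k = mirror_scale \<beta> n"
  have k: "k > 0" using mirror_scale_pos[of \<beta> n] assms by (simp add: k_def)
  have \<rho>: "\<rho> \<ge> 0" using k by (simp add: \<rho>_def mixing_ratio_def k_def)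
  have fin: "finite \<J>" unfolding \<J>_def by (rule finite_subset[of _ "Pow {1..n}"]) auto
  have pointwise: "ennreal (mixed_indicator n \<theta> * sin_weight \<beta> n \<theta>)
      \<le> (\<Sum>a\<in>{pi/2, -pi/2}. \<Sum>J\<in>\<J>. \<Prod>i\<in>{1..n}. ennreal (g a J i (\<theta> i)))" for \<theta>
  proof (cases "mixed_indicator n \<theta> = 0")
    case False
    with n have \<theta>: "\<And>i. i \<in> {1..n} \<Longrightarrow> \<theta> i \<in> {-pi<..pi}" "\<not> (\<forall>i\<in>{1..n}. \<theta> i \<in> {0<..pi})" "\<not> (\<forall>i\<in>{1..n}. \<theta> i \<in> {-pi<..0})"
        and one: "mixed_indicator n \<theta> = 1"
      using mixed_indicator_cases[of n \<theta>] by (auto split: if_splits)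
    define J where "J a = {i\<in>{1..n}. \<theta> i \<notin> {a - pi/2<..a + pi/2}}" for a
    have J1: "J (pi/2) = {i\<in>{1..n}. \<theta> i \<notin> {0<..pi}}" and J2: "J (-pi/2) = {i\<in>{1..n}. \<theta> i \<notin> {-pi<..0}}"
      by (simp_all add: J_def)
    have un: "J (pi/2) \<union> J (-pi/2) = {1..n}" "J (pi/2) \<inter> J (-pi/2) = {}"
      unfolding J1 J2 using \<theta>(1) by fastforce+
    have "card (J (pi/2)) + card (J (-pi/2)) = n"
      using card_Un_disjoint[OF _ _ un(2)] un(1) by (simp add: J_def)
    \<comment> \<open>The two minority candidates are complementary, so one of them has at most n/2
      points.\<close>
    then obtain a where a: "a = pi/2 \<or> a = -pi/2" "2 * card (J a) \<le> n" by (metis add_le_cancel_left le_cases mult_2 add.commute add_le_mono not_le nle_le)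
    have Ja: "J a \<subseteq> {1..n}" "J a \<noteq> {}" using a(1) \<theta>(2,3) J1 J2 by (auto simp: J_def)
    then have JJ: "J a \<in> \<J>" using a(2) by (simp add: \<J>_def)
    have inJ: "\<theta> i \<in> {- a - pi/2<..- a - pi/2 + pi}" if "i \<in> J a" for i
      using that a(1) \<theta>(1)[of i] by (auto simp: J_def)
    have "sin_weight \<beta> n \<theta> \<le> (\<Prod>i\<in>{1..n}. if i \<in> J a then \<kappa> powr (\<beta> * (real n - card (J a)))
      else exp (- (\<beta> / 16 * (2 * real n - 3 * card (J a) - 4) * (\<theta> i - a)\<^sup>2)))"
    proof (rule sin_weight_mixed_le[OF assms(1) \<kappa>(1,3) a(1) Ja(1)])
      show "\<bar>\<theta> j - a\<bar> \<le> pi / 2" if "j \<in> {1..n} - J a" for j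
      proof -
        have "a - pi/2 < \<theta> j \<and> \<theta> j \<le> a + pi/2" using that by (auto simp: J_def)
        then show ?thesis by linarith
      qed
      show "\<bar>\<theta> j + a\<bar> \<le> pi / 2" if "j \<in> J a" for j
      proof -
        have "- a - pi/2 < \<theta> j \<and> \<theta> j \<le> - a - pi/2 + pi" using inJ[OF that] by simp
        then show ?thesis by linarith
      qed
    qed
    also have "\<dots> = (\<Prod>i\<in>{1..n}. g a (J a) i (\<theta> i))"
      using inJ by (intro prod.cong refl) (simp add: g_def)
    finally have "ennreal (mixed_indicator n \<theta> * sin_weight \<beta> n \<theta>) \<le> ennreal (\<Prod>i\<in>{1..n}. g a (J a) i (\<theta> i))"
      unfolding one by (simp add: ennreal_leI)
    also have "\<dots> = (\<Prod>i\<in>{1..n}. ennreal (g a (J a) i (\<theta> i)))"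
      by (rule prod_ennreal[symmetric]) (auto simp: g_def)
    also have "\<dots> \<le> (\<Sum>J\<in>\<J>. \<Prod>i\<in>{1..n}. ennreal (g a J i (\<theta> i)))"
      by (rule member_le_sum[OF JJ _ fin]) auto
    also have "\<dots> \<le> (\<Sum>a\<in>{pi/2, -pi/2}. \<Sum>J\<in>\<J>. \<Prod>i\<in>{1..n}. ennreal (g a J i (\<theta> i)))"
      by (rule member_le_sum) (use a in auto)
    finally show ?thesis .
  qed simp
  have meas: "(\<lambda>\<theta>. \<Prod>i\<in>{1..n}. ennreal (g a J i (\<theta> i))) \<in> borel_measurable (lborel_pow n)" for a J
  proof (rule borel_measurable_prod_ennreal)
    fix i assume "i \<in> {1..n}"
    then have [measurable]: "(\<lambda>\<theta>. \<theta> i) \<in> borel_measurable (lborel_pow n)" by auto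
    have [measurable]: "g a J i \<in> borel_measurable borel" unfolding g_def[abs_def] by measurable
    show "(\<lambda>\<theta>. ennreal (g a J i (\<theta> i))) \<in> borel_measurable (lborel_pow n)" by measurable
  qed
  have "(\<integral>\<^sup>+ \<theta>. ennreal (mixed_indicator n \<theta> * sin_weight \<beta> n \<theta>) \<partial>lborel_pow n)
      \<le> (\<integral>\<^sup>+ \<theta>. (\<Sum>a\<in>{pi/2, -pi/2}. \<Sum>J\<in>\<J>. \<Prod>i\<in>{1..n}. ennreal (g a J i (\<theta> i))) \<partial>lborel_pow n)"
    by (rule nn_integral_mono) (rule pointwise)
  also have "\<dots> = (\<Sum>a\<in>{pi/2, -pi/2}. \<Sum>J\<in>\<J>. \<integral>\<^sup>+ \<theta>. (\<Prod>i\<in>{1..n}. ennreal (g a J i (\<theta> i))) \<partial>lborel_pow n)"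
    using meas by (simp only: nn_integral_sum borel_measurable_sum)
  also have "\<dots> \<le> (\<Sum>a\<in>{pi/2, -pi/2}. \<Sum>J\<in>\<J>. ennreal (k ^ n * \<rho> ^ card J))"
    unfolding g_def k_def \<rho>_def
    by (intro sum_mono mixed_piece_integral_le assms(1) \<kappa>(1,2) n) (auto simp: \<J>_def)
  also have "\<dots> = ennreal (2 * (\<Sum>J\<in>\<J>. k ^ n * \<rho> ^ card J))"
  proof -
    have "(\<Sum>J\<in>\<J>. ennreal (k ^ n * \<rho> ^ card J)) = ennreal (\<Sum>J\<in>\<J>. k ^ n * \<rho> ^ card J)"
      using k \<rho> by (intro sum_ennreal) auto
    moreover have "card {pi/2, -pi/2} = 2" by (auto simp: card_insert_if)
    ultimately show ?thesis using k \<rho> by (simp add: ennreal_mult sum_nonneg)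
  qed
  also have "\<dots> \<le> ennreal (k ^ n * (2 * ((1 + \<rho>) ^ n - 1)))"
  proof (rule ennreal_leI)
    \<comment> \<open>The restriction to small \<open>J\<close> is given up; only the empty set,
      responsible for the \<open>- 1\<close>, stays excluded.\<close>
    have "(\<Sum>J\<in>\<J>. \<rho> ^ card J) \<le> (\<Sum>J\<in>Pow {1..n} - {{}}. \<rho> ^ card J)"
      using \<rho> by (intro sum_mono2) (auto simp: \<J>_def)
    also have "\<dots> = (\<Sum>J\<in>Pow {1..n}. \<rho> ^ card J) - 1"
      by (subst sum_diff1) auto
    also have "\<dots> = (1 + \<rho>) ^ n - 1" by (simp add: sum_pow_card_subsets)
    finally have "k ^ n * (\<Sum>J\<in>\<J>. \<rho> ^ card J) \<le> k ^ n * ((1 + \<rho>) ^ n - 1)"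
      using k by (intro mult_left_mono) auto
    then show "2 * (\<Sum>J\<in>\<J>. k ^ n * \<rho> ^ card J) \<le> k ^ n * (2 * ((1 + \<rho>) ^ n - 1))"
      unfolding sum_distrib_left[symmetric] right_diff_distrib by simp
  qed
  finally show ?thesis unfolding k_def \<rho>_def .
qed

text \<open>The exponential decay of \<open>\<kappa> powr (\<beta> * n / 2)\<close> beats the growth
  of \<open>1 / mirror_scale \<beta> n\<close> even after multiplication by n, and (1 + \<rho>)^n <=
  e^{n\<rho>}.\<close>

lemma mixing_ratio_tendsto:
  assumes "\<beta> > 0" "0 < \<kappa>" "\<kappa> < 1"
  shows "(\<lambda>n. (1 + mixing_ratio \<beta> \<kappa> n) ^ n - 1) \<longlonglongrightarrow> 0"
proof -
  define c where "c = - (\<beta> / 2 * ln \<kappa>)"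
  have c: "c > 0" using assms by (auto simp: c_def intro!: mult_pos_neg)
  define C where "C = pi * exp 6 * sqrt (\<beta> / (8 * pi))"
  have "(\<lambda>n. real n * exp (- (c * real n)) * sqrt (real n - 2)) \<longlonglongrightarrow> 0"
    using c by real_asymp
  then have "(\<lambda>n. C * (real n * exp (- (c * real n)) * sqrt (real n - 2))) \<longlonglongrightarrow> C * 0"
    by (intro tendsto_mult tendsto_const)
  moreover have "\<forall>\<^sub>F n in sequentially. C * (real n * exp (- (c * real n)) * sqrt (real n - 2)) = n * mixing_ratio \<beta> \<kappa> n"
    using eventually_ge_at_top[of 3]
  proof eventually_elim
    case (elim n)
    have "1 / mirror_scale \<beta> n = sqrt (\<beta> / (8 * pi)) * sqrt (real n - 2)"
    proof -
      have "1 / mirror_scale \<beta> n = sqrt (1 / (2 * pi * (4 / (\<beta> * (real n - 2)))))"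
        using elim assms by (simp add: mirror_scale_def mirror_sd_square real_sqrt_divide)
      also have "1 / (2 * pi * (4 / (\<beta> * (real n - 2)))) = \<beta> / (8 * pi) * (real n - 2)"
        using elim assms by (simp add: field_simps)
      finally show ?thesis by (simp only: real_sqrt_mult)
    qed
    moreover have "\<kappa> powr (\<beta> * n / 2) = exp (- (c * real n))"
      using assms by (simp add: powr_def c_def)
    ultimately show ?case
      unfolding mixing_ratio_def C_def divide_inverse[of _ "mirror_scale \<beta> n"] by (simp add: inverse_eq_divide mult_ac)
  qed
  ultimately have n\<rho>: "(\<lambda>n. n * mixing_ratio \<beta> \<kappa> n) \<longlonglongrightarrow> 0"
    by (simp add: Lim_transform_eventually)
  have "(\<lambda>n. exp (n * mixing_ratio \<beta> \<kappa> n) - 1) \<longlonglongrightarrow> exp 0 - 1"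
    by (intro tendsto_intros n\<rho>)
  then have up: "(\<lambda>n. exp (n * mixing_ratio \<beta> \<kappa> n) - 1) \<longlonglongrightarrow> 0" by simp
  have nonneg: "\<forall>\<^sub>F n in sequentially. 0 \<le> mixing_ratio \<beta> \<kappa> n"
    using eventually_ge_at_top[of 3]
    by eventually_elim (use mirror_scale_pos[OF assms(1)] in \<open>simp add: mixing_ratio_def less_imp_le\<close>)
  show ?thesis
  proof (rule tendsto_sandwich[OF _ _ tendsto_const up])
    show "\<forall>\<^sub>F n in sequentially. 0 \<le> (1 + mixing_ratio \<beta> \<kappa> n) ^ n - 1"
      using nonneg by eventually_elim (simp add: one_le_power)
    show "\<forall>\<^sub>F n in sequentially. (1 + mixing_ratio \<beta> \<kappa> n) ^ n - 1 \<le> exp (n * mixing_ratio \<beta> \<kappa> n) - 1"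
      using nonneg
    proof eventually_elim
      case (elim n)
      have "(1 + mixing_ratio \<beta> \<kappa> n) ^ n \<le> exp (mixing_ratio \<beta> \<kappa> n) ^ n"
        using elim by (intro power_mono) auto
      then show ?case by (simp add: exp_of_nat_mult)
    qed
  qed
qed

text \<open>The scaled Gaussian density and the exponential of p_2 in \<open>tilted_weight\<close>
  are inverse to each other, so that only the indicators and \<open>cos_weight\<close> remain; the
  latter is \<open>sin_weight\<close> by \<open>sin_weight_shift\<close>.\<close>

lemma integral_pure_piece:
  fixes F :: "(nat \<Rightarrow> real) \<Rightarrow> complex"
  assumes "\<beta> > 0" "n \<ge> 3" and a: "a = pi/2 \<or> a = -pi/2" and [measurable]: "F \<in> borel_measurable (lborel_pow n)"
  shows "(CLINT \<theta>|lborel_pow n. ((\<Prod>i\<in>{1..n}. indicator {a - pi/2<..a + pi/2} (\<theta> i)) * sin_weight \<beta> n \<theta>) *\<^sub>R F \<theta>)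
    = mirror_scale \<beta> n ^ n * (CLINT \<theta>|gaussian_pow a (mirror_sd \<beta> n) n.
        F \<theta> * iid_normal.tilted_weight (\<lambda>i \<theta>. \<theta> i - a) n \<beta> \<theta>)"
proof -
  define \<sigma> where "\<sigma> = mirror_sd \<beta> n"
  define k where "k = mirror_scale \<beta> n"
  have \<sigma>: "\<sigma> > 0" "\<sigma>\<^sup>2 = 4 / (\<beta> * (real n - 2))"
    using mirror_sd_pos[of \<beta> n] mirror_sd_square[of \<beta> n] assms by (auto simp: \<sigma>_def)
  have k: "k > 0" "k = sqrt (2 * pi * \<sigma>\<^sup>2)" using mirror_scale_pos[of \<beta> n] assms by (auto simp: k_def mirror_scale_def \<sigma>_def)
  interpret I: iid_normal "gaussian_pow a \<sigma> n" "\<lambda>i \<theta>. \<theta> i - a" \<sigma> n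
    using \<sigma> assms by (intro iid_normal_gaussian_pow) auto
  have sets: "sets (gaussian_pow a \<sigma> n) = sets (lborel_pow n)"
    unfolding gaussian_pow_def by (simp cong: sets_PiM_cong)
  have [measurable]: "I.tilted_weight \<beta> \<in> borel_measurable (lborel_pow n)"
    using I.tilted_weight_measurable[of \<beta>] measurable_cong_sets[OF sets refl] by blast
  have ndm: "(\<lambda>\<theta>. \<Prod>i\<in>{1..n}. normal_density a \<sigma> (\<theta> i)) \<in> borel_measurable (lborel_pow n)"
    by measurable
  have eq: "k ^ n * ((\<Prod>i\<in>{1..n}. normal_density a \<sigma> (\<theta> i)) * I.tilted_weight \<beta> \<theta>)
      = (\<Prod>i\<in>{1..n}. indicator {a - pi/2<..a + pi/2} (\<theta> i)) * sin_weight \<beta> n \<theta>" for \<theta>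
  proof -
    have "(\<Prod>i\<in>{1..n}. normal_density a \<sigma> (\<theta> i)) = (\<Prod>i\<in>{1..n}. 1 / k * exp (- (\<beta> * (real n - 2) / 8 * (\<theta> i - a)\<^sup>2)))"
    proof (intro prod.cong refl)
      fix i
      have "(\<theta> i - a)\<^sup>2 / (2 * \<sigma>\<^sup>2) = \<beta> * (real n - 2) / 8 * (\<theta> i - a)\<^sup>2"
        unfolding \<sigma>(2) using assms(1,2) by (simp add: field_simps)
      then show "normal_density a \<sigma> (\<theta> i) = 1 / k * exp (- (\<beta> * (real n - 2) / 8 * (\<theta> i - a)\<^sup>2))"
        by (simp only: normal_density_def k(2)[symmetric] minus_divide_left[symmetric])
    qed
    also have "\<dots> = (1 / k) ^ n * exp (- (\<beta> * (real n - 2) / 8 * I.psum 2 \<theta>))"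
      by (simp only: prod.distrib exp_sum[symmetric] finite_atLeastAtMost prod_constant card_atLeastAtMost)
         (simp add: I.psum_def sum_distrib_left sum_negf)
    finally have nd: "k ^ n * (\<Prod>i\<in>{1..n}. normal_density a \<sigma> (\<theta> i)) = exp (- (\<beta> * (real n - 2) / 8 * I.psum 2 \<theta>))"
      using k(1) by (simp add: power_one_over)
    have ind: "indicator {-pi/2<..pi/2} (y - a) = (indicator {a - pi/2<..a + pi/2} y :: real)" for y :: real
      by (auto simp: indicator_def)
    show ?thesis
      unfolding mult.assoc[symmetric] nd I.tilted_weight_def ind sin_weight_shift[OF a]
      by (simp add: exp_minus field_simps)
  qed
  have "(CLINT \<theta>|gaussian_pow a \<sigma> n. F \<theta> * I.tilted_weight \<beta> \<theta>)
      = (CLINT \<theta>|lborel_pow n. (\<Prod>i\<in>{1..n}. normal_density a \<sigma> (\<theta> i)) *\<^sub>R (F \<theta> * I.tilted_weight \<beta> \<theta>))"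
    unfolding gaussian_pow_eq_density[OF \<sigma>(1)]
    by (rule integral_density[OF _ ndm]) (measurable, auto intro!: prod_nonneg)
  then have "k ^ n * (CLINT \<theta>|gaussian_pow a \<sigma> n. F \<theta> * I.tilted_weight \<beta> \<theta>)
      = (CLINT \<theta>|lborel_pow n. complex_of_real (k ^ n) * ((\<Prod>i\<in>{1..n}. normal_density a \<sigma> (\<theta> i)) *\<^sub>R (F \<theta> * I.tilted_weight \<beta> \<theta>)))"
    by (simp only: integral_mult_right_zero)
  also have "\<dots> = (CLINT \<theta>|lborel_pow n. ((\<Prod>i\<in>{1..n}. indicator {a - pi/2<..a + pi/2} (\<theta> i)) * sin_weight \<beta> n \<theta>) *\<^sub>R F \<theta>)"
    unfolding eq[symmetric] by (intro Bochner_Integration.integral_cong refl) (simp only: scaleR_conv_of_real of_real_mult mult_ac)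
  finally show ?thesis unfolding k_def \<sigma>_def ..
qed

section \<open>Convergence in law\<close>

text \<open>The Lagrange remainder has the second derivative at an intermediate point; moving it to
  \<open>a\<close> costs a Hoelder increment, which supplies the exponent 2 + q. The constant in the
  definition carries no sign condition, hence the absolute value in the proof.\<close>

lemma C2_holder_taylor:
  assumes "C2_holder_near q g a" "q > 0"
  obtains r C where "r > 0" "C \<ge> 0"
    "\<And>y. \<bar>y\<bar> \<le> r \<Longrightarrow> \<bar>g (a + y) - g a - deriv g a * y - deriv (deriv g) a / 2 * y\<^sup>2\<bar> \<le> C * \<bar>y\<bar> powr (2 + q)"
proof -
  obtain U C where U: "open U" "a \<in> U" "\<And>x. x \<in> U \<Longrightarrow> g differentiable (at x)"
      "\<And>x. x \<in> U \<Longrightarrow> deriv g differentiable (at x)"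
      and C: "\<And>x y. x \<in> U \<Longrightarrow> y \<in> U \<Longrightarrow> \<bar>deriv (deriv g) x - deriv (deriv g) y\<bar> \<le> C * \<bar>x - y\<bar> powr q"
    using assms(1) unfolding C2_holder_near_def by blast
  obtain r where r: "r > 0" "cball a r \<subseteq> U" using U(1,2) open_contains_cball by blast
  have U': "x \<in> U" if "\<bar>x - a\<bar> \<le> r" for x
    using r(2) that by (auto simp: subset_iff dist_real_def abs_minus_commute)
  have "\<bar>g (a + y) - g a - deriv g a * y - deriv (deriv g) a / 2 * y\<^sup>2\<bar> \<le> \<bar>C\<bar> * \<bar>y\<bar> powr (2 + q)" if y: "\<bar>y\<bar> \<le> r" for y
  proof (cases "y = 0")
    case False
    define D where "D m = (if m = 0 then g else if m = 1 then deriv g else deriv (deriv g))" for m :: nat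
    have "\<exists>t. (if a + y < a then a + y < t \<and> t < a else a < t \<and> t < a + y) \<and>
        g (a + y) = (\<Sum>m<2. D m a / fact m * (a + y - a) ^ m) + D 2 t / fact 2 * (a + y - a) ^ 2"
    proof (rule Taylor[of 2 D g "a - r" "a + r" a "a + y"])
      show "\<forall>m t. m < 2 \<and> a - r \<le> t \<and> t \<le> a + r \<longrightarrow> (D m has_real_derivative D (Suc m) t) (at t)"
      proof (intro allI impI)
        fix m :: nat and t assume m: "m < 2 \<and> a - r \<le> t \<and> t \<le> a + r"
        then have t: "t \<in> U" by (intro U') auto
        from m consider "m = 0" | "m = 1" by linarith
        then show "(D m has_real_derivative D (Suc m) t) (at t)"
          using U(3)[OF t] U(4)[OF t] by cases (auto simp: D_def DERIV_deriv_iff_real_differentiable)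
      qed
    qed (use False y r in \<open>auto simp: D_def\<close>)
    then obtain t where t': "if a + y < a then a + y < t \<and> t < a else a < t \<and> t < a + y"
        and g: "g (a + y) = (\<Sum>m<2. D m a / fact m * (a + y - a) ^ m) + D 2 t / fact 2 * (a + y - a) ^ 2"
      by blast
    have t: "\<bar>t - a\<bar> \<le> \<bar>y\<bar>" using t' by (auto split: if_splits)
    have "g (a + y) - g a - deriv g a * y - deriv (deriv g) a / 2 * y\<^sup>2 = (deriv (deriv g) t - deriv (deriv g) a) / 2 * y\<^sup>2"
      unfolding g by (simp add: D_def numeral_2_eq_2 field_simps)
    also have "\<bar>\<dots>\<bar> = \<bar>deriv (deriv g) t - deriv (deriv g) a\<bar> / 2 * y\<^sup>2" by (simp add: abs_mult)
    also have "\<dots> \<le> (\<bar>C\<bar> * \<bar>y\<bar> powr q) * y\<^sup>2"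
    proof (rule mult_right_mono)
      have "\<bar>deriv (deriv g) t - deriv (deriv g) a\<bar> \<le> C * \<bar>t - a\<bar> powr q"
        using t y r by (intro C U') auto
      also have "\<dots> \<le> \<bar>C\<bar> * \<bar>y\<bar> powr q"
        using t assms(2) by (intro mult_mono powr_mono2) auto
      finally show "\<bar>deriv (deriv g) t - deriv (deriv g) a\<bar> / 2 \<le> \<bar>C\<bar> * \<bar>y\<bar> powr q"
        by (rule order.trans[rotated]) simp
    qed simp
    also have "\<dots> = \<bar>C\<bar> * \<bar>y\<bar> powr (2 + q)" using False by (simp add: powr_add)
    finally show ?thesis .
  qed simp
  then show ?thesis using that[of r "\<bar>C\<bar>"] r(1) by auto
qed

text \<open>The exact tilt with c = \<beta>/8 has 1 + 2cn\<sigma>^2 -> 2, hence the factor 1/sqrt 2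
  and the effective variance 2/\<beta> of p_1; the quartic exponent gives e^{-1/(2\<beta>)}. This
  prefactor depends neither on \<open>g\<close> nor on \<open>a\<close>.\<close>

lemma pure_piece_tendsto:
  fixes g :: "real \<Rightarrow> real"
  assumes "\<beta> > 0" and [measurable]: "g \<in> borel_measurable borel" and q: "0 < q" "q \<le> 1" and "C2_holder_near q g a"
    and s: "s \<longlonglongrightarrow> s0"
  shows "(\<lambda>n. CLINT \<theta>|gaussian_pow a (mirror_sd \<beta> n) n. iexp (s n * (\<Sum>j\<in>{1..n}. g (\<theta> j) - g a)) *
            iid_normal.tilted_weight (\<lambda>i \<theta>. \<theta> i - a) n \<beta> \<theta>)
     \<longlonglongrightarrow> (exp (- (1 / (2 * \<beta>))) / sqrt 2) * (iexp (s0 * (2 * deriv (deriv g) a / \<beta>)) * exp (- ((s0 * deriv g a)\<^sup>2 / \<beta>)))"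
    (is "?X \<longlonglongrightarrow> ?L")
proof -
  define d1 where "d1 = deriv g a"
  define d2 where "d2 = deriv (deriv g) a"
  obtain r1 C where r1: "r1 > 0" and C: "C \<ge> 0"
    and taylor: "\<And>y. \<bar>y\<bar> \<le> r1 \<Longrightarrow> \<bar>g (a + y) - g a - d1 * y - d2 / 2 * y\<^sup>2\<bar> \<le> C * \<bar>y\<bar> powr (2 + q)"
    using C2_holder_taylor[OF assms(5) q(1)] unfolding d1_def d2_def by blast
  obtain r2 where r2: "0 < r2" "r2 < pi/2" "\<And>u::real. \<bar>u\<bar> \<le> r2 \<Longrightarrow> \<bar>- ln (cos u) - u\<^sup>2 / 2 - u^4 / 12\<bar> \<le> u^6"
    using ln_cos_quartic by blast
  define r where "r = min r1 r2"
  define Y where "Y n = (CLINT \<theta>|gaussian_pow a (mirror_sd \<beta> n) n.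
      iexp (s0 * (d1 * iid_normal.psum (\<lambda>i \<theta>. \<theta> i - a) n 1 \<theta> + 2 * d2 / \<beta>))
      * exp (- (\<beta> / 8 * (iid_normal.psum (\<lambda>i \<theta>. \<theta> i - a) n 1 \<theta>)\<^sup>2 + 1 / (2 * \<beta>))))" for n
  define \<kappa> where "\<kappa> n = real n * (mirror_sd \<beta> n)\<^sup>2" for n
  \<comment> \<open>The exact value of \<open>Y n\<close> for \<open>n \<ge> 3\<close>, from
    \<open>expectation_gaussian_tilt\<close> with frequency \<open>s0 * d1\<close>.\<close>
  define L where "L n = iexp (s0 * (2 * d2 / \<beta>)) * exp (- (1 / (2 * \<beta>)))
      * (exp (- ((s0 * d1)\<^sup>2 * (\<kappa> n / (1 + \<beta> / 4 * \<kappa> n)) / 2)) / sqrt (1 + \<beta> / 4 * \<kappa> n))" for n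
  have XY: "\<forall>\<^sub>F n in sequentially. cmod (?X n - Y n)
      \<le> tilt_error (tilt_coeffs \<beta> C q d1 d2 r (s n) s0 (mirror_sd \<beta> n) n) (mirror_sd \<beta> n) n"
    using eventually_ge_at_top[of 3]
  proof eventually_elim
    case (elim n)
    interpret I: iid_normal "gaussian_pow a (mirror_sd \<beta> n) n" "\<lambda>i \<theta>. \<theta> i - a" "mirror_sd \<beta> n" n
      using mirror_sd_pos[of \<beta> n] assms elim by (intro iid_normal_gaussian_pow) auto
    have "cmod ((CLINT \<theta>|gaussian_pow a (mirror_sd \<beta> n) n. iexp (s n * (\<Sum>j\<in>{1..n}. g (a + (\<theta> j - a)) - g a)) * I.tilted_weight \<beta> \<theta>)
        - (CLINT \<theta>|gaussian_pow a (mirror_sd \<beta> n) n. iexp (s0 * (d1 * I.psum 1 \<theta> + 2 * d2 / \<beta>))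
            * exp (- (\<beta> / 8 * (I.psum 1 \<theta>)\<^sup>2 + 1 / (2 * \<beta>)))))
      \<le> tilt_error (tilt_coeffs \<beta> C q d1 d2 r (s n) s0 (mirror_sd \<beta> n) n) (mirror_sd \<beta> n) n"
      by (rule I.tilted_weight_approx[where h="\<lambda>y. g (a + y) - g a"])
         (use assms(1) elim r1 r2 q C taylor in \<open>auto simp: r_def\<close>)
    then show ?case unfolding Y_def by simp
  qed
  have "(\<lambda>n. tilt_error (tilt_coeffs \<beta> C q d1 d2 r (s n) s0 (mirror_sd \<beta> n) n) (mirror_sd \<beta> n) n) \<longlonglongrightarrow> 0"
    using assms(1) q s r1 r2 by (intro tilt_error_tendsto_0) (auto simp: r_def)
  then have diff: "(\<lambda>n. ?X n - Y n) \<longlonglongrightarrow> 0"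
    by (rule Lim_null_comparison[OF XY])
  have YL: "\<forall>\<^sub>F n in sequentially. L n = Y n"
    using eventually_ge_at_top[of 3]
  proof eventually_elim
    case (elim n)
    interpret I: iid_normal "gaussian_pow a (mirror_sd \<beta> n) n" "\<lambda>i \<theta>. \<theta> i - a" "mirror_sd \<beta> n" n
      using mirror_sd_pos[of \<beta> n] assms elim by (intro iid_normal_gaussian_pow) auto
    have "Y n = (CLINT \<theta>|gaussian_pow a (mirror_sd \<beta> n) n. (iexp (s0 * (2 * d2 / \<beta>)) * exp (- (1 / (2 * \<beta>))))
        * (iexp ((s0 * d1) * I.psum 1 \<theta>) * exp (- (\<beta> / 8 * (I.psum 1 \<theta>)\<^sup>2))))"
      unfolding Y_def by (intro Bochner_Integration.integral_cong refl)
        (simp add: exp_add[symmetric] exp_of_real[symmetric] of_real_exp[symmetric] algebra_simps del: exp_of_real)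
    also have "\<dots> = (iexp (s0 * (2 * d2 / \<beta>)) * exp (- (1 / (2 * \<beta>))))
        * (CLINT \<theta>|gaussian_pow a (mirror_sd \<beta> n) n. iexp ((s0 * d1) * I.psum 1 \<theta>) * exp (- (\<beta> / 8 * (I.psum 1 \<theta>)\<^sup>2)))"
      by (rule integral_mult_right_zero)
    also have "\<dots> = L n"
      using elim assms(1) by (subst I.expectation_gaussian_tilt) (auto simp: L_def \<kappa>_def mult.assoc)
    finally show ?case ..
  qed
  have \<kappa>: "\<kappa> \<longlonglongrightarrow> 4 / \<beta>"
    unfolding \<kappa>_def[abs_def] by (rule n_mirror_sd_square_tendsto[OF assms(1)])
  have "L \<longlonglongrightarrow> iexp (s0 * (2 * d2 / \<beta>)) * exp (- (1 / (2 * \<beta>)))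
      * (exp (- ((s0 * d1)\<^sup>2 * ((4 / \<beta>) / (1 + \<beta> / 4 * (4 / \<beta>))) / 2)) / sqrt (1 + \<beta> / 4 * (4 / \<beta>)))"
    unfolding L_def[abs_def] using assms(1) by (intro tendsto_intros \<kappa>) auto
  also have "iexp (s0 * (2 * d2 / \<beta>)) * exp (- (1 / (2 * \<beta>)))
      * (exp (- ((s0 * d1)\<^sup>2 * ((4 / \<beta>) / (1 + \<beta> / 4 * (4 / \<beta>))) / 2)) / sqrt (1 + \<beta> / 4 * (4 / \<beta>))) = ?L"
  proof -
    have "1 + \<beta> / 4 * (4 / \<beta>) = 2" using assms(1) by simp
    moreover have "(s0 * d1)\<^sup>2 * ((4 / \<beta>) / 2) / 2 = (s0 * d1)\<^sup>2 / \<beta>" by simp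
    ultimately show ?thesis by (simp only: d1_def[symmetric] d2_def[symmetric] of_real_mult of_real_divide) (simp add: mult_ac)
  qed
  finally have "Y \<longlonglongrightarrow> ?L" using YL by (rule Lim_transform_eventually)
  from tendsto_add[OF diff this] show ?thesis by simp
qed

text \<open>After division by \<open>mirror_scale \<beta> n ^ n\<close> each half circle becomes a
  Gaussian expectation, and the error from mixed configurations is uniform over all \<open>F\<close>
  bounded by 1, so it serves numerator and denominator alike.\<close>

lemma mirror_integral_split:
  fixes F :: "(nat \<Rightarrow> real) \<Rightarrow> complex"
  assumes "\<beta> > 0" and \<kappa>: "0 < \<kappa>" "\<kappa> < 1"
      "\<And>x y::real. \<bar>x\<bar> \<le> pi/2 \<Longrightarrow> \<bar>y\<bar> \<le> pi/2 \<Longrightarrow> \<bar>sin ((x + y) / 2)\<bar> \<le> \<kappa> * exp (x\<^sup>2 / 16)"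
    and n: "n \<ge> 16" and F[measurable]: "F \<in> borel_measurable (lborel_pow n)" "\<And>\<theta>. cmod (F \<theta>) \<le> 1"
  shows "cmod ((CLINT \<theta>|lborel_pow n. ((\<Prod>i\<in>{1..n}. indicator {-pi<..pi} (\<theta> i)) * sin_weight \<beta> n \<theta>) *\<^sub>R F \<theta>) / mirror_scale \<beta> n ^ n
      - ((CLINT \<theta>|gaussian_pow (pi/2) (mirror_sd \<beta> n) n. F \<theta> * iid_normal.tilted_weight (\<lambda>i \<theta>. \<theta> i - pi/2) n \<beta> \<theta>)
       + (CLINT \<theta>|gaussian_pow (-pi/2) (mirror_sd \<beta> n) n. F \<theta> * iid_normal.tilted_weight (\<lambda>i \<theta>. \<theta> i - (-pi/2)) n \<beta> \<theta>)))
    \<le> 2 * ((1 + mixing_ratio \<beta> \<kappa> n) ^ n - 1)"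
proof -
  interpret L: product_sigma_finite "\<lambda>_. lborel :: real measure"
    by (simp add: product_sigma_finite_def sigma_finite_lborel)
  define k where "k = mirror_scale \<beta> n"
  have k: "k > 0" using mirror_scale_pos[of \<beta> n] assms(1) n by (simp add: k_def)
  define E where "E = 2 * ((1 + mixing_ratio \<beta> \<kappa> n) ^ n - 1)"
  have E: "E \<ge> 0" using k by (simp add: E_def mixing_ratio_def k_def one_le_power)
  have sw1: "sin_weight \<beta> n \<theta> \<le> 1" for \<theta>
    unfolding sin_weight_def by (intro prod_le_1 conjI prod_nonneg powr_le1) (use assms(1) in auto)
  have int: "integrable (lborel_pow n) (\<lambda>\<theta>. ((\<Prod>i\<in>{1..n}. indicator {c<..d} (\<theta> i)) * sin_weight \<beta> n \<theta>) *\<^sub>R F \<theta>)" for c d :: real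
  proof (rule Bochner_Integration.integrable_bound)
    show "integrable (lborel_pow n) (\<lambda>\<theta>. \<Prod>i\<in>{1..n}. indicator {c<..d} (\<theta> i) :: real)"
      by (rule L.product_integrable_prod, simp, cases "c \<le> d") (auto intro!: integrable_real_indicator)
    show "AE \<theta> in lborel_pow n. norm (((\<Prod>i\<in>{1..n}. indicator {c<..d} (\<theta> i)) * sin_weight \<beta> n \<theta>) *\<^sub>R F \<theta>)
        \<le> norm (\<Prod>i\<in>{1..n}. indicator {c<..d} (\<theta> i) :: real)"
    proof (rule AE_I2)
      fix \<theta>
      have "norm (((\<Prod>i\<in>{1..n}. indicator {c<..d} (\<theta> i)) * sin_weight \<beta> n \<theta>) *\<^sub>R F \<theta>)
        = norm (\<Prod>i\<in>{1..n}. indicator {c<..d} (\<theta> i) :: real) * (sin_weight \<beta> n \<theta> * cmod (F \<theta>))"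
        using sin_weight_nonneg[of \<beta> n \<theta>] by (simp only: norm_scaleR abs_mult real_norm_def abs_of_nonneg mult.assoc)
      also have "\<dots> \<le> norm (\<Prod>i\<in>{1..n}. indicator {c<..d} (\<theta> i) :: real) * 1"
        using sin_weight_nonneg[of \<beta> n \<theta>] sw1[of \<theta>] F(2)[of \<theta>] by (intro mult_left_mono mult_le_one) auto
      finally show "norm (((\<Prod>i\<in>{1..n}. indicator {c<..d} (\<theta> i)) * sin_weight \<beta> n \<theta>) *\<^sub>R F \<theta>)
        \<le> norm (\<Prod>i\<in>{1..n}. indicator {c<..d} (\<theta> i) :: real)" by simp
    qed
  qed measurable
  define I where "I c d = (CLINT \<theta>|lborel_pow n. ((\<Prod>i\<in>{1..n}. indicator {c<..d} (\<theta> i)) * sin_weight \<beta> n \<theta>) *\<^sub>R F \<theta>)" for c d :: real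
  define R where "R = (CLINT \<theta>|lborel_pow n. (mixed_indicator n \<theta> * sin_weight \<beta> n \<theta>) *\<^sub>R F \<theta>)"
  have split: "I (-pi) pi - I 0 pi - I (-pi) 0 = R"
    unfolding I_def R_def
    by (subst Bochner_Integration.integral_diff[symmetric], (intro Bochner_Integration.integrable_diff int)+)+
       (simp only: mixed_indicator_def left_diff_distrib scaleR_left_diff_distrib)
  have mixed: "mixed_indicator n \<theta> \<ge> 0" for \<theta>
    using mixed_indicator_cases[of n \<theta>] n by (auto split: if_splits)
  have "cmod R \<le> k ^ n * E"
  proof -
    have "ennreal (cmod R) \<le> (\<integral>\<^sup>+ \<theta>. norm ((mixed_indicator n \<theta> * sin_weight \<beta> n \<theta>) *\<^sub>R F \<theta>) \<partial>lborel_pow n)"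
      unfolding R_def by (rule integral_norm_bound_ennreal)
        (use Bochner_Integration.integrable_diff[OF Bochner_Integration.integrable_diff[OF int[of "-pi" pi] int[of 0 pi]] int[of "-pi" 0]] in
          \<open>simp only: mixed_indicator_def left_diff_distrib scaleR_left_diff_distrib\<close>)
    also have "\<dots> \<le> (\<integral>\<^sup>+ \<theta>. ennreal (mixed_indicator n \<theta> * sin_weight \<beta> n \<theta>) \<partial>lborel_pow n)"
    proof (intro nn_integral_mono ennreal_leI)
      fix \<theta>
      have nn: "0 \<le> mixed_indicator n \<theta> * sin_weight \<beta> n \<theta>" using mixed sin_weight_nonneg by (intro mult_nonneg_nonneg)
      then have "norm ((mixed_indicator n \<theta> * sin_weight \<beta> n \<theta>) *\<^sub>R F \<theta>) = mixed_indicator n \<theta> * sin_weight \<beta> n \<theta> * cmod (F \<theta>)"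
        by (simp only: norm_scaleR abs_of_nonneg)
      also have "\<dots> \<le> mixed_indicator n \<theta> * sin_weight \<beta> n \<theta> * 1"
        using nn F(2) by (intro mult_left_mono)
      finally show "norm ((mixed_indicator n \<theta> * sin_weight \<beta> n \<theta>) *\<^sub>R F \<theta>) \<le> mixed_indicator n \<theta> * sin_weight \<beta> n \<theta>" by simp
    qed
    also have "\<dots> \<le> ennreal (k ^ n * E)"
      unfolding k_def E_def by (rule mixed_integral_le[OF assms(1) \<kappa> n])
    finally show ?thesis using k E by (subst (asm) ennreal_le_iff) auto
  qed
  then have Rb: "cmod (R / k ^ n) \<le> E"
    using k by (simp add: norm_divide norm_power field_simps)
  have p: "I 0 pi = k ^ n * (CLINT \<theta>|gaussian_pow (pi/2) (mirror_sd \<beta> n) n. F \<theta> * iid_normal.tilted_weight (\<lambda>i \<theta>. \<theta> i - pi/2) n \<beta> \<theta>)"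
    using integral_pure_piece[OF assms(1) _ _ F(1), of "pi/2"] n by (simp add: I_def k_def)
  have m: "I (-pi) 0 = k ^ n * (CLINT \<theta>|gaussian_pow (-pi/2) (mirror_sd \<beta> n) n. F \<theta> * iid_normal.tilted_weight (\<lambda>i \<theta>. \<theta> i - (-pi/2)) n \<beta> \<theta>)"
    using integral_pure_piece[OF assms(1) _ _ F(1), of "-pi/2"] n by (simp add: I_def k_def)
  have "I (-pi) pi / k ^ n - (I 0 pi / k ^ n + I (-pi) 0 / k ^ n) = R / k ^ n"
    unfolding split[symmetric] by (simp add: diff_divide_distrib)
  then show ?thesis
    using Rb k unfolding p m unfolding I_def[of "-pi" pi] k_def E_def by simp
qed

text \<open>Scaling \<open>w\<close> and centring \<open>\<nu>\<close> are general so as to cover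
  both averages (\<open>w n = 1 / n\<close>, \<open>w0 = 0\<close>) and sums
  (\<open>w n = 1\<close>). \<open>d1\<close> and \<open>d2\<close> are the deterministic shifts at
  the two centres; they are prescribed for \<open>n > 0\<close> only, since at \<open>n = 0\<close>
  the left sides vanish.\<close>

lemma mirror_char_tendsto:
  fixes g :: "real \<Rightarrow> real" and w :: "nat \<Rightarrow> real" and \<nu> :: real
  assumes \<beta>: "\<beta> > 0" and g[measurable]: "g \<in> borel_measurable borel" and q: "0 < q" "q \<le> 1"
    and C2: "C2_holder_near q g (pi/2)" "C2_holder_near q g (-pi/2)"
    and w: "w \<longlonglongrightarrow> w0"
    and d: "\<And>n. n > 0 \<Longrightarrow> w n * (n * (g (pi/2) - \<nu>)) = d1" "\<And>n. n > 0 \<Longrightarrow> w n * (n * (g (-pi/2) - \<nu>)) = d2"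
  shows "(\<lambda>n. CLINT \<theta>|mirror_process n \<beta>. iexp (t * (w n * ((\<Sum>j\<in>{1..n}. g (\<theta> j)) - \<nu> * n))))
    \<longlonglongrightarrow> (iexp (t * d1) * (iexp (t * w0 * (2 * deriv (deriv g) (pi/2) / \<beta>)) * exp (- ((t * w0 * deriv g (pi/2))\<^sup>2 / \<beta>)))
       + iexp (t * d2) * (iexp (t * w0 * (2 * deriv (deriv g) (-pi/2) / \<beta>)) * exp (- ((t * w0 * deriv g (-pi/2))\<^sup>2 / \<beta>)))) / 2"
proof -
  obtain \<kappa> where \<kappa>: "0 < \<kappa>" "\<kappa> < 1"
      "\<And>x y::real. \<bar>x\<bar> \<le> pi/2 \<Longrightarrow> \<bar>y\<bar> \<le> pi/2 \<Longrightarrow> \<bar>sin ((x + y) / 2)\<bar> \<le> \<kappa> * exp (x\<^sup>2 / 16)"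
    using sin_shifted_decay by blast
  define K where "K = exp (- (1 / (2 * \<beta>))) / sqrt 2"
  have K: "K \<noteq> 0" by (simp add: K_def)
  define A where "A a s = iexp (s * (2 * deriv (deriv g) a / \<beta>)) * exp (- ((s * deriv g a)\<^sup>2 / \<beta>))" for a s
  define N where "N n F = (CLINT \<theta>|lborel_pow n. ((\<Prod>i\<in>{1..n}. indicator {-pi<..pi} (\<theta> i)) * sin_weight \<beta> n \<theta>) *\<^sub>R F \<theta>)"
    for n and F :: "(nat \<Rightarrow> real) \<Rightarrow> complex"
  define I where "I a n F = (CLINT \<theta>|gaussian_pow a (mirror_sd \<beta> n) n. F \<theta> * iid_normal.tilted_weight (\<lambda>i \<theta>. \<theta> i - a) n \<beta> \<theta>)"
    for a n and F :: "(nat \<Rightarrow> real) \<Rightarrow> complex"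
  define S where "S a n \<theta> = (\<Sum>j\<in>{1..n}. g (\<theta> j) - g a)" for a n and \<theta> :: "nat \<Rightarrow> real"
  define F where "F n \<theta> = iexp (t * (w n * ((\<Sum>j\<in>{1..n}. g (\<theta> j)) - \<nu> * n)))" for n and \<theta> :: "nat \<Rightarrow> real"
  have Fm: "F n \<in> borel_measurable (lborel_pow n)" for n unfolding F_def[abs_def] by measurable
  have I_lim: "(\<lambda>n. I a n (\<lambda>\<theta>. iexp (s n * S a n \<theta>))) \<longlonglongrightarrow> K * A a s0"
    if "a = pi/2 \<or> a = -pi/2" "s \<longlonglongrightarrow> s0" for a s s0
    unfolding I_def S_def K_def A_def
    by (rule pure_piece_tendsto[OF \<beta> g q _ that(2)]) (use that(1) C2 in \<open>elim disjE; simp only:\<close>)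
  have FI: "I a n (F n) = iexp (t * dd) * I a n (\<lambda>\<theta>. iexp ((t * w n) * S a n \<theta>))"
    if "w n * (n * (g a - \<nu>)) = dd" for a n dd
  proof -
    have "F n \<theta> = iexp (t * dd) * iexp ((t * w n) * S a n \<theta>)" for \<theta>
      unfolding F_def S_def exp_add[symmetric] that[symmetric]
      by (rule arg_cong[where f=exp]) (simp add: sum_subtractf algebra_simps)
    then have "I a n (F n) = (CLINT \<theta>|gaussian_pow a (mirror_sd \<beta> n) n. iexp (t * dd)
        * (iexp ((t * w n) * S a n \<theta>) * iid_normal.tilted_weight (\<lambda>i \<theta>. \<theta> i - a) n \<beta> \<theta>))"
      unfolding I_def by (simp only: mult.assoc)
    also have "\<dots> = iexp (t * dd) * I a n (\<lambda>\<theta>. iexp ((t * w n) * S a n \<theta>))"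
      unfolding I_def by (rule integral_mult_right_zero)
    finally show ?thesis .
  qed
  have I_F: "(\<lambda>n. I a n (F n)) \<longlonglongrightarrow> iexp (t * dd) * (K * A a (t * w0))"
    if "a = pi/2 \<or> a = -pi/2" "\<And>n. n > 0 \<Longrightarrow> w n * (n * (g a - \<nu>)) = dd" for a dd
  proof (rule Lim_transform_eventually)
    show "(\<lambda>n. iexp (t * dd) * I a n (\<lambda>\<theta>. iexp ((t * w n) * S a n \<theta>))) \<longlonglongrightarrow> iexp (t * dd) * (K * A a (t * w0))"
      by (intro tendsto_mult tendsto_const I_lim that(1) w)
    show "\<forall>\<^sub>F n in sequentially. iexp (t * dd) * I a n (\<lambda>\<theta>. iexp ((t * w n) * S a n \<theta>)) = I a n (F n)"
      using eventually_gt_at_top[of 0] by eventually_elim (rule FI[OF that(2), symmetric])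
  qed
  \<comment> \<open>Frequency 0 gives the normalisation, with the same \<open>K\<close> at both
    centres.\<close>
  have I_1: "(\<lambda>n. I a n (\<lambda>_. 1)) \<longlonglongrightarrow> K" if "a = pi/2 \<or> a = -pi/2" for a
    using I_lim[OF that tendsto_const[of 0]] by (simp add: A_def)
  have err: "(\<lambda>n. 2 * ((1 + mixing_ratio \<beta> \<kappa> n) ^ n - 1)) \<longlonglongrightarrow> 0"
    using tendsto_mult[OF tendsto_const[of 2] mixing_ratio_tendsto[OF \<beta> \<kappa>(1,2)]] by simp
  have N_lim: "(\<lambda>n. N n (G n) / mirror_scale \<beta> n ^ n) \<longlonglongrightarrow> l1 + l2"
    if G: "\<And>n. G n \<in> borel_measurable (lborel_pow n)" "\<And>n \<theta>. cmod (G n \<theta>) \<le> 1"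
      and l: "(\<lambda>n. I (pi/2) n (G n)) \<longlonglongrightarrow> l1" "(\<lambda>n. I (-pi/2) n (G n)) \<longlonglongrightarrow> l2" for G l1 l2
  proof -
    have "\<forall>\<^sub>F n in sequentially. cmod (N n (G n) / mirror_scale \<beta> n ^ n - (I (pi/2) n (G n) + I (-pi/2) n (G n)))
        \<le> 2 * ((1 + mixing_ratio \<beta> \<kappa> n) ^ n - 1)"
      using eventually_ge_at_top[of 16]
      by eventually_elim (unfold N_def I_def, rule mirror_integral_split[OF \<beta> \<kappa> _ G])
    then have "(\<lambda>n. N n (G n) / mirror_scale \<beta> n ^ n - (I (pi/2) n (G n) + I (-pi/2) n (G n))) \<longlonglongrightarrow> 0"
      by (rule Lim_null_comparison[OF _ err])
    from tendsto_add[OF this tendsto_add[OF l]] show ?thesis by simp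
  qed
  have num: "(\<lambda>n. N n (F n) / mirror_scale \<beta> n ^ n) \<longlonglongrightarrow> iexp (t * d1) * (K * A (pi/2) (t * w0)) + iexp (t * d2) * (K * A (-pi/2) (t * w0))"
    by (rule N_lim[OF Fm _ I_F I_F]) (use d in \<open>auto simp: F_def\<close>)
  have den: "(\<lambda>n. N n (\<lambda>_. 1) / mirror_scale \<beta> n ^ n) \<longlonglongrightarrow> complex_of_real K + complex_of_real K"
    by (rule N_lim[OF _ _ I_1 I_1]) auto
  have "(\<lambda>n. (N n (F n) / mirror_scale \<beta> n ^ n) / (N n (\<lambda>_. 1) / mirror_scale \<beta> n ^ n))
      \<longlonglongrightarrow> (iexp (t * d1) * (K * A (pi/2) (t * w0)) + iexp (t * d2) * (K * A (-pi/2) (t * w0))) / (complex_of_real K + complex_of_real K)"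
    using K by (intro tendsto_divide num den) (simp flip: mult_2 del: of_real_add)
  \<comment> \<open>The equal normalisations cancel and leave the weight 1/2 for each
    centre.\<close>
  also have "(iexp (t * d1) * (K * A (pi/2) (t * w0)) + iexp (t * d2) * (K * A (-pi/2) (t * w0))) / (complex_of_real K + complex_of_real K)
      = (iexp (t * d1) * A (pi/2) (t * w0) + iexp (t * d2) * A (-pi/2) (t * w0)) / 2"
    using K by (simp add: field_simps flip: mult_2)
  finally have lim: "(\<lambda>n. (N n (F n) / mirror_scale \<beta> n ^ n) / (N n (\<lambda>_. 1) / mirror_scale \<beta> n ^ n))
      \<longlonglongrightarrow> (iexp (t * d1) * A (pi/2) (t * w0) + iexp (t * d2) * A (-pi/2) (t * w0)) / 2" .
  have "(\<lambda>n. CLINT \<theta>|mirror_process n \<beta>. F n \<theta>)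
      \<longlonglongrightarrow> (iexp (t * d1) * A (pi/2) (t * w0) + iexp (t * d2) * A (-pi/2) (t * w0)) / 2"
  proof (rule Lim_transform_eventually[OF lim])
    show "\<forall>\<^sub>F n in sequentially. (N n (F n) / mirror_scale \<beta> n ^ n) / (N n (\<lambda>_. 1) / mirror_scale \<beta> n ^ n)
        = (CLINT \<theta>|mirror_process n \<beta>. F n \<theta>)"
      using eventually_ge_at_top[of 3]
    proof eventually_elim
      case (elim n)
      then have "mirror_scale \<beta> n \<noteq> 0" using mirror_scale_pos[OF \<beta>] by fastforce
      then show ?case unfolding integral_mirror_process[OF Fm] N_def by simp
    qed
  qed
  then show ?thesis unfolding F_def A_def .
qed

text \<open>Levy's theorem asks for a distribution at every index, but nothing is assumed at
  \<open>n = 0\<close>. It is therefore applied to the sequence shifted by one, which has the same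
  limit.\<close>

lemma conv_in_law_if_char_tendsto:
  assumes "\<And>n. n > 0 \<Longrightarrow> real_distribution (distr (P n) borel (X n))" "real_distribution (distr M borel Y)"
    and char: "\<And>t. (\<lambda>n. char (distr (P n) borel (X n)) t) \<longlonglongrightarrow> char (distr M borel Y) t"
  shows "conv_in_law P X M Y"
proof -
  have "weak_conv_m (\<lambda>n. distr (P (Suc n)) borel (X (Suc n))) (distr M borel Y)"
    by (rule levy_continuity) (use assms(1,2) LIMSEQ_Suc[OF char] in auto)
  then show ?thesis
    unfolding conv_in_law_def weak_conv_m_def weak_conv_def by (auto intro: LIMSEQ_imp_Suc)
qed

text \<open>The constant \<open>c\<close> absorbs a deterministic shift of the statistic:
  \<open>\<nu>\<^sub>1\<close> for the integral against the empirical measure,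
  \<open>- \<nu>\<^sub>2\<close> when both first derivatives vanish.\<close>

lemma mirror_conv_in_law:
  fixes g :: "real \<Rightarrow> real" and w :: "nat \<Rightarrow> real" and \<nu> :: real
  assumes \<beta>: "\<beta> > 0" and g[measurable]: "g \<in> borel_measurable borel" and q: "0 < q" "q \<le> 1"
    and C2: "C2_holder_near q g (pi/2)" "C2_holder_near q g (-pi/2)"
    and w: "w \<longlonglongrightarrow> w0"
    and d: "\<And>n. n > 0 \<Longrightarrow> w n * (n * (g (pi/2) - \<nu>)) = d1" "\<And>n. n > 0 \<Longrightarrow> w n * (n * (g (-pi/2) - \<nu>)) = d2"
    and P: "\<And>n. n > 0 \<Longrightarrow> prob_space (P n)"
      "\<And>n. n > 0 \<Longrightarrow> (\<lambda>\<omega>. \<lambda>j\<in>{1..n}. \<theta> n j \<omega>) \<in> measurable (P n) (mirror_process n \<beta>)"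
      "\<And>n. n > 0 \<Longrightarrow> distr (P n) (mirror_process n \<beta>) (\<lambda>\<omega>. \<lambda>j\<in>{1..n}. \<theta> n j \<omega>) = mirror_process n \<beta>"
    and X: "\<And>n \<omega>. n > 0 \<Longrightarrow> \<omega> \<in> space (P n) \<Longrightarrow> X n \<omega> = w n * ((\<Sum>j=1..n. g (\<theta> n j \<omega>)) - \<nu> * n) + c"
    and Y: "prob_space M" "Y \<in> borel_measurable M"
      "\<And>t. char (distr M borel Y) t = iexp (t * c) *
        ((iexp (t * d1) * (iexp (t * w0 * (2 * deriv (deriv g) (pi/2) / \<beta>)) * exp (- ((t * w0 * deriv g (pi/2))\<^sup>2 / \<beta>)))
        + iexp (t * d2) * (iexp (t * w0 * (2 * deriv (deriv g) (-pi/2) / \<beta>)) * exp (- ((t * w0 * deriv g (-pi/2))\<^sup>2 / \<beta>)))) / 2)"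
  shows "conv_in_law P X M Y"
proof (rule conv_in_law_if_char_tendsto)
  define T where "T n \<omega> = (\<lambda>j\<in>{1..n}. \<theta> n j \<omega>)" for n \<omega>
  define G where "G n \<theta> = (\<Sum>j\<in>{1..n}. g (\<theta> j)) - \<nu> * n" for n and \<theta> :: "nat \<Rightarrow> real"
  have Gm[measurable]: "G n \<in> borel_measurable (lborel_pow n)" for n unfolding G_def[abs_def] by measurable
  have sets: "sets (mirror_process n \<beta>) = sets (mirror_base n)" for n by (simp add: mirror_process_def)
  have Gm': "G n \<in> borel_measurable (mirror_process n \<beta>)" for n
    using measurable_compose[OF measurable_id_mirror_base Gm] measurable_cong_sets[OF sets refl] by blast
  have XT: "X n \<omega> = w n * G n (T n \<omega>) + c" if "n > 0" "\<omega> \<in> space (P n)" for n \<omega>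
    using X[OF that] by (simp add: T_def G_def)
  have GT: "(\<lambda>\<omega>. G n (T n \<omega>)) \<in> borel_measurable (P n)" if "n > 0" for n
    using measurable_compose[OF P(2)[OF that] Gm'] by (simp add: T_def)
  have Xm: "X n \<in> borel_measurable (P n)" if "n > 0" for n
  proof -
    have "(\<lambda>\<omega>. w n * G n (T n \<omega>) + c) \<in> borel_measurable (P n)" using GT[OF that] by measurable
    then show ?thesis by (rule measurable_cong[THEN iffD2, rotated]) (rule XT[OF that])
  qed
  show "real_distribution (distr (P n) borel (X n))" if "n > 0" for n
    using prob_space.real_distribution_distr[OF P(1)[OF that] Xm[OF that]] .
  show "real_distribution (distr M borel Y)"
    using prob_space.real_distribution_distr[OF Y(1,2)] .
  fix t
  have char: "char (distr (P n) borel (X n)) t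
      = iexp (t * c) * (CLINT \<theta>|mirror_process n \<beta>. iexp (t * (w n * G n \<theta>)))" if n: "n > 0" for n
  proof -
    have "char (distr (P n) borel (X n)) t = (CLINT \<omega>|P n. iexp (t * X n \<omega>))"
      unfolding char_def using Xm[OF n] by (subst integral_distr) auto
    also have "\<dots> = (CLINT \<omega>|P n. iexp (t * c) * iexp (t * (w n * G n (T n \<omega>))))"
      by (intro Bochner_Integration.integral_cong refl) (simp add: XT[OF n] algebra_simps flip: exp_add)
    also have "\<dots> = iexp (t * c) * (CLINT \<omega>|P n. iexp (t * (w n * G n (T n \<omega>))))"
      by (rule integral_mult_right_zero)
    also have "(CLINT \<omega>|P n. iexp (t * (w n * G n (T n \<omega>))))
        = (CLINT \<theta>|distr (P n) (mirror_process n \<beta>) (T n). iexp (t * (w n * G n \<theta>)))"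
      unfolding T_def[abs_def]
      by (rule integral_distr[OF P(2)[OF n] measurable_compose[OF Gm'], symmetric]) measurable
    also have "distr (P n) (mirror_process n \<beta>) (T n) = mirror_process n \<beta>"
      using P(3)[OF n] unfolding T_def[abs_def] .
    finally show ?thesis .
  qed
  have "(\<lambda>n. iexp (t * c) * (CLINT \<theta>|mirror_process n \<beta>. iexp (t * (w n * G n \<theta>)))) \<longlonglongrightarrow> char (distr M borel Y) t"
    unfolding Y(3) G_def by (intro tendsto_mult tendsto_const mirror_char_tendsto[OF \<beta> g q C2 w d])
  moreover have "\<forall>\<^sub>F n in sequentially. iexp (t * c) * (CLINT \<theta>|mirror_process n \<beta>. iexp (t * (w n * G n \<theta>)))
      = char (distr (P n) borel (X n)) t"
    using eventually_gt_at_top[of 0] by eventually_elim (rule char[symmetric])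
  ultimately show "(\<lambda>n. char (distr (P n) borel (X n)) t) \<longlonglongrightarrow> char (distr M borel Y) t"
    by (rule Lim_transform_eventually)
qed

text \<open>On each of the events B = 1 and B = 0 the variable \<open>Y\<close> is a function of a
  single one of \<open>N1\<close>, \<open>N2\<close>, and independence from \<open>B\<close> factors
  the expectation. Constant \<open>f\<close> or \<open>h\<close> cover the cases in which a Gaussian
  degenerates to a point.\<close>

lemma char_bernoulli_mixture:
  fixes f h :: "real \<Rightarrow> real"
  assumes "prob_space M"
    and indep: "prob_space.indep_var M borel B borel N1" "prob_space.indep_var M borel B borel N2"
    and B: "measure M {\<omega> \<in> space M. B \<omega> = 0} = 1/2" "measure M {\<omega> \<in> space M. B \<omega> = 1} = 1/2"
    and [measurable]: "f \<in> borel_measurable borel" "h \<in> borel_measurable borel"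
    and [measurable]: "Y \<in> borel_measurable M"
    and Y: "\<And>\<omega>. \<omega> \<in> space M \<Longrightarrow> B \<omega> = 1 \<Longrightarrow> Y \<omega> = f (N1 \<omega>)"
           "\<And>\<omega>. \<omega> \<in> space M \<Longrightarrow> B \<omega> = 0 \<Longrightarrow> Y \<omega> = h (N2 \<omega>)"
  shows "char (distr M borel Y) t
    = ((CLINT x|distr M borel N1. iexp (t * f x)) + (CLINT x|distr M borel N2. iexp (t * h x))) / 2"
proof -
  interpret prob_space M by fact
  have [measurable]: "B \<in> borel_measurable M" "N1 \<in> borel_measurable M" "N2 \<in> borel_measurable M"
    using indep by (auto dest: indep_var_rv1 indep_var_rv2)
  \<comment> \<open>The two atoms have total mass 1, so \<open>B\<close> takes other values only on
    a null set.\<close>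
  have "prob ({\<omega> \<in> space M. B \<omega> = 0} \<union> {\<omega> \<in> space M. B \<omega> = 1}) = 1"
    using B by (subst finite_measure_Union) auto
  then have "AE \<omega> in M. \<omega> \<in> {\<omega> \<in> space M. B \<omega> = 0} \<union> {\<omega> \<in> space M. B \<omega> = 1}"
    by (subst (asm) prob_eq_1) auto
  then have AE: "AE \<omega> in M. B \<omega> = 0 \<or> B \<omega> = 1" by eventually_elim auto
  have piece: "(CLINT \<omega>|M. indicator {b} (B \<omega>) * iexp (t * f (N \<omega>))) = 1/2 * (CLINT x|distr M borel N. iexp (t * f x))"
    and piece_int: "integrable M (\<lambda>\<omega>. indicator {b} (B \<omega>) * iexp (t * f (N \<omega>)))"
    if ind: "indep_var borel B borel N" and [measurable]: "f \<in> borel_measurable borel"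
      and b: "prob {\<omega> \<in> space M. B \<omega> = b} = 1/2" for b :: real and f :: "real \<Rightarrow> real" and N
  proof -
    have [measurable]: "N \<in> borel_measurable M" using ind by (rule indep_var_rv2)
    have ind': "indep_var borel ((\<lambda>x. indicator {b} x :: complex) \<circ> B) borel ((\<lambda>x. iexp (t * f x)) \<circ> N)"
      by (rule indep_var_compose[OF ind]) measurable
    have i1: "integrable M ((\<lambda>x. indicator {b} x :: complex) \<circ> B)"
      unfolding comp_def by (intro integrable_const_bound[where B=1]) (auto simp: indicator_def)
    have i2: "integrable M ((\<lambda>x. iexp (t * f x)) \<circ> N)"
      unfolding comp_def by (intro integrable_const_bound[where B=1]) auto
    have "(CLINT \<omega>|M. indicator {b} (B \<omega>)) = complex_of_real (LINT \<omega>|M. indicator {\<omega> \<in> space M. B \<omega> = b} \<omega>)"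
      unfolding integral_complex_of_real[symmetric]
      by (intro Bochner_Integration.integral_cong refl) (auto simp: indicator_def)
    also have "\<dots> = 1/2" by (simp add: b)
    finally have e: "(CLINT \<omega>|M. indicator {b} (B \<omega>)) = 1/2" .
    have "(CLINT \<omega>|M. indicator {b} (B \<omega>) * iexp (t * f (N \<omega>))) = (CLINT \<omega>|M. indicator {b} (B \<omega>)) * (CLINT \<omega>|M. iexp (t * f (N \<omega>)))"
      using indep_var_lebesgue_integral[OF ind' i1 i2] by (simp add: comp_def)
    also have "(CLINT \<omega>|M. iexp (t * f (N \<omega>))) = (CLINT x|distr M borel N. iexp (t * f x))"
      by (subst integral_distr) auto
    finally show "(CLINT \<omega>|M. indicator {b} (B \<omega>) * iexp (t * f (N \<omega>))) = 1/2 * (CLINT x|distr M borel N. iexp (t * f x))"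
      unfolding e .
    show "integrable M (\<lambda>\<omega>. indicator {b} (B \<omega>) * iexp (t * f (N \<omega>)))"
      using indep_var_integrable[OF ind' i1 i2] by (simp add: comp_def)
  qed
  have "char (distr M borel Y) t = (CLINT \<omega>|M. iexp (t * Y \<omega>))"
    unfolding char_def by (subst integral_distr) auto
  also have "\<dots> = (CLINT \<omega>|M. indicator {1} (B \<omega>) * iexp (t * f (N1 \<omega>)) + indicator {0} (B \<omega>) * iexp (t * h (N2 \<omega>)))"
  proof (rule integral_cong_AE)
    show "AE \<omega> in M. iexp (t * Y \<omega>) = indicator {1} (B \<omega>) * iexp (t * f (N1 \<omega>)) + indicator {0} (B \<omega>) * iexp (t * h (N2 \<omega>))"
      using AE AE_space by eventually_elim (auto simp: Y)
  qed measurable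
  also have "\<dots> = (CLINT \<omega>|M. indicator {1} (B \<omega>) * iexp (t * f (N1 \<omega>))) + (CLINT \<omega>|M. indicator {0} (B \<omega>) * iexp (t * h (N2 \<omega>)))"
    by (intro Bochner_Integration.integral_add piece_int indep B assms)
  finally show ?thesis
    unfolding piece[OF indep(1) assms(6) B(2)] piece[OF indep(2) assms(7) B(1)] by simp
qed

text \<open>The truncation \<open>max 0 w\<close> reflects \<open>ennreal\<close>, which sends
  negative weights to 0. For the weights \<open>B\<close> and \<open>1 - B\<close> this concerns
  only outcomes with \<open>B\<close> outside [0, 1].\<close>

lemma integral_dirac_sum:
  assumes [measurable]: "f \<in> borel_measurable borel"
  shows "(LINT x|dirac_sum ps. f x) = (\<Sum>(w, x)\<leftarrow>ps. max 0 w * f x)"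
proof -
  have fin: "(\<Sum>(w, x)\<leftarrow>ps. ennreal w * ennreal (h x)) = ennreal (\<Sum>(w, x)\<leftarrow>ps. max 0 w * h x)"
    if "\<And>x. 0 \<le> h x" for h :: "real \<Rightarrow> real"
  proof (induction ps)
    case (Cons p ps)
    obtain w x where p: "p = (w, x)" by (cases p)
    have nn: "0 \<le> (\<Sum>(w, x)\<leftarrow>ps. max 0 w * h x)" using that by (intro sum_list_nonneg) auto
    have "ennreal w * ennreal (h x) = ennreal (max 0 w * h x)"
      using that by (auto simp: ennreal_mult' max_def ennreal_neg)
    then show ?case using Cons nn that by (simp add: p ennreal_plus)
  qed simp
  have nn: "(\<Sum>(w, x)\<leftarrow>ps. max 0 w * h x) \<ge> 0" if "\<And>x. 0 \<le> h x" for h :: "real \<Rightarrow> real"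
    using that by (intro sum_list_nonneg) auto
  have I: "(\<integral>\<^sup>+ x. ennreal (h x) \<partial>dirac_sum ps) = ennreal (\<Sum>(w, x)\<leftarrow>ps. max 0 w * h x)"
    if "h \<in> borel_measurable borel" "\<And>x. 0 \<le> h x" for h :: "real \<Rightarrow> real"
    using that fin[of h] by (subst nn_integral_dirac_sum) auto
  have m: "f \<in> borel_measurable (dirac_sum ps)" by (simp cong: measurable_cong_sets)
  have "integrable (dirac_sum ps) f"
    using m I[of "\<lambda>x. \<bar>f x\<bar>"] by (intro integrableI_bounded) auto
  then have "(LINT x|dirac_sum ps. f x) = enn2real (\<integral>\<^sup>+ x. ennreal (max 0 (f x)) \<partial>dirac_sum ps)
      - enn2real (\<integral>\<^sup>+ x. ennreal (max 0 (- f x)) \<partial>dirac_sum ps)"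
    by (subst real_lebesgue_integral_def) (simp_all add: ennreal_max_0 )
  also have "\<dots> = (\<Sum>(w, x)\<leftarrow>ps. max 0 w * max 0 (f x)) - (\<Sum>(w, x)\<leftarrow>ps. max 0 w * max 0 (- f x))"
    using nn[of "\<lambda>x. max 0 (f x)"] nn[of "\<lambda>x. max 0 (- f x)"]
      I[of "\<lambda>x. max 0 (f x)"] I[of "\<lambda>x. max 0 (- f x)"] by simp
  also have "\<dots> = (\<Sum>(w, x)\<leftarrow>ps. max 0 w * f x)"
    by (induction ps) (auto simp: max_def algebra_simps)
  finally show ?thesis .
qed

section \<open>The four regimes of the fluctuations\<close>

theorem theorem1p6:
  fixes \<beta> q \<nu>\<^sub>1 \<nu>\<^sub>2 :: real
    and g :: "real \<Rightarrow> real"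
    and P :: "nat \<Rightarrow> 'b measure" and \<theta> :: "nat \<Rightarrow> nat \<Rightarrow> 'b \<Rightarrow> real"
    and M :: "'a measure" and B N\<^sub>1 N\<^sub>2 :: "'a \<Rightarrow> real"
  assumes "\<beta> > 0"
    and "g \<in> borel_measurable borel"
    and "\<And>x. g (x + 2 * pi) = g x"
    and "bounded (range g)"
    and "0 < q" "q \<le> 1"
    and "C2_holder_near q g (pi/2)"
    and "C2_holder_near q g (-pi/2)"
    and "\<And>n. n > 0 \<Longrightarrow> prob_space (P n)"
    and "\<And>n. n > 0 \<Longrightarrow> (\<lambda>\<omega>. \<lambda>j\<in>{1..n}. \<theta> n j \<omega>) \<in> measurable (P n) (mirror_process n \<beta>)"
    and "\<And>n. n > 0 \<Longrightarrow>
           distr (P n) (mirror_process n \<beta>) (\<lambda>\<omega>. \<lambda>j\<in>{1..n}. \<theta> n j \<omega>) = mirror_process n \<beta>"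
    and "prob_space M"
    and "prob_space.indep_vars M (\<lambda>_. borel) (\<lambda>i. [B, N\<^sub>1, N\<^sub>2] ! i) {..<3}"
    and "measure M {\<omega> \<in> space M. B \<omega> = 0} = 1/2"
    and "measure M {\<omega> \<in> space M. B \<omega> = 1} = 1/2"
    and "distr M borel N\<^sub>1 =
           gaussian_law (2 * deriv (deriv g) (pi/2) / \<beta>) (2 * (deriv g (pi/2))\<^sup>2 / \<beta>)"
    and "distr M borel N\<^sub>2 =
           gaussian_law (2 * deriv (deriv g) (-pi/2) / \<beta>) (2 * (deriv g (-pi/2))\<^sup>2 / \<beta>)"
    and "\<nu>\<^sub>1 = (g (pi/2) + g (-pi/2)) / 2"
    and "\<nu>\<^sub>2 = (deriv (deriv g) (pi/2) + deriv (deriv g) (-pi/2)) / \<beta>"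
  shows
    "conv_in_law
       P (\<lambda>n \<omega>. LINT x:{-pi<..pi}|dirac_sum (map (\<lambda>j. (1 / real n, \<theta> n j \<omega>)) [1..<Suc n]). g x)
       M (\<lambda>\<omega>. LINT x:{-pi<..pi}|dirac_sum [(B \<omega>, pi/2), (1 - B \<omega>, -pi/2)]. g x)
     \<and>
     conv_in_law
       P (\<lambda>n \<omega>. inverse (real n) * ((\<Sum>j=1..n. g (\<theta> n j \<omega>)) - \<nu>\<^sub>1 * real n))
       M (\<lambda>\<omega>. (g (pi/2) - g (-pi/2)) / 2 * (2 * B \<omega> - 1))
     \<and>
     (g (pi/2) = g (-pi/2) \<and> deriv g (pi/2) \<noteq> 0 \<and> deriv g (-pi/2) \<noteq> 0 \<longrightarrow>
        conv_in_law
          P (\<lambda>n \<omega>. (\<Sum>j=1..n. g (\<theta> n j \<omega>)) - \<nu>\<^sub>1 * real n)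
          M (\<lambda>\<omega>. B \<omega> * N\<^sub>1 \<omega> + (1 - B \<omega>) * N\<^sub>2 \<omega>))
     \<and>
     (g (pi/2) = g (-pi/2) \<and> deriv g (pi/2) = deriv g (-pi/2) \<and> deriv g (-pi/2) \<noteq> 0 \<and>
      deriv (deriv g) (pi/2) = deriv (deriv g) (-pi/2) \<longrightarrow>
        distr M borel N\<^sub>1 = distr M borel N\<^sub>2 \<and>
        conv_in_law
          P (\<lambda>n \<omega>. (\<Sum>j=1..n. g (\<theta> n j \<omega>)) - \<nu>\<^sub>1 * real n)
          M N\<^sub>1)
     \<and>
     (g (pi/2) = g (-pi/2) \<and> deriv g (pi/2) \<noteq> 0 \<and> deriv g (-pi/2) = 0 \<longrightarrow>
        conv_in_law
          P (\<lambda>n \<omega>. (\<Sum>j=1..n. g (\<theta> n j \<omega>)) - \<nu>\<^sub>1 * real n)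
          M (\<lambda>\<omega>. B \<omega> * N\<^sub>1 \<omega> + (1 - B \<omega>) * (2 * deriv (deriv g) (-pi/2) / \<beta>)))
     \<and>
     (g (pi/2) = g (-pi/2) \<and> deriv g (-pi/2) \<noteq> 0 \<and> deriv g (pi/2) = 0 \<longrightarrow>
        conv_in_law
          P (\<lambda>n \<omega>. (\<Sum>j=1..n. g (\<theta> n j \<omega>)) - \<nu>\<^sub>1 * real n)
          M (\<lambda>\<omega>. B \<omega> * (2 * deriv (deriv g) (pi/2) / \<beta>) + (1 - B \<omega>) * N\<^sub>2 \<omega>))
     \<and>
     (g (pi/2) = g (-pi/2) \<and> deriv g (pi/2) = 0 \<and> deriv g (-pi/2) = 0 \<longrightarrow>
        conv_in_law
          P (\<lambda>n \<omega>. (\<Sum>j=1..n. g (\<theta> n j \<omega>)) - (\<nu>\<^sub>1 * real n + \<nu>\<^sub>2))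
          M (\<lambda>\<omega>. (deriv (deriv g) (pi/2) - deriv (deriv g) (-pi/2)) / \<beta> * (2 * B \<omega> - 1)))"
proof -
  note \<beta> = assms(1) and g = assms(2) and q = assms(5,6) and C2 = assms(7,8) and P = assms(9,10,11)
    and \<nu>\<^sub>1 = assms(18) and \<nu>\<^sub>2 = assms(19)
  note [measurable] = g
  define gp gm where "gp = g (pi/2)" and "gm = g (-pi/2)"
  interpret prob_space M by (rule assms(12))
  \<comment> \<open>The mixture formula takes the pairs of \<open>B\<close> with one Gaussian, which
    are extracted from the joint independence.\<close>
  have ind: "indep_var borel B borel N\<^sub>1" "indep_var borel B borel N\<^sub>2"
  proof -
    let ?X = "\<lambda>i. [B, N\<^sub>1, N\<^sub>2] ! i"
    have "indep_var borel (?X 0) borel (?X i)" if i: "i \<in> {1, 2}" for i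
    proof -
      have "indep_var (PiM {0} (\<lambda>_. borel)) (\<lambda>\<omega>. \<lambda>j\<in>{0}. ?X j \<omega>) (PiM {i} (\<lambda>_. borel)) (\<lambda>\<omega>. \<lambda>j\<in>{i}. ?X j \<omega>)"
        using i by (intro indep_var_restrict[OF assms(13)]) auto
      then have "indep_var borel ((\<lambda>f. f 0) \<circ> (\<lambda>\<omega>. \<lambda>j\<in>{0}. ?X j \<omega>)) borel ((\<lambda>f. f i) \<circ> (\<lambda>\<omega>. \<lambda>j\<in>{i}. ?X j \<omega>))"
        by (rule indep_var_compose) simp_all
      then show ?thesis by (simp add: comp_def)
    qed
    from this[of 1] this[of 2] show "indep_var borel B borel N\<^sub>1" "indep_var borel B borel N\<^sub>2" by simp_all
  qed
  have [measurable]: "B \<in> borel_measurable M" "N\<^sub>1 \<in> borel_measurable M" "N\<^sub>2 \<in> borel_measurable M"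
    using ind by (auto dest: indep_var_rv1 indep_var_rv2)
  \<comment> \<open>Needed for the set integral in (a): its indicator equals 1 at every
    point.\<close>
  have range: "\<theta> n j \<omega> \<in> {-pi<..pi}" if "n > 0" "j \<in> {1..n}" "\<omega> \<in> space (P n)" for n j \<omega>
  proof -
    have "(\<lambda>j\<in>{1..n}. \<theta> n j \<omega>) \<in> space (mirror_process n \<beta>)"
      using measurable_space[OF P(2)[OF that(1)] that(3)] .
    also have "space (mirror_process n \<beta>) = {1..n} \<rightarrow>\<^sub>E {-pi<..pi}"
      by (simp add: mirror_process_def mirror_base_def space_PiM space_restrict_space)
    finally show ?thesis using that(2) by (auto dest: PiE_mem)
  qed
  define \<phi> where "\<phi> a t = iexp (t * (2 * deriv (deriv g) a / \<beta>)) * exp (- ((t * deriv g a)\<^sup>2 / \<beta>))" for a t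
  have char_N: "(CLINT x|distr M borel N\<^sub>1. iexp (t * x)) = \<phi> (pi/2) t" "(CLINT x|distr M borel N\<^sub>2. iexp (t * x)) = \<phi> (-pi/2) t" for t
  proof -
    have "t\<^sup>2 * (2 * d\<^sup>2 / \<beta>) / 2 = (t * d)\<^sup>2 / \<beta>" for d by (simp add: power_mult_distrib)
    then show "(CLINT x|distr M borel N\<^sub>1. iexp (t * x)) = \<phi> (pi/2) t" "(CLINT x|distr M borel N\<^sub>2. iexp (t * x)) = \<phi> (-pi/2) t"
      using \<beta> unfolding char_def[symmetric] assms(16,17) \<phi>_def by (simp_all only: char_gaussian_law zero_le_divide_iff zero_le_power2 zero_le_mult_iff zero_le_numeral simp_thms less_imp_le)
  qed
  have const_N: "(CLINT x|distr M borel N. iexp (t * d)) = iexp (t * d)" if "N \<in> borel_measurable M" for N t and d :: real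
    using prob_space.prob_space[OF prob_space_distr[OF that]] by (simp del: distr_const)
  note const_N = const_N[OF \<open>N\<^sub>1 \<in> borel_measurable M\<close>] const_N[OF \<open>N\<^sub>2 \<in> borel_measurable M\<close>]
  have \<phi>0: "\<phi> a t = iexp (t * (2 * deriv (deriv g) a / \<beta>))" if "deriv g a = 0" for a t
    using that by (simp add: \<phi>_def)
  note mixture = char_bernoulli_mixture[OF assms(12) ind assms(14,15)]
  \<comment> \<open>Common to both forms of (a): with scaling 1/n the Gaussian fluctuations vanish
    and only the values of \<open>g\<close> at the two centres remain.\<close>
  have mean_law: "conv_in_law P X M Y"
    if X: "\<And>n \<omega>. n > 0 \<Longrightarrow> \<omega> \<in> space (P n) \<Longrightarrow> X n \<omega> = inverse (real n) * ((\<Sum>j=1..n. g (\<theta> n j \<omega>)) - \<nu>\<^sub>1 * n) + c"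
      and Ym[measurable]: "Y \<in> borel_measurable M"
      and Y: "\<And>\<omega>. B \<omega> = 1 \<Longrightarrow> Y \<omega> = c + (gp - gm) / 2" "\<And>\<omega>. B \<omega> = 0 \<Longrightarrow> Y \<omega> = c + (gm - gp) / 2"
    for X Y c
  proof (rule mirror_conv_in_law[OF \<beta> g q C2 _ _ _ P X assms(12)])
    show "(\<lambda>n. inverse (real n)) \<longlonglongrightarrow> 0" by real_asymp
    show "inverse (real n) * (real n * (g (pi/2) - \<nu>\<^sub>1)) = (gp - gm) / 2" "inverse (real n) * (real n * (g (-pi/2) - \<nu>\<^sub>1)) = (gm - gp) / 2"
      if "n > 0" for n
      using that by (simp_all add: \<nu>\<^sub>1 gp_def gm_def field_simps)
    fix t
    have "char (distr M borel Y) t = (iexp (t * (c + (gp - gm) / 2)) + iexp (t * (c + (gm - gp) / 2))) / 2"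
      by (subst mixture[where f="\<lambda>_. c + (gp - gm) / 2" and h="\<lambda>_. c + (gm - gp) / 2"]) ((simp only: const_N) | (simp add: Y))+
    also have "\<dots> = iexp (t * c) * ((iexp (t * ((gp - gm) / 2)) + iexp (t * ((gm - gp) / 2))) / 2)"
      by (simp only: distrib_left of_real_add exp_add times_divide_eq_right)
    finally show "char (distr M borel Y) t = iexp (t * c) *
        ((iexp (t * ((gp - gm) / 2)) * (iexp (t * 0 * (2 * deriv (deriv g) (pi/2) / \<beta>)) * exp (- ((t * 0 * deriv g (pi/2))\<^sup>2 / \<beta>)))
        + iexp (t * ((gm - gp) / 2)) * (iexp (t * 0 * (2 * deriv (deriv g) (-pi/2) / \<beta>)) * exp (- ((t * 0 * deriv g (-pi/2))\<^sup>2 / \<beta>)))) / 2)"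
      by simp
  qed (assumption | rule Ym)+
  \<comment> \<open>Common to (b), (c) and (d): equal values of \<open>g\<close> at the centres
    remove the term of order n, and the limit is the even mixture of the two Gaussian laws, shifted
    by \<open>c\<close>.\<close>
  have sum_law: "conv_in_law P X M Y"
    if eq: "g (pi/2) = g (-pi/2)"
      and X: "\<And>n \<omega>. X n \<omega> = (\<Sum>j=1..n. g (\<theta> n j \<omega>)) - \<nu>\<^sub>1 * n + c"
      and Y[measurable]: "Y \<in> borel_measurable M"
      and char: "\<And>t. char (distr M borel Y) t = iexp (t * c) * ((\<phi> (pi/2) t + \<phi> (-pi/2) t) / 2)"
    for X Y c
  proof (rule mirror_conv_in_law[OF \<beta> g q C2 tendsto_const[of 1] _ _ P _ assms(12) Y])
    show "1 * (real n * (g (pi/2) - \<nu>\<^sub>1)) = 0" "1 * (real n * (g (-pi/2) - \<nu>\<^sub>1)) = 0" for n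
      using eq by (simp_all add: \<nu>\<^sub>1)
    show "X n \<omega> = 1 * ((\<Sum>j=1..n. g (\<theta> n j \<omega>)) - \<nu>\<^sub>1 * n) + c" for n \<omega> by (simp add: X)
    show "char (distr M borel Y) t = iexp (t * c) *
        ((iexp (t * 0) * (iexp (t * 1 * (2 * deriv (deriv g) (pi/2) / \<beta>)) * exp (- ((t * 1 * deriv g (pi/2))\<^sup>2 / \<beta>)))
        + iexp (t * 0) * (iexp (t * 1 * (2 * deriv (deriv g) (-pi/2) / \<beta>)) * exp (- ((t * 1 * deriv g (-pi/2))\<^sup>2 / \<beta>)))) / 2)" for t
      unfolding char \<phi>_def by simp
  qed
  have dirac: "(LINT x:{-pi<..pi}|dirac_sum ps. g x) = (\<Sum>(w, x)\<leftarrow>ps. max 0 w * (indicator {-pi<..pi} x * g x))" for ps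
    unfolding set_lebesgue_integral_def by (subst integral_dirac_sum) simp_all
  show ?thesis
  proof (intro conjI impI; (elim conjE)?)
    show "conv_in_law
       P (\<lambda>n \<omega>. LINT x:{-pi<..pi}|dirac_sum (map (\<lambda>j. (1 / real n, \<theta> n j \<omega>)) [1..<Suc n]). g x)
       M (\<lambda>\<omega>. LINT x:{-pi<..pi}|dirac_sum [(B \<omega>, pi/2), (1 - B \<omega>, -pi/2)]. g x)"
      unfolding dirac
    \<comment> \<open>The integral against the empirical measure is the uncentred average, so
      \<open>c\<close> adds the centring back; the limit values become \<open>gp\<close> and
      \<open>gm\<close>.\<close>
    proof (rule mean_law[of _ "\<nu>\<^sub>1"])
      fix n :: nat and \<omega> assume n: "n > 0" and \<omega>: "\<omega> \<in> space (P n)"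
      have "(\<Sum>(w, x)\<leftarrow>map (\<lambda>j. (1 / real n, \<theta> n j \<omega>)) [1..<Suc n]. max 0 w * (indicator {-pi<..pi} x * g x))
          = (\<Sum>j\<leftarrow>[1..<Suc n]. max 0 (1 / real n) * (indicator {-pi<..pi} (\<theta> n j \<omega>) * g (\<theta> n j \<omega>)))"
        by (simp only: map_map comp_def prod.case)
      also have "\<dots> = (\<Sum>j\<in>set [1..<Suc n]. max 0 (1 / real n) * (indicator {-pi<..pi} (\<theta> n j \<omega>) * g (\<theta> n j \<omega>)))"
        by (rule sum_list_distinct_conv_sum_set) simp
      also have "\<dots> = (\<Sum>j=1..n. 1 / real n * g (\<theta> n j \<omega>))"
      proof (rule sum.cong)
        show "set [1..<Suc n] = {1..n}" by auto
        fix j assume "j \<in> {1..n}"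
        from range[OF n this \<omega>] show "max 0 (1 / real n) * (indicator {-pi<..pi} (\<theta> n j \<omega>) * g (\<theta> n j \<omega>)) = 1 / real n * g (\<theta> n j \<omega>)"
          by (simp add: max_def)
      qed
      also have "\<dots> = inverse (real n) * ((\<Sum>j=1..n. g (\<theta> n j \<omega>)) - \<nu>\<^sub>1 * n) + \<nu>\<^sub>1"
        using n unfolding sum_distrib_left[symmetric] by (simp add: inverse_eq_divide right_diff_distrib)
      finally show "(\<Sum>(w, x)\<leftarrow>map (\<lambda>j. (1 / real n, \<theta> n j \<omega>)) [1..<Suc n]. max 0 w * (indicator {-pi<..pi} x * g x))
          = inverse (real n) * ((\<Sum>j=1..n. g (\<theta> n j \<omega>)) - \<nu>\<^sub>1 * n) + \<nu>\<^sub>1" .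
    next
      show "(\<lambda>\<omega>. \<Sum>(w, x)\<leftarrow>[(B \<omega>, pi/2), (1 - B \<omega>, -pi/2)]. max 0 w * (indicator {-pi<..pi} x * g x)) \<in> borel_measurable M"
        by simp measurable
    qed (simp_all add: \<nu>\<^sub>1 gp_def gm_def field_simps)
    show "conv_in_law
       P (\<lambda>n \<omega>. inverse (real n) * ((\<Sum>j=1..n. g (\<theta> n j \<omega>)) - \<nu>\<^sub>1 * real n))
       M (\<lambda>\<omega>. (g (pi/2) - g (-pi/2)) / 2 * (2 * B \<omega> - 1))"
      by (rule mean_law[of _ 0]) (simp_all add: gp_def gm_def field_simps)
    show "conv_in_law P (\<lambda>n \<omega>. (\<Sum>j=1..n. g (\<theta> n j \<omega>)) - \<nu>\<^sub>1 * real n)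
          M (\<lambda>\<omega>. B \<omega> * N\<^sub>1 \<omega> + (1 - B \<omega>) * N\<^sub>2 \<omega>)"
      if "g (pi/2) = g (-pi/2)"
      by (rule sum_law[of _ 0, OF that]; (subst mixture[where f="\<lambda>x. x" and h="\<lambda>x. x"])?)
        ((simp only: char_N mult_zero_right of_real_0 exp_zero mult_1) | simp)+
    show "distr M borel N\<^sub>1 = distr M borel N\<^sub>2"
      if "deriv g (pi/2) = deriv g (-pi/2)" "deriv (deriv g) (pi/2) = deriv (deriv g) (-pi/2)"
      unfolding assms(16,17) that ..
    show "conv_in_law P (\<lambda>n \<omega>. (\<Sum>j=1..n. g (\<theta> n j \<omega>)) - \<nu>\<^sub>1 * real n) M N\<^sub>1"
      if "g (pi/2) = g (-pi/2)" "deriv g (pi/2) = deriv g (-pi/2)" "deriv (deriv g) (pi/2) = deriv (deriv g) (-pi/2)"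
    proof (rule sum_law[of _ 0, OF that(1)])
      \<comment> \<open>Equal derivatives make the two components of the mixture coincide, so the
        coin disappears.\<close>
      show "char (distr M borel N\<^sub>1) t = iexp (t * 0) * ((\<phi> (pi/2) t + \<phi> (-pi/2) t) / 2)" for t
        using char_N(1)[of t] that by (simp only: char_def) (simp add: \<phi>_def)
    qed simp_all
    show "conv_in_law P (\<lambda>n \<omega>. (\<Sum>j=1..n. g (\<theta> n j \<omega>)) - \<nu>\<^sub>1 * real n)
          M (\<lambda>\<omega>. B \<omega> * N\<^sub>1 \<omega> + (1 - B \<omega>) * (2 * deriv (deriv g) (-pi/2) / \<beta>))"
      if "g (pi/2) = g (-pi/2)" "deriv g (-pi/2) = 0"
      by (rule sum_law[of _ 0, OF that(1)]; (subst mixture[where f="\<lambda>x. x" and h="\<lambda>_. 2 * deriv (deriv g) (-pi/2) / \<beta>"])?)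
        ((simp only: char_N const_N \<phi>0[OF that(2)] mult_zero_right of_real_0 exp_zero mult_1) | simp)+
    show "conv_in_law P (\<lambda>n \<omega>. (\<Sum>j=1..n. g (\<theta> n j \<omega>)) - \<nu>\<^sub>1 * real n)
          M (\<lambda>\<omega>. B \<omega> * (2 * deriv (deriv g) (pi/2) / \<beta>) + (1 - B \<omega>) * N\<^sub>2 \<omega>)"
      if "g (pi/2) = g (-pi/2)" "deriv g (pi/2) = 0"
      by (rule sum_law[of _ 0, OF that(1)]; (subst mixture[where f="\<lambda>_. 2 * deriv (deriv g) (pi/2) / \<beta>" and h="\<lambda>x. x"])?)
        ((simp only: char_N const_N \<phi>0[OF that(2)] mult_zero_right of_real_0 exp_zero mult_1) | simp)+
    show "conv_in_law P (\<lambda>n \<omega>. (\<Sum>j=1..n. g (\<theta> n j \<omega>)) - (\<nu>\<^sub>1 * real n + \<nu>\<^sub>2))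
          M (\<lambda>\<omega>. (deriv (deriv g) (pi/2) - deriv (deriv g) (-pi/2)) / \<beta> * (2 * B \<omega> - 1))"
      if "g (pi/2) = g (-pi/2)" "deriv g (pi/2) = 0" "deriv g (-pi/2) = 0"
    proof (rule sum_law[of _ "- \<nu>\<^sub>2", OF that(1)])
      fix t
      \<comment> \<open>After subtraction of \<open>\<nu>\<^sub>2\<close> the two values are plus
        and minus (g''(pi/2) - g''(-pi/2))/\<beta>, the values of the limit for B = 1 and B =
        0.\<close>
      let ?f1 = "2 * deriv (deriv g) (pi/2) / \<beta> - \<nu>\<^sub>2" and ?f2 = "2 * deriv (deriv g) (-pi/2) / \<beta> - \<nu>\<^sub>2"
      have "char (distr M borel (\<lambda>\<omega>. (deriv (deriv g) (pi/2) - deriv (deriv g) (-pi/2)) / \<beta> * (2 * B \<omega> - 1))) t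
          = (iexp (t * ?f1) + iexp (t * ?f2)) / 2"
        by (subst mixture[where f="\<lambda>_. ?f1" and h="\<lambda>_. ?f2"]) ((simp only: const_N) | (simp add: \<nu>\<^sub>2 add_divide_distrib diff_divide_distrib))+
      also have "\<dots> = iexp (t * - \<nu>\<^sub>2) * ((\<phi> (pi/2) t + \<phi> (-pi/2) t) / 2)"
      proof -
        have "iexp (t * (u - \<nu>\<^sub>2)) = iexp (t * - \<nu>\<^sub>2) * iexp (t * u)" for u
          unfolding exp_add[symmetric] by (rule arg_cong[where f=exp]) (simp add: algebra_simps)
        then show ?thesis
          unfolding \<phi>0[OF that(2)] \<phi>0[OF that(3)] by (simp only: distrib_left times_divide_eq_right)
      qed
      finally show "char (distr M borel (\<lambda>\<omega>. (deriv (deriv g) (pi/2) - deriv (deriv g) (-pi/2)) / \<beta> * (2 * B \<omega> - 1))) t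
        = iexp (t * - \<nu>\<^sub>2) * ((\<phi> (pi/2) t + \<phi> (-pi/2) t) / 2)" .
    qed simp_all
  qed
qed

end
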